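(* The space of left $\mathcal{O}_q(\mathrm{SU}_3)$-coinvariant $2$-forms $\{\omega\in\Omega^2_q(\mathrm{F}_3):\Delta_L(\omega)=1\otimes\omega\}$ is three-dimensional. The corresponding space of $\mathcal{O}(\mathbb{T}^2)$-coinvariant degree-$2$ elements of the quantum exterior algebra $V^\bullet$ is spanned by $$f_{\alpha_1}\wedge e_{\alpha_1},\qquad f_{\alpha_2}\wedge e_{\alpha_2},\qquad f_{\alpha_1+\alpha_2}\wedge e_{\alpha_1+\alpha_2}.$$
   Context: Let $q\in\mathbb{R}\setminus\{-1,0,1\}$. Let $\Delta^+=\{\alpha_1,\alpha_2,\alpha_1+\alpha_2\}$ be the positive roots of $\mathfrak{sl}_3$, with Cartan matrix $a_{11}=a_{22}=2$, $a_{12}=a_{21}=-1$. $U_q(\mathfrak{sl}_3)$ is the complex algebra generated by $E_i,F_i,K_i^{\pm1}$ ($i=1,2$) with $K_iK_j=K_jK_i$, $K_iE_j=q^{a_{ij}}E_jK_i$, $K_iF_j=q^{-a_{ij}}F_jK_i$, $[E_i,F_j]=\delta_{ij}\frac{K_i-K_i^{-1}}{q-q^{-1}}$, and $E_i^2E_j-(q+q^{-1})E_iE_jE_i+E_jE_i^2=0$, $F_i^2F_j-(q+q^{-1})F_iF_jF_i+F_jF_i^2=0$ for $i\ne j$. It is a Hopf $*$-algebra with $\Delta(E_i)=E_i\otimes K_i+1\otimes E_i$, $\Delta(F_i)=F_i\otimes1+K_i^{-1}\otimes F_i$, $\Delta(K_i)=K_i\otimes K_i$, $\varepsilon(E_i)=\varepsilon(F_i)=0$,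 $\varepsilon(K_i)=1$, $E_i^*=K_iF_i$, $F_i^*=E_iK_i^{-1}$, $K_i^*=K_i$. $A:=\mathcal{O}_q(\mathrm{SU}_3)$ is the Hopf subalgebra of the Hopf dual of $U_q(\mathfrak{sl}_3)$ generated by $u_{ij}$ ($1\le i,j\le3$), where $\Delta(u_{ij})=\sum_a u_{ia}\otimes u_{aj}$ and the only nonzero pairings of the $u_{ij}$ with the generators are $\langle E_1,u_{21}\rangle=\langle E_2,u_{32}\rangle=\langle F_1,u_{12}\rangle=\langle F_2,u_{23}\rangle=1$, $\langle K_i^{\pm1},u_{jj}\rangle=q^{\pm(\delta_{i,j-1}-\delta_{ij})}$. Put $X\triangleright a:=a_{(1)}\langle X,a_{(2)}\rangle$. Then $B:=\mathcal{O}_q(\mathrm{F}_3):=\{b\in A: K_i^{\pm1}\triangleright b=b,\ i=1,2\}$, a quantum homogeneous space with $\pi_B(A):=A/B^+A\cong\mathcal{O}(\mathbb{T}^2)$ (written $\mathcal{O}_q(\mathbb{T}^2)$ in places). Put $E_{\alpha_i}:=E_i$, $E_{\alpha_1+\alpha_2}:=E_2E_1-q^{-1}E_1E_2$, $F_\gamma:=E_\gamma^*$, and $T:=\mathrm{span}_{\mathbb{C}}\{E_\gamma,F_\gamma:\gamma\in\Delta^+\}$. $T$ defines the left $A$-covariant first-order differential calculus $\Omega^1_q(\mathrm{SU}_3)=A\otimes\Lambda^1$ over $A$: $\Lambda^1:=A^+/\{y\in A^+:X(y)=0\ \forall X\in T\}$ (with $A^+=\ker\varepsilon$) is a right $A$-module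 with basis $\{e_\gamma,f_\gamma\}$ dual to $\{E_\gamma,F_\gamma\}$, the bimodule structure is $a(b\otimes v)c=abc_{(1)}\otimes vc_{(2)}$, the left coaction is $\Delta\otimes\mathrm{id}$, and $\mathrm{d}a=\sum_\gamma (E_\gamma\triangleright a)\otimes e_\gamma+(F_\gamma\triangleright a)\otimes f_\gamma$. $\Omega^1_q(\mathrm{F}_3)$ is its restriction to $B$ (the $B$-sub-bimodule generated by $\mathrm{d}b$, $b\in B$), and $\Omega^\bullet_q(\mathrm{F}_3)$ is the maximal prolongation: the quotient of the tensor algebra of the $B$-bimodule $\Omega^1_q(\mathrm{F}_3)$ by the ideal generated by all $\sum_i\mathrm{d}b_i\otimes\mathrm{d}c_i$ with $\sum_ib_i\,\mathrm{d}c_i=0$; $\Delta_L$ is its left $A$-coaction. With $I:=\{y\in B^+:X(y)=0\ \forall X\in T\}$ the cotangent space is $V^1:=B^+/I$, with left $\pi_B(A)$-coaction $[b]\mapsto\pi_B(b_{(1)})\otimes[b_{(2)}]$, identified with $\Lambda^1$ via $[b]\mapsto[b]$ (an isomorphism). For $a\in A$ write $a^+:=a-\varepsilon(a)1$. The quantum exterior algebra is $V^\bullet:=\mathcal{T}(V^1)/\langle I^{(2)}\rangle$, $I^{(2)}:=\{[y_{(1)}^+]\otimes[y_{(2)}^+]:y\in I\}$, with product $\wedge$ and the induced $\pi_B(A)$-coaction. Takeuchi's equivalence identifies $\Omega^k_q(\mathrm{F}_3)$ with $A\square_{\pi_B(A)}V^k$, and coinvariant $k$-forms correspond to elements $1\otimes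 v$ with $v\in V^k$ coinvariant. *)

theory Defs
  imports Complex_Main
    "HOL-Library.Poly_Mapping"
    "HOL-Library.Function_Algebras"
    "HOL-Library.Product_Plus"
begin

section \<open>Free algebras and their quotients\<close>

text \<open>Words form a monoid under concatenation, written additively because
  \<open>'k \<Rightarrow>\<^sub>0 complex\<close> is the monoid algebra of an additively written monoid.
  Thus \<open>'a word \<Rightarrow>\<^sub>0 complex\<close> is the free unital complex algebra on \<open>'a\<close>,
  i.e. the tensor algebra of the free vector space on \<open>'a\<close>.\<close>

datatype 'a word = Word (letters: "'a list")

instantiation word :: (type) monoid_add
begin

definition zero_word :: "'a word" where "0 = Word []"

definition plus_word :: "'a word \<Rightarrow> 'a word \<Rightarrow> 'a word"
  where "v + w = Word (letters v @ letters w)"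

instance by standard (simp_all add: zero_word_def plus_word_def)

end

type_synonym 'a free_alg = "'a word \<Rightarrow>\<^sub>0 complex"

definition mon :: "'a word \<Rightarrow> 'a free_alg"
  where "mon w = Poly_Mapping.single w 1"

definition lett :: "'a \<Rightarrow> 'a free_alg"
  where "lett x = mon (Word [x])"

definition fscale :: "complex \<Rightarrow> ('k \<Rightarrow>\<^sub>0 complex) \<Rightarrow> ('k \<Rightarrow>\<^sub>0 complex)"
  where "fscale c x = Poly_Mapping.map ((*) c) x"

lemma lookup_fscale [simp]:
  "Poly_Mapping.lookup (fscale c x) k = c * Poly_Mapping.lookup x k"
  unfolding fscale_def by transfer (simp add: when_def)

global_interpretation flin: vector_space fscale
  by standard (auto intro!: poly_mapping_eqI simp: lookup_add algebra_simps)

definition ideal_gen :: "'a set \<Rightarrow> 'a free_alg set \<Rightarrow> 'a free_alg set"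
  where "ideal_gen M S = flin.span {mon u * s * mon v | u s v.
     set (letters u) \<subseteq> M \<and> s \<in> S \<and> set (letters v) \<subseteq> M}"

definition cls :: "'v::ab_group_add set \<Rightarrow> 'v \<Rightarrow> 'v set"
  where "cls J x = {y. y - x \<in> J}"

definition qspan :: "('k \<Rightarrow>\<^sub>0 complex) set \<Rightarrow> ('k \<Rightarrow>\<^sub>0 complex) set set \<Rightarrow> ('k \<Rightarrow>\<^sub>0 complex) set set"
  where "qspan J S = cls J ` flin.span {x. cls J x \<in> S}"

text \<open>\<open>Q\<close> is an \<open>n\<close>-dimensional space of cosets of \<open>J\<close>, with basis
  \<open>cls J (b 0), \<dots>, cls J (b (n - 1))\<close>.\<close>

definition qdim :: "('k \<Rightarrow>\<^sub>0 complex) set \<Rightarrow> ('k \<Rightarrow>\<^sub>0 complex) set set \<Rightarrow> nat \<Rightarrow> bool"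
  where "qdim J Q n \<longleftrightarrow> (\<exists>b.
     Q = qspan J ((\<lambda>i. cls J (b i)) ` {..<n}) \<and>
     (\<forall>c. cls J (\<Sum>i<n. fscale (c i) (b i)) = cls J 0 \<longrightarrow> (\<forall>i<n. c i = 0)))"


section \<open>The Hopf algebra \<open>U\<^sub>q(sl\<^sub>3)\<close>\<close>

datatype node = N1 | N2

fun num :: "node \<Rightarrow> nat"
  where "num N1 = 1" | "num N2 = 2"

datatype gen = E node | F node | K node | Kinv node

definition cartan :: "node \<Rightarrow> node \<Rightarrow> int"
  where "cartan i j = (if i = j then 2 else -1)"

definition Uq_rels :: "real \<Rightarrow> gen free_alg set"
  where "Uq_rels q = (let q = complex_of_real q;
       e = \<lambda>i. lett (E i); f = \<lambda>i. lett (F i); k = \<lambda>i. lett (K i); k' = \<lambda>i. lett (Kinv i) in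
     {k i * k' i - 1 | i. True} \<union> {k' i * k i - 1 | i. True} \<union>
     {k i * k j - k j * k i | i j. True} \<union>
     {k i * e j - fscale (q powi cartan i j) (e j * k i) | i j. True} \<union>
     {k i * f j - fscale (q powi (- cartan i j)) (f j * k i) | i j. True} \<union>
     {e i * f j - f j * e i - (if i = j then fscale (1 / (q - 1 / q)) (k i - k' i) else 0) | i j. True} \<union>
     {e i * e i * e j - fscale (q + 1 / q) (e i * e j * e i) + e j * e i * e i | i j. i \<noteq> j} \<union>
     {f i * f i * f j - fscale (q + 1 / q) (f i * f j * f i) + f j * f i * f i | i j. i \<noteq> j})"

definition Uq_ideal :: "real \<Rightarrow> gen free_alg set"
  where "Uq_ideal q = ideal_gen UNIV (Uq_rels q)"

text \<open>The structure maps are given on the free algebra; they descend to the quotient by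
  \<^const>\<open>Uq_ideal\<close>. The tensor square of the free algebra is the monoid algebra of the monoid of
  pairs of words. The antipode is the one determined by the coproduct.\<close>

fun cop_gen :: "gen \<Rightarrow> gen word \<times> gen word \<Rightarrow>\<^sub>0 complex"
  where
    "cop_gen (E i) = Poly_Mapping.single (Word [E i], Word [K i]) 1 + Poly_Mapping.single (0, Word [E i]) 1"
  | "cop_gen (F i) = Poly_Mapping.single (Word [F i], 0) 1 + Poly_Mapping.single (Word [Kinv i], Word [F i]) 1"
  | "cop_gen (K i) = Poly_Mapping.single (Word [K i], Word [K i]) 1"
  | "cop_gen (Kinv i) = Poly_Mapping.single (Word [Kinv i], Word [Kinv i]) 1"

definition cop_word :: "gen word \<Rightarrow> gen word \<times> gen word \<Rightarrow>\<^sub>0 complex"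
  where "cop_word w = prod_list (map cop_gen (letters w))"

fun eps_gen :: "gen \<Rightarrow> complex"
  where "eps_gen (E i) = 0" | "eps_gen (F i) = 0" | "eps_gen (K i) = 1" | "eps_gen (Kinv i) = 1"

fun antipode_gen :: "gen \<Rightarrow> gen free_alg"
  where
    "antipode_gen (E i) = - (lett (E i) * lett (Kinv i))"
  | "antipode_gen (F i) = - (lett (K i) * lett (F i))"
  | "antipode_gen (K i) = lett (Kinv i)"
  | "antipode_gen (Kinv i) = lett (K i)"

definition antipode_word :: "gen word \<Rightarrow> gen free_alg"
  where "antipode_word w = prod_list (rev (map antipode_gen (letters w)))"

fun star_gen :: "gen \<Rightarrow> gen free_alg"
  where
    "star_gen (E i) = lett (K i) * lett (F i)"
  | "star_gen (F i) = lett (E i) * lett (Kinv i)"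
  | "star_gen (K i) = lett (K i)"
  | "star_gen (Kinv i) = lett (Kinv i)"

definition star :: "gen free_alg \<Rightarrow> gen free_alg"
  where "star X = (\<Sum>w\<in>Poly_Mapping.keys X.
     fscale (cnj (Poly_Mapping.lookup X w)) (prod_list (rev (map star_gen (letters w)))))"


section \<open>The Hopf dual and \<open>O\<^sub>q(SU\<^sub>3)\<close>\<close>

text \<open>A linear functional on the free algebra is given by its values on words; functionals on
  \<open>U\<^sub>q(sl\<^sub>3)\<close> are those vanishing on \<^const>\<open>Uq_ideal\<close>. Addition of functionals is pointwise, but
  their product is the convolution \<open>\<star>\<close>, not the pointwise product \<open>*\<close>.\<close>

type_synonym fnl = "gen word \<Rightarrow> complex"

definition pair :: "gen free_alg \<Rightarrow> fnl \<Rightarrow> complex"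
  where "pair X a = (\<Sum>w\<in>Poly_Mapping.keys X. Poly_Mapping.lookup X w * a w)"

definition csc :: "complex \<Rightarrow> fnl \<Rightarrow> fnl"
  where "csc c a = (\<lambda>w. c * a w)"

definition conv :: "fnl \<Rightarrow> fnl \<Rightarrow> fnl"  (infixl \<open>\<star>\<close> 70)
  where "a \<star> b = (\<lambda>w. \<Sum>p\<in>Poly_Mapping.keys (cop_word w).
     Poly_Mapping.lookup (cop_word w) p * a (fst p) * b (snd p))"

definition unit :: fnl
  where "unit = (\<lambda>w. prod_list (map eps_gen (letters w)))"

definition antip :: "fnl \<Rightarrow> fnl"
  where "antip a = (\<lambda>w. pair (antipode_word w) a)"

definition counit :: "fnl \<Rightarrow> complex"
  where "counit a = a 0"

definition plus_part :: "fnl \<Rightarrow> fnl"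
  where "plus_part a = a - csc (counit a) unit"

text \<open>\<open>sweedler H H' a ps\<close>: the finite list \<open>ps\<close> of pairs in \<open>H \<times> H'\<close> represents the coproduct
  \<open>a\<^sub>(\<^sub>1\<^sub>) \<otimes> a\<^sub>(\<^sub>2\<^sub>)\<close>, which is characterised by
  \<open>\<langle>XY, a\<rangle> = \<langle>X, a\<^sub>(\<^sub>1\<^sub>)\<rangle> \<langle>Y, a\<^sub>(\<^sub>2\<^sub>)\<rangle>\<close>.\<close>

definition sweedler :: "fnl set \<Rightarrow> fnl set \<Rightarrow> fnl \<Rightarrow> (fnl \<times> fnl) list \<Rightarrow> bool"
  where "sweedler H H' a ps \<longleftrightarrow> set ps \<subseteq> H \<times> H' \<and>
     (\<forall>X Y. a (X + Y) = (\<Sum>(x, y)\<leftarrow>ps. x X * y Y))"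

definition Uq_dual :: "real \<Rightarrow> fnl set"
  where "Uq_dual q = {a. \<forall>X\<in>Uq_ideal q. pair X a = 0}"

definition hopf_dual :: "real \<Rightarrow> fnl set"
  where "hopf_dual q = {a \<in> Uq_dual q. \<exists>ps. sweedler (Uq_dual q) (Uq_dual q) a ps}"

definition hopf_subalgebra :: "real \<Rightarrow> fnl set \<Rightarrow> bool"
  where "hopf_subalgebra q H \<longleftrightarrow> H \<subseteq> hopf_dual q \<and> unit \<in> H \<and>
     (\<forall>a\<in>H. \<forall>b\<in>H. a + b \<in> H \<and> a \<star> b \<in> H) \<and>
     (\<forall>a\<in>H. (\<forall>c. csc c a \<in> H) \<and> antip a \<in> H \<and> (\<exists>ps. sweedler H H a ps))"

fun u_gen :: "real \<Rightarrow> gen \<Rightarrow> nat \<Rightarrow> nat \<Rightarrow> complex"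
  where
    "u_gen q (E i) k l = of_bool (k = num i + 1 \<and> l = num i)"
  | "u_gen q (F i) k l = of_bool (k = num i \<and> l = num i + 1)"
  | "u_gen q (K i) k l = (if k = l
       then complex_of_real q powi (of_bool (l = num i + 1) - of_bool (l = num i)) else 0)"
  | "u_gen q (Kinv i) k l = (if k = l
       then complex_of_real q powi (- (of_bool (l = num i + 1) - of_bool (l = num i))) else 0)"

fun u_list :: "real \<Rightarrow> nat \<Rightarrow> nat \<Rightarrow> gen list \<Rightarrow> complex"
  where
    "u_list q k l [] = of_bool (k = l)"
  | "u_list q k l (g # gs) = (\<Sum>m\<in>{1..3}. u_gen q g k m * u_list q m l gs)"

definition u_coef :: "real \<Rightarrow> nat \<Rightarrow> nat \<Rightarrow> fnl"
  where "u_coef q k l = (\<lambda>w. u_list q k l (letters w))"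

definition OqSU3 :: "real \<Rightarrow> fnl set"
  where "OqSU3 q = \<Inter>{H. hopf_subalgebra q H \<and> (\<forall>k\<in>{1..3}. \<forall>l\<in>{1..3}. u_coef q k l \<in> H)}"

definition OqSU3_plus :: "real \<Rightarrow> fnl set"
  where "OqSU3_plus q = {a \<in> OqSU3 q. counit a = 0}"

text \<open>\<open>X \<triangleright> a = a\<^sub>(\<^sub>1\<^sub>) \<langle>X, a\<^sub>(\<^sub>2\<^sub>)\<rangle>\<close>, i.e. \<open>\<langle>Y, X \<triangleright> a\<rangle> = \<langle>YX, a\<rangle>\<close>.\<close>

definition act :: "gen free_alg \<Rightarrow> fnl \<Rightarrow> fnl"  (infixr \<open>\<triangleright>\<close> 75)
  where "X \<triangleright> a = (\<lambda>Y. pair (mon Y * X) a)"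

definition OqF3 :: "real \<Rightarrow> fnl set"
  where "OqF3 q = {b \<in> OqSU3 q. \<forall>i. lett (K i) \<triangleright> b = b \<and> lett (Kinv i) \<triangleright> b = b}"

definition OqF3_plus :: "real \<Rightarrow> fnl set"
  where "OqF3_plus q = {b \<in> OqF3 q. counit b = 0}"

text \<open>The subspace \<open>B\<^sup>+A\<close> of \<open>A\<close>, the kernel of \<open>\<pi>\<^sub>B\<close>.\<close>

definition BplusA :: "real \<Rightarrow> fnl set"
  where "BplusA q = {\<Sum>(b, a)\<leftarrow>ps. b \<star> a | ps. set ps \<subseteq> OqF3_plus q \<times> OqSU3 q}"


section \<open>First-order calculus\<close>

datatype root = A1 | A2 | A12

datatype rvec = Eix root | Fix root

fun Evec :: "real \<Rightarrow> root \<Rightarrow> gen free_alg"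
  where
    "Evec q A1 = lett (E N1)"
  | "Evec q A2 = lett (E N2)"
  | "Evec q A12 = lett (E N2) * lett (E N1)
       - fscale (1 / complex_of_real q) (lett (E N1) * lett (E N2))"

fun Xvec :: "real \<Rightarrow> rvec \<Rightarrow> gen free_alg"
  where
    "Xvec q (Eix \<gamma>) = Evec q \<gamma>"
  | "Xvec q (Fix \<gamma>) = star (Evec q \<gamma>)"

definition Tspace :: "real \<Rightarrow> gen free_alg set"
  where "Tspace q = flin.span (range (Xvec q))"

text \<open>The class of \<open>y \<in> A\<^sup>+\<close> in \<open>\<Lambda>\<^sup>1 = A\<^sup>+/{y. X(y) = 0 for X \<in> T}\<close>, written in coordinates with
  respect to the basis dual to the root vectors: the quotient by the kernel is realised as the
  image of \<open>y \<mapsto> (X(y))\<^sub>X\<close>.\<close>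

type_synonym coords = "rvec \<Rightarrow> complex"

definition cot :: "real \<Rightarrow> fnl \<Rightarrow> coords"
  where "cot q y = (\<lambda>r. pair (Xvec q r) y)"

definition unitvec :: "rvec \<Rightarrow> coords"
  where "unitvec r = (\<lambda>s. of_bool (s = r))"

definition e_form :: "root \<Rightarrow> coords" where "e_form \<gamma> = unitvec (Eix \<gamma>)"
definition f_form :: "root \<Rightarrow> coords" where "f_form \<gamma> = unitvec (Fix \<gamma>)"

text \<open>\<open>Lambda_act q r c\<close> is the product of the basis vector \<open>r\<close> of \<open>\<Lambda>\<^sup>1\<close> with \<open>c \<in> A\<close>,
  computed as \<open>[y] c = [y c]\<close> on a representative.\<close>

definition Lambda_rep :: "real \<Rightarrow> rvec \<Rightarrow> fnl"
  where "Lambda_rep q r = (SOME y. y \<in> OqSU3_plus q \<and> cot q y = unitvec r)"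

definition Lambda_act :: "real \<Rightarrow> rvec \<Rightarrow> fnl \<Rightarrow> coords"
  where "Lambda_act q r c = cot q (Lambda_rep q r \<star> c)"

text \<open>An element \<open>\<Sum>\<^sub>r a\<^sub>r \<otimes> r\<close> of \<open>A \<otimes> \<Lambda>\<^sup>1\<close> is the family of its coefficients \<open>a\<^sub>r \<in> A\<close>.\<close>

type_synonym form1 = "rvec \<Rightarrow> fnl"

definition lmult :: "fnl \<Rightarrow> form1 \<Rightarrow> form1"
  where "lmult b \<omega> = (\<lambda>r. b \<star> \<omega> r)"

definition rmult :: "real \<Rightarrow> form1 \<Rightarrow> fnl \<Rightarrow> form1"
  where "rmult q \<omega> c = (\<lambda>s. \<Sum>r\<in>UNIV.
     \<Sum>(c1, c2)\<leftarrow>(SOME ps. sweedler (OqSU3 q) (OqSU3 q) c ps).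
       csc (Lambda_act q r c2 s) (\<omega> r \<star> c1))"

definition diff :: "real \<Rightarrow> fnl \<Rightarrow> form1"
  where "diff q a = (\<lambda>r. Xvec q r \<triangleright> a)"

inductive_set Omega1 :: "real \<Rightarrow> form1 set" for q
  where
    diff: "b \<in> OqF3 q \<Longrightarrow> diff q b \<in> Omega1 q"
  | add: "\<omega> \<in> Omega1 q \<Longrightarrow> \<eta> \<in> Omega1 q \<Longrightarrow> \<omega> + \<eta> \<in> Omega1 q"
  | left: "b \<in> OqF3 q \<Longrightarrow> \<omega> \<in> Omega1 q \<Longrightarrow> lmult b \<omega> \<in> Omega1 q"
  | right: "b \<in> OqF3 q \<Longrightarrow> \<omega> \<in> Omega1 q \<Longrightarrow> rmult q \<omega> b \<in> Omega1 q"


section \<open>Tensor algebras and coactions on them\<close>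

text \<open>For a complex vector space with carrier \<open>M\<close> and scaling \<open>sc\<close>, the tensor algebra \<open>T(M)\<close> is
  the free algebra on the letters \<open>M\<close> modulo the linear relations \<open>lin_rels sc M\<close>;
  \<open>words_deg M k\<close> spans its component of degree \<open>k\<close>.\<close>

definition lin_rels :: "(complex \<Rightarrow> 'm \<Rightarrow> 'm) \<Rightarrow> 'm::plus set \<Rightarrow> 'm free_alg set"
  where "lin_rels sc M = {lett (x + y) - lett x - lett y | x y. x \<in> M \<and> y \<in> M} \<union>
     {lett (sc c x) - fscale c (lett x) | c x. x \<in> M}"

definition words_on :: "'m set \<Rightarrow> 'm free_alg set"
  where "words_on M = {x. \<forall>w\<in>Poly_Mapping.keys x. set (letters w) \<subseteq> M}"

definition words_deg :: "'m set \<Rightarrow> nat \<Rightarrow> 'm free_alg set"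
  where "words_deg M k = {x \<in> words_on M. \<forall>w\<in>Poly_Mapping.keys x. length (letters w) = k}"

text \<open>\<open>A \<otimes> T\<close>, for \<open>T\<close> with basis the words, is the space of finitely supported \<open>A\<close>-valued
  functions on words.\<close>

definition otimes :: "fnl \<Rightarrow> 'm free_alg \<Rightarrow> 'm word \<Rightarrow>\<^sub>0 fnl"
  where "otimes a x = Poly_Mapping.map (\<lambda>c. csc c a) x"

definition otimes_set :: "fnl set \<Rightarrow> 'm free_alg set \<Rightarrow> ('m word \<Rightarrow>\<^sub>0 fnl) set"
  where "otimes_set N P = {\<Sum>(a, x)\<leftarrow>ps. otimes a x | ps. set ps \<subseteq> N \<times> P}"

text \<open>A coaction \<open>\<delta>\<close> on letters, with values represented by finite lists of elementary tensors,
  is extended by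
  \<open>m\<^sub>1 \<dots> m\<^sub>k \<mapsto> (m\<^sub>1)\<^sub>(\<^sub>-\<^sub>1\<^sub>) \<dots> (m\<^sub>k)\<^sub>(\<^sub>-\<^sub>1\<^sub>) \<otimes> (m\<^sub>1)\<^sub>(\<^sub>0\<^sub>) \<dots> (m\<^sub>k)\<^sub>(\<^sub>0\<^sub>)\<close>.\<close>

fun coact_list :: "('m \<Rightarrow> (fnl \<times> 'm) list) \<Rightarrow> 'm list \<Rightarrow> (fnl \<times> 'm list) list"
  where
    "coact_list \<delta> [] = [(unit, [])]"
  | "coact_list \<delta> (m # ms) =
       concat (map (\<lambda>(a, n). map (\<lambda>(b, ns). (a \<star> b, n # ns)) (coact_list \<delta> ms)) (\<delta> m))"

definition coact :: "('m \<Rightarrow> (fnl \<times> 'm) list) \<Rightarrow> 'm free_alg \<Rightarrow> 'm word \<Rightarrow>\<^sub>0 fnl"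
  where "coact \<delta> x = (\<Sum>w\<in>Poly_Mapping.keys x.
     \<Sum>(a, ms)\<leftarrow>coact_list \<delta> (letters w).
       Poly_Mapping.single (Word ms) (csc (Poly_Mapping.lookup x w) a))"

text \<open>The elements of degree \<open>k\<close> of the quotient by \<open>J\<close> that are coinvariant for the induced left
  coaction of the quotient \<open>H/N\<close>. Here \<open>(H/N) \<otimes> (T/J)\<close> is the quotient of \<open>H \<otimes> T\<close> by
  \<open>N \<otimes> T + H \<otimes> J\<close>. The values of \<open>\<delta>\<close> matter only up to this subspace.\<close>

definition coinvariants ::
  "fnl set \<Rightarrow> fnl set \<Rightarrow> ('m \<Rightarrow> (fnl \<times> 'm) list) \<Rightarrow> 'm set \<Rightarrow> 'm free_alg set \<Rightarrow> nat \<Rightarrow> 'm free_alg set set"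
  where "coinvariants H N \<delta> M J k = (let Z = {s + t | s t. s \<in> otimes_set N (words_on M) \<and> t \<in> otimes_set H J}
     in {cls J x | x. x \<in> words_deg M k \<and> cls Z (coact \<delta> x) = cls Z (otimes unit x)})"


section \<open>The maximal prolongation \<open>\<Omega>\<^sup>\<bullet>\<^sub>q(F\<^sub>3)\<close>\<close>

text \<open>In degrees \<open>k \<ge> 1\<close>, the tensor algebra of the \<open>B\<close>-bimodule \<open>\<Omega>\<^sup>1\<close> is the complex tensor algebra
  of \<open>\<Omega>\<^sup>1\<close> modulo the ideal generated by the balancing relations
  \<open>\<omega>b \<otimes> \<eta> - \<omega> \<otimes> b\<eta>\<close>. (Its degree \<open>0\<close> component is \<open>B\<close> and not \<open>\<complex>\<close>, which is why the generators of
  the second ideal are multiplied by elements of \<open>B\<close> on both sides.)\<close>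

definition balance_rels :: "real \<Rightarrow> form1 free_alg set"
  where "balance_rels q = {lett (rmult q \<omega> b) * lett \<eta> - lett \<omega> * lett (lmult b \<eta>) | \<omega> b \<eta>.
     \<omega> \<in> Omega1 q \<and> b \<in> OqF3 q \<and> \<eta> \<in> Omega1 q}"

definition prolongation_rels :: "real \<Rightarrow> form1 free_alg set"
  where "prolongation_rels q =
     {\<Sum>(b, c)\<leftarrow>ps. lett (lmult x (diff q b)) * lett (rmult q (diff q c) y) | ps x y.
        set ps \<subseteq> OqF3 q \<times> OqF3 q \<and> (\<Sum>(b, c)\<leftarrow>ps. lmult b (diff q c)) = 0 \<and>
        x \<in> OqF3 q \<and> y \<in> OqF3 q}"

definition Omega_ideal :: "real \<Rightarrow> form1 free_alg set"
  where "Omega_ideal q = ideal_gen (Omega1 q)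
     (lin_rels (\<lambda>c \<omega> r. csc c (\<omega> r)) (Omega1 q) \<union> balance_rels q \<union> prolongation_rels q)"

text \<open>\<open>\<Delta>\<^sub>L(\<Sum>\<^sub>r a\<^sub>r \<otimes> r) = \<Sum>\<^sub>r (a\<^sub>r)\<^sub>(\<^sub>1\<^sub>) \<otimes> ((a\<^sub>r)\<^sub>(\<^sub>2\<^sub>) \<otimes> r)\<close>, as a finite list of elements of
  \<open>A \<times> \<Omega>\<^sup>1\<close>.\<close>

definition coact_form :: "real \<Rightarrow> form1 \<Rightarrow> (fnl \<times> form1) list"
  where "coact_form q \<omega> = (SOME ps. set ps \<subseteq> OqSU3 q \<times> Omega1 q \<and>
     (\<forall>X Y r. \<omega> r (X + Y) = (\<Sum>(a, \<eta>)\<leftarrow>ps. a X * \<eta> r Y)))"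

text \<open>The left \<open>O\<^sub>q(SU\<^sub>3)\<close>-coinvariant \<open>k\<close>-forms, for \<open>k \<ge> 1\<close>.\<close>

definition Omega_coinv :: "real \<Rightarrow> nat \<Rightarrow> form1 free_alg set set"
  where "Omega_coinv q k =
     coinvariants (OqSU3 q) {0} (coact_form q) (Omega1 q) (Omega_ideal q) k"


section \<open>The quantum exterior algebra \<open>V\<^sup>\<bullet>\<close>\<close>

definition cot_ideal :: "real \<Rightarrow> fnl set"
  where "cot_ideal q = {y \<in> OqF3_plus q. \<forall>X\<in>Tspace q. pair X y = 0}"

text \<open>\<open>V\<^sup>1 = B\<^sup>+/I\<close>, with \<open>I\<close> = \<^const>\<open>cot_ideal\<close>, realised as the image of \<open>B\<^sup>+\<close> in \<open>\<Lambda>\<^sup>1\<close>.\<close>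

definition V1 :: "real \<Rightarrow> coords set"
  where "V1 q = cot q ` OqF3_plus q"

definition I2 :: "real \<Rightarrow> coords free_alg set"
  where "I2 q = {\<Sum>(y1, y2)\<leftarrow>ps. lett (cot q (plus_part y1)) * lett (cot q (plus_part y2)) | y ps.
     y \<in> cot_ideal q \<and> sweedler (OqSU3 q) (OqSU3 q) y ps}"

definition V_ideal :: "real \<Rightarrow> coords free_alg set"
  where "V_ideal q = ideal_gen (V1 q) (lin_rels (\<lambda>c v r. c * v r) (V1 q) \<union> I2 q)"

definition coact_cot :: "real \<Rightarrow> coords \<Rightarrow> (fnl \<times> coords) list"
  where "coact_cot q v = (SOME ps. \<exists>b qs. b \<in> OqF3_plus q \<and> cot q b = v \<and>
     sweedler (OqSU3 q) (OqF3 q) b qs \<and> ps = map (\<lambda>(x, y). (x, cot q (plus_part y))) qs)"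

text \<open>The elements of \<open>V\<^sup>k\<close> coinvariant for \<open>\<pi>\<^sub>B(A) = A/B\<^sup>+A\<close>.\<close>

definition V_coinv :: "real \<Rightarrow> nat \<Rightarrow> coords free_alg set set"
  where "V_coinv q k =
     coinvariants (OqSU3 q) (BplusA q) (coact_cot q) (V1 q) (V_ideal q) k"

definition wedge :: "real \<Rightarrow> coords \<Rightarrow> coords \<Rightarrow> coords free_alg set"
  where "wedge q v w = cls (V_ideal q) (lett v * lett w)"

end

theory Submission
  imports Defs
begin

text \<open>Everything is reduced to the finite-dimensional space \<open>W\<close> (\<open>quad_rels\<close> below) of matrices
  \<open>(\<langle>X\<^sub>t X\<^sub>s, y\<rangle>)\<^sub>t\<^sub>s\<close>, \<open>y \<in> I\<close>, indexed by pairs of root vectors. The coproducts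
  \<open>\<Delta>(X\<^sub>s) = \<Sum>\<^sub>r X\<^sub>r \<otimes> G\<^sub>r\<^sub>s + 1 \<otimes> X\<^sub>s\<close> give \<open>V\<^sup>2 = \<complex>\<^sup>6\<^sup>\<times>\<^sup>6/W\<close>, and \<open>\<Omega>\<^sup>2\<close> embeds into
  \<open>A \<otimes> (\<complex>\<^sup>6\<^sup>\<times>\<^sup>6/W)\<close> by moving the coefficients of the second factor to the left; the inverse uses
  \<open>a \<otimes> [b] = \<Sum> a S(b\<^sub>(\<^sub>1\<^sub>)) d b\<^sub>(\<^sub>2\<^sub>)\<close>, whose coefficients lie in \<open>B\<close> when \<open>a\<close> and \<open>b\<close> have the same weight.
  On both sides coinvariance forces the matrix to have weight zero modulo \<open>W\<close>. The weight-zero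
  matrices are spanned by \<open>e\<^sub>\<gamma> \<otimes> f\<^sub>\<gamma>\<close> and \<open>f\<^sub>\<gamma> \<otimes> e\<^sub>\<gamma>\<close>; the elements \<open>u\<^sub>i\<^sub>j S(u\<^sub>j\<^sub>i)\<close> of \<open>I\<close> express the former through
  the latter modulo \<open>W\<close>, and the commutators \<open>[E\<^sub>\<gamma>, F\<^sub>\<gamma>]\<close> show that the latter remain independent.\<close>

section \<open>Finite sums over lists\<close>

lemma sum_list_mem:
  fixes S :: "'a::monoid_add set"
  assumes "0 \<in> S" "\<And>x y. x \<in> S \<Longrightarrow> y \<in> S \<Longrightarrow> x + y \<in> S" "\<And>i. i \<in> set is \<Longrightarrow> f i \<in> S"
  shows "(\<Sum>i\<leftarrow>is. f i) \<in> S"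
  using assms(3) by (induction "is") (auto intro: assms(1,2))

lemma (in module) subspace_sum_list:
  assumes "subspace S" "\<And>i. i \<in> set is \<Longrightarrow> f i \<in> S"
  shows "(\<Sum>i\<leftarrow>is. f i) \<in> S"
  using assms by (intro sum_list_mem) (auto simp: subspace_0 subspace_add)

lemma (in module) scale_sum_list: "a *s (\<Sum>i\<leftarrow>is. f i) = (\<Sum>i\<leftarrow>is. a *s f i)"
  by (induction "is") (simp_all add: scale_right_distrib)

lemma sum_list_swap: "(\<Sum>x\<leftarrow>xs. \<Sum>y\<leftarrow>ys. f x y) = (\<Sum>y\<leftarrow>ys. \<Sum>x\<leftarrow>xs. f x y)"
  for f :: "'a \<Rightarrow> 'b \<Rightarrow> 'c::comm_monoid_add"
  by (induction xs) (simp_all add: sum_list_addf)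

lemma sum_list_concat_map: "(\<Sum>p\<leftarrow>concat (map h xs). g p) = (\<Sum>x\<leftarrow>xs. \<Sum>p\<leftarrow>h x. g p)"
  for g :: "'b \<Rightarrow> 'c::comm_monoid_add"
  by (induction xs) simp_all

lemma sum_list_product: "(\<Sum>p\<leftarrow>List.product xs ys. f p) = (\<Sum>x\<leftarrow>xs. \<Sum>y\<leftarrow>ys. f (x, y))"
  for f :: "'a \<times> 'b \<Rightarrow> 'c::comm_monoid_add"
  by (simp add: product_concat_map sum_list_concat_map comp_def)

lemma sum_list_times: "(\<Sum>x\<leftarrow>xs. f x) * (\<Sum>y\<leftarrow>ys. g y) = (\<Sum>x\<leftarrow>xs. \<Sum>y\<leftarrow>ys. f x * g y)"
  for f :: "'a \<Rightarrow> 'c::semiring_0"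
  by (simp add: sum_list_const_mult flip: sum_list_mult_const)

lemma sum_fun_apply [simp]: "(\<Sum>i\<in>S. f i) x = (\<Sum>i\<in>S. f i x)"
  by (induction S rule: infinite_finite_induct) simp_all

lemma sum_list_fun_apply: "(\<Sum>i\<leftarrow>is. f i) x = (\<Sum>i\<leftarrow>is. f i x)"
  by (induction "is") simp_all

section \<open>Linear extension from a monoid basis\<close>

definition lin_ext :: "('k \<Rightarrow> complex) \<Rightarrow> ('k \<Rightarrow>\<^sub>0 complex) \<Rightarrow> complex"
  where "lin_ext f x = (\<Sum>k\<in>Poly_Mapping.keys x. Poly_Mapping.lookup x k * f k)"

lemma lin_ext_superset:
  assumes "finite S" "Poly_Mapping.keys x \<subseteq> S"
  shows "lin_ext f x = (\<Sum>k\<in>S. Poly_Mapping.lookup x k * f k)"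
  unfolding lin_ext_def using assms
  by (intro sum.mono_neutral_left) (auto simp: in_keys_iff)

lemma lin_ext_add [simp]: "lin_ext f (x + y) = lin_ext f x + lin_ext f y"
proof -
  let ?S = "Poly_Mapping.keys x \<union> Poly_Mapping.keys y"
  have "lin_ext f z = (\<Sum>k\<in>?S. Poly_Mapping.lookup z k * f k)" if "z \<in> {x, y, x + y}" for z
    using that keys_add[of x y] by (intro lin_ext_superset) auto
  then show ?thesis
    by (simp add: lookup_add algebra_simps sum.distrib)
qed

lemma lin_ext_zero [simp]: "lin_ext f 0 = 0"
  by (simp add: lin_ext_def)

lemma lin_ext_single [simp]: "lin_ext f (Poly_Mapping.single k c) = c * f k"
  by (cases "c = 0") (simp_all add: lin_ext_def)

lemma lin_ext_fscale [simp]: "lin_ext f (fscale c x) = c * lin_ext f x"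
proof -
  have "lin_ext f (fscale c x) = (\<Sum>k\<in>Poly_Mapping.keys x. Poly_Mapping.lookup (fscale c x) k * f k)"
    by (intro lin_ext_superset) (auto simp: in_keys_iff)
  then show ?thesis
    by (simp add: lin_ext_def sum_distrib_left mult.assoc)
qed

lemma lin_ext_uminus [simp]: "lin_ext f (- x) = - lin_ext f x"
  using lin_ext_add[of f x "- x"] by (simp add: eq_neg_iff_add_eq_0 add.commute)

lemma lin_ext_minus [simp]: "lin_ext f (x - y) = lin_ext f x - lin_ext f y"
  using lin_ext_add[of f x "- y"] by simp

lemma lin_ext_sum [simp]: "lin_ext f (sum g S) = (\<Sum>i\<in>S. lin_ext f (g i))"
  by (induction S rule: infinite_finite_induct) auto

lemma lin_ext_sum_list: "lin_ext f (\<Sum>i\<leftarrow>is. g i) = (\<Sum>i\<leftarrow>is. lin_ext f (g i))"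
  by (induction "is") auto

lemma poly_mapping_decomp:
  fixes x :: "'k \<Rightarrow>\<^sub>0 'b::comm_monoid_add"
  shows "x = (\<Sum>k\<in>Poly_Mapping.keys x. Poly_Mapping.single k (Poly_Mapping.lookup x k))"
  by (rule poly_mapping_eqI) (simp add: lookup_sum lookup_single when_def in_keys_iff)

lemma poly_mapping_single_induct [case_names zero single add]:
  fixes x :: "'k \<Rightarrow>\<^sub>0 'b::comm_monoid_add"
  assumes "P 0" "\<And>k c. P (Poly_Mapping.single k c)" "\<And>x y. P x \<Longrightarrow> P y \<Longrightarrow> P (x + y)"
  shows "P x"
proof -
  have "P (\<Sum>k\<in>S. Poly_Mapping.single k (f k))" if "finite S" for S f
    using that by induction (auto intro: assms)
  from this[of "Poly_Mapping.keys x" "Poly_Mapping.lookup x"] show ?thesis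
    by (subst poly_mapping_decomp) simp
qed

lemma lin_ext_mult: "lin_ext f (x * y) = lin_ext (\<lambda>k. lin_ext (\<lambda>l. f (k + l)) y) x"
  for x y :: "'k::monoid_add \<Rightarrow>\<^sub>0 complex"
proof (induction x rule: poly_mapping_single_induct)
  case (single k c)
  show ?case
    by (induction y rule: poly_mapping_single_induct) (simp_all add: mult_single algebra_simps)
qed (simp_all add: algebra_simps)

lemma lin_ext_mult_left [simp]: "lin_ext (\<lambda>k. c * f k) x = c * lin_ext f x"
  by (simp add: lin_ext_def sum_distrib_left algebra_simps)

lemma lin_ext_mult_right [simp]: "lin_ext (\<lambda>k. f k * c) x = lin_ext f x * c"
  by (simp add: lin_ext_def sum_distrib_right algebra_simps)

lemma lin_ext_add_fun: "lin_ext (\<lambda>k. f k + g k) x = lin_ext f x + lin_ext g x"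
  by (simp add: lin_ext_def sum.distrib algebra_simps)

lemma lin_ext_uminus_fun: "lin_ext (\<lambda>k. - f k) x = - lin_ext f x"
  using lin_ext_mult_left[of "-1" f x] by simp

lemma lin_ext_minus_fun: "lin_ext (\<lambda>k. f k - g k) x = lin_ext f x - lin_ext g x"
  by (simp add: lin_ext_def sum_subtractf algebra_simps)

lemma lin_ext_zero_fun [simp]: "lin_ext (\<lambda>k. 0) x = 0"
  by (simp add: lin_ext_def)

lemma lin_ext_sum_list_fun: "lin_ext (\<lambda>k. \<Sum>i\<leftarrow>is. f i k) x = (\<Sum>i\<leftarrow>is. lin_ext (f i) x)"
  by (induction "is") (simp_all add: lin_ext_add_fun)

lemma lin_ext_mon [simp]: "lin_ext f (mon w) = f w"
  by (simp add: mon_def)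

lemma lin_ext_lett [simp]: "lin_ext f (lett g) = f (Word [g])"
  by (simp add: lett_def)

lemma lin_ext_one [simp]: "lin_ext f 1 = f 0"
  using lin_ext_single[of f 0 1] by (simp del: lin_ext_single)

lemma pair_eq_lin_ext: "pair X a = lin_ext a X"
  by (simp add: pair_def lin_ext_def)

lemma conv_eq_lin_ext: "(a \<star> b) w = lin_ext (\<lambda>p. a (fst p) * b (snd p)) (cop_word w)"
  by (simp add: conv_def lin_ext_def mult.assoc)

section \<open>Words and free algebras\<close>

lemma word_plus [simp]: "Word xs + Word ys = Word (xs @ ys)"
  by (simp add: plus_word_def)

lemma letters_plus [simp]: "letters (v + w) = letters v @ letters w"
  by (simp add: plus_word_def)

lemma letters_zero [simp]: "letters 0 = []"
  by (simp add: zero_word_def)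

lemma Word_Nil: "Word [] = 0"
  by (simp add: zero_word_def)

lemma word_induct [case_names zero plus]:
  assumes "P 0" "\<And>g w. P w \<Longrightarrow> P (Word [g] + w)"
  shows "P w"
proof (cases w)
  case (Word xs)
  have "P (Word xs)"
  proof (induction xs)
    case (Cons x xs)
    then show ?case using assms(2)[of "Word xs" x] by simp
  qed (use assms(1) in \<open>simp add: Word_Nil\<close>)
  then show ?thesis by (simp add: Word)
qed

lemma word_rev_induct [case_names zero plus]:
  assumes "P 0" "\<And>g w. P w \<Longrightarrow> P (w + Word [g])"
  shows "P w"
proof (cases w)
  case (Word xs)
  have "P (Word xs)"
  proof (induction xs rule: rev_induct)
    case (snoc x xs)
    then show ?case using assms(2)[of "Word xs" x] by simp
  qed (use assms(1) in \<open>simp add: Word_Nil\<close>)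
  then show ?thesis by (simp add: Word)
qed

lemma mon_plus: "mon (v + w) = mon v * mon w"
  by (simp add: mon_def mult_single)

lemma mon_0 [simp]: "mon 0 = 1"
  by (simp add: mon_def)

lemma fscale_mon: "fscale c (mon w) = Poly_Mapping.single w c"
  by (rule poly_mapping_eqI) (simp add: mon_def lookup_single when_def)

lemma free_alg_decomp: "x = (\<Sum>w\<in>Poly_Mapping.keys x. fscale (Poly_Mapping.lookup x w) (mon w))"
  using poly_mapping_decomp[of x] by (simp add: fscale_mon)

lemma lett_mult: "lett a * lett b = mon (Word [a, b])"
  by (simp add: lett_def mon_def mult_single)

lemma fscale_mult_left: "fscale c x * y = fscale c (x * y)"
  and fscale_mult_right: "x * fscale c y = fscale c (x * y)"
  for x y :: "'m free_alg"
proof -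
  have scale: "fscale c x = Poly_Mapping.single 0 c * x" for c and x :: "'m free_alg"
    by (simp add: fscale_def mult_map_scale_conv_mult)
  have central: "Poly_Mapping.single 0 c * x = x * Poly_Mapping.single 0 c" for c and x :: "'m free_alg"
    by (induction x rule: poly_mapping_single_induct) (simp_all add: mult_single algebra_simps)
  show "fscale c x * y = fscale c (x * y)" by (simp add: scale mult.assoc)
  show "x * fscale c y = fscale c (x * y)" by (metis scale central mult.assoc)
qed

lemma ideal_gen_base:
  "s \<in> S \<Longrightarrow> set (letters u) \<subseteq> M \<Longrightarrow> set (letters v) \<subseteq> M \<Longrightarrow> mon u * s * mon v \<in> ideal_gen M S"
  unfolding ideal_gen_def by (rule flin.span_base) auto

lemma ideal_gen_minimal:
  assumes "flin.subspace P"
    and "\<And>u s v. set (letters u) \<subseteq> M \<Longrightarrow> s \<in> S \<Longrightarrow> set (letters v) \<subseteq> M \<Longrightarrow> mon u * s * mon v \<in> P"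
  shows "ideal_gen M S \<subseteq> P"
  unfolding ideal_gen_def using assms by (intro flin.span_minimal) auto

section \<open>Functionals and their translates\<close>

lemma csc_apply [simp]: "csc c a w = c * a w"
  by (simp add: csc_def)

lemma csc_1 [simp]: "csc 1 a = a" and csc_0 [simp]: "csc 0 a = 0" and csc_zero [simp]: "csc c 0 = 0"
  and csc_csc [simp]: "csc c (csc d a) = csc (c * d) a"
  and csc_add: "csc c (a + b) = csc c a + csc c b"
  and csc_minus: "csc c (a - b) = csc c a - csc c b"
  by (simp_all add: fun_eq_iff algebra_simps)

global_interpretation fn: vector_space csc
  by standard (simp_all add: fun_eq_iff algebra_simps)

definition lshift :: "gen \<Rightarrow> fnl \<Rightarrow> fnl" where "lshift g a = (\<lambda>w. a (Word [g] + w))"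
definition rshift :: "gen \<Rightarrow> fnl \<Rightarrow> fnl" where "rshift g a = (\<lambda>w. a (w + Word [g]))"

lemma lshift_apply: "lshift g a w = a (Word [g] + w)"
  and rshift_apply: "rshift g a w = a (w + Word [g])"
  by (simp_all add: lshift_def rshift_def)

lemma lshift_linear [simp]:
  "lshift g (a + b) = lshift g a + lshift g b" "lshift g (csc c a) = csc c (lshift g a)"
  "lshift g (a - b) = lshift g a - lshift g b" "lshift g (- a) = - lshift g a" "lshift g 0 = 0"
  by (simp_all add: fun_eq_iff lshift_def)

lemma rshift_linear [simp]:
  "rshift g (a + b) = rshift g a + rshift g b" "rshift g (csc c a) = csc c (rshift g a)"
  "rshift g (a - b) = rshift g a - rshift g b" "rshift g (- a) = - rshift g a" "rshift g 0 = 0"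
  by (simp_all add: fun_eq_iff rshift_def)

lemma act_apply: "(X \<triangleright> a) w = lin_ext (\<lambda>v. a (w + v)) X"
  by (simp add: act_def pair_eq_lin_ext lin_ext_mult)

lemma act_apply_0: "(X \<triangleright> a) 0 = pair X a"
  by (simp add: act_apply pair_eq_lin_ext)

lemma act_lett [simp]: "lett g \<triangleright> a = rshift g a"
  by (simp add: fun_eq_iff act_apply rshift_def)

lemma act_mult [simp]: "(X * Y) \<triangleright> a = X \<triangleright> (Y \<triangleright> a)"
  by (simp add: fun_eq_iff act_apply lin_ext_mult add.assoc)

lemma act_1 [simp]: "1 \<triangleright> a = a"
  by (simp add: fun_eq_iff act_apply)

lemma act_linear_left [simp]:
  "(X + Y) \<triangleright> a = X \<triangleright> a + Y \<triangleright> a" "(X - Y) \<triangleright> a = X \<triangleright> a - Y \<triangleright> a"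
  "(- X) \<triangleright> a = - (X \<triangleright> a)" "fscale c X \<triangleright> a = csc c (X \<triangleright> a)" "0 \<triangleright> a = 0"
  by (simp_all add: fun_eq_iff act_apply)

lemma act_linear [simp]:
  "X \<triangleright> (a + b) = X \<triangleright> a + X \<triangleright> b" "X \<triangleright> (csc c a) = csc c (X \<triangleright> a)" "X \<triangleright> 0 = 0"
  by (simp_all add: fun_eq_iff act_apply lin_ext_add_fun)

lemma act_minus [simp]: "X \<triangleright> (a - b) = X \<triangleright> a - X \<triangleright> b"
  using act_linear(1)[of X "a - b" b] by simp

lemma act_sum_list: "X \<triangleright> (\<Sum>i\<leftarrow>is. f i) = (\<Sum>i\<leftarrow>is. X \<triangleright> f i)"
  by (induction "is") (simp_all only: list.map sum_list.Nil sum_list.Cons act_linear)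

lemma act_sum: "X \<triangleright> (\<Sum>i\<in>S. f i) = (\<Sum>i\<in>S. X \<triangleright> f i)"
  by (induction S rule: infinite_finite_induct)
    (simp_all only: sum.infinite sum.empty sum.insert act_linear not_False_eq_True)

lemma lshift_act: "lshift g (X \<triangleright> a) = X \<triangleright> lshift g a"
  by (simp add: fun_eq_iff lshift_def act_apply add.assoc)

lemma mon_act_plus: "mon (Word [g] + v) \<triangleright> a = rshift g (mon v \<triangleright> a)"
  by (simp add: mon_plus flip: lett_def)

lemma pair_linear: "pair X (a + b) = pair X a + pair X b" "pair X (a - b) = pair X a - pair X b"
  "pair X (csc c a) = c * pair X a" "pair X 0 = 0"
  unfolding act_apply_0[symmetric] by simp_all

section \<open>Convolution\<close>

lemma cop_word_plus: "cop_word (v + w) = cop_word v * cop_word w"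
  by (simp add: cop_word_def)

lemma cop_word_0 [simp]: "cop_word 0 = 1"
  by (simp add: cop_word_def)

lemma cop_word_gen [simp]: "cop_word (Word [g]) = cop_gen g"
  by (simp add: cop_word_def)

lemma conv_add_left: "(a + a') \<star> b = a \<star> b + a' \<star> b"
  and conv_add_right: "a \<star> (b + b') = a \<star> b + a \<star> b'"
  and conv_csc_left [simp]: "csc c a \<star> b = csc c (a \<star> b)"
  and conv_csc_right [simp]: "a \<star> csc c b = csc c (a \<star> b)"
  and conv_zero_left [simp]: "0 \<star> b = 0"
  and conv_zero_right [simp]: "a \<star> 0 = 0"
  by (simp_all add: fun_eq_iff conv_eq_lin_ext algebra_simps lin_ext_add_fun flip: lin_ext_mult_left)

lemma conv_uminus_left [simp]: "(- a) \<star> b = - (a \<star> b)"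
  and conv_uminus_right [simp]: "a \<star> (- b) = - (a \<star> b)"
  using conv_csc_left[of "-1" a b] conv_csc_right[of a "-1" b]
  by (simp_all add: csc_def fun_Compl_def)

lemma conv_minus_left: "(a - a') \<star> b = a \<star> b - a' \<star> b"
  and conv_minus_right: "a \<star> (b - b') = a \<star> b - a \<star> b'"
  using conv_add_left[of a "- a'" b] conv_add_right[of a b "- b'"] by simp_all

lemmas conv_linear = conv_add_left conv_add_right conv_minus_left conv_minus_right

lemma conv_sum_left: "(\<Sum>i\<in>S. f i) \<star> b = (\<Sum>i\<in>S. f i \<star> b)"
  by (induction S rule: infinite_finite_induct)
    (simp_all only: sum.infinite sum.empty sum.insert conv_zero_left conv_add_left not_False_eq_True)

lemma conv_sum_right: "a \<star> (\<Sum>i\<in>S. f i) = (\<Sum>i\<in>S. a \<star> f i)"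
  by (induction S rule: infinite_finite_induct)
    (simp_all only: sum.infinite sum.empty sum.insert conv_zero_right conv_add_right not_False_eq_True)

lemma conv_sum_list_left: "(\<Sum>i\<leftarrow>is. f i) \<star> b = (\<Sum>i\<leftarrow>is. f i \<star> b)"
  by (induction "is") (simp_all only: list.map sum_list.Nil sum_list.Cons conv_zero_left conv_add_left)

lemma conv_sum_list_right: "a \<star> (\<Sum>i\<leftarrow>is. f i) = (\<Sum>i\<leftarrow>is. a \<star> f i)"
  by (induction "is") (simp_all only: list.map sum_list.Nil sum_list.Cons conv_zero_right conv_add_right)

lemma conv_0: "(a \<star> b) 0 = a 0 * b 0"
  by (simp add: conv_eq_lin_ext)

lemma lshift_conv:
  "lshift (E i) (a \<star> b) = lshift (E i) a \<star> lshift (K i) b + a \<star> lshift (E i) b"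
  "lshift (F i) (a \<star> b) = lshift (F i) a \<star> b + lshift (Kinv i) a \<star> lshift (F i) b"
  "lshift (K i) (a \<star> b) = lshift (K i) a \<star> lshift (K i) b"
  "lshift (Kinv i) (a \<star> b) = lshift (Kinv i) a \<star> lshift (Kinv i) b"
  by (simp_all add: fun_eq_iff lshift_apply conv_eq_lin_ext cop_word_plus lin_ext_mult)

lemma rshift_conv:
  "rshift (E i) (a \<star> b) = rshift (E i) a \<star> rshift (K i) b + a \<star> rshift (E i) b"
  "rshift (F i) (a \<star> b) = rshift (F i) a \<star> b + rshift (Kinv i) a \<star> rshift (F i) b"
  "rshift (K i) (a \<star> b) = rshift (K i) a \<star> rshift (K i) b"
  "rshift (Kinv i) (a \<star> b) = rshift (Kinv i) a \<star> rshift (Kinv i) b"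
  by (simp_all add: fun_eq_iff rshift_apply conv_eq_lin_ext cop_word_plus lin_ext_mult lin_ext_add_fun)

lemma conv_assoc: "(a \<star> b) \<star> c = a \<star> (b \<star> c)"
proof
  fix w
  show "((a \<star> b) \<star> c) w = (a \<star> (b \<star> c)) w"
  proof (induction w arbitrary: a b c rule: word_induct)
    case zero
    show ?case by (simp add: conv_0)
  next
    case (plus g w)
    have "lshift g ((a \<star> b) \<star> c) w = lshift g (a \<star> (b \<star> c)) w"
      by (cases g) (simp_all add: lshift_conv conv_add_left conv_add_right plus)
    then show ?case by (simp add: lshift_apply)
  qed
qed

lemma unit_0 [simp]: "unit 0 = 1"
  by (simp add: unit_def)

lemma lshift_unit [simp]: "lshift g unit = csc (eps_gen g) unit"
  and rshift_unit [simp]: "rshift g unit = csc (eps_gen g) unit"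
  by (simp_all add: fun_eq_iff lshift_apply rshift_apply unit_def)

lemma unit_conv [simp]: "unit \<star> a = a"
  and conv_unit [simp]: "a \<star> unit = a"
proof -
  have "(unit \<star> a) w = a w \<and> (a \<star> unit) w = a w" for w
  proof (induction w arbitrary: a rule: word_induct)
    case zero
    show ?case by (simp add: conv_0)
  next
    case (plus g w)
    have "lshift g (unit \<star> a) w = lshift g a w \<and> lshift g (a \<star> unit) w = lshift g a w"
      by (cases g) (simp_all add: lshift_conv conv_add_left conv_add_right plus)
    then show ?case by (simp add: lshift_apply)
  qed
  then show "unit \<star> a = a" "a \<star> unit = a" by (simp_all add: fun_eq_iff)
qed

section \<open>The antipode\<close>

lemma antip_apply: "antip a w = lin_ext a (antipode_word w)"
  by (simp add: antip_def pair_eq_lin_ext)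

lemma antip_0: "antip a 0 = a 0"
  by (simp add: antip_apply antipode_word_def)

lemma antip_linear [simp]: "antip (a + b) = antip a + antip b" "antip (csc c a) = csc c (antip a)"
  "antip (- a) = - antip a" "antip 0 = 0"
  by (simp_all add: fun_eq_iff antip_apply lin_ext_add_fun lin_ext_uminus_fun plus_fun_def fun_Compl_def
      csc_def zero_fun_def)

lemma antip_minus [simp]: "antip (a - b) = antip a - antip b"
  using antip_linear(1)[of a "- b"] by simp

lemma antip_plus: "antip a (v + w) = lin_ext (\<lambda>p. lin_ext (\<lambda>p'. a (p + p')) (antipode_word v)) (antipode_word w)"
  by (simp add: antip_apply antipode_word_def flip: lin_ext_mult)

lemma antipode_word_gen [simp]: "antipode_word (Word [g]) = antipode_gen g"
  by (simp add: antipode_word_def)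

lemma lshift_antip:
  "lshift (E i) (antip a) = - antip (rshift (E i) (rshift (Kinv i) a))"
  "lshift (F i) (antip a) = - antip (rshift (K i) (rshift (F i) a))"
  "lshift (K i) (antip a) = antip (rshift (Kinv i) a)"
  "lshift (Kinv i) (antip a) = antip (rshift (K i) a)"
  by (simp_all add: fun_eq_iff lshift_apply antip_plus lin_ext_mult lin_ext_uminus_fun)
    (simp_all add: antip_apply rshift_def add.assoc)

lemma rshift_antip:
  "rshift (E i) (antip a) = - antip (lshift (Kinv i) (lshift (E i) a))"
  "rshift (F i) (antip a) = - antip (lshift (F i) (lshift (K i) a))"
  "rshift (K i) (antip a) = antip (lshift (Kinv i) a)"
  "rshift (Kinv i) (antip a) = antip (lshift (K i) a)"
  by (simp_all add: fun_eq_iff rshift_apply antip_plus lin_ext_mult lin_ext_uminus_fun)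
    (simp_all add: antip_apply lshift_def flip: add.assoc)

section \<open>Functionals on the quantised enveloping algebra\<close>

text \<open>Passing to the inverses of \<open>K\<^sub>i\<close> in a commutation relation.\<close>

lemma commute_inverse:
  assumes inverse: "\<And>a. a \<in> S \<Longrightarrow> k (k' a) = a" "\<And>a. a \<in> S \<Longrightarrow> k' (k a) = a"
    and closed: "\<And>a. a \<in> S \<Longrightarrow> k' a \<in> S" "\<And>a. a \<in> S \<Longrightarrow> f a \<in> S"
    and scale: "\<And>c a. k' (csc c a) = csc c (k' a)"
    and commute: "\<And>a. a \<in> S \<Longrightarrow> k (f a) = csc c (f (k a))"
    and "c * d = 1" "a \<in> S"
  shows "k' (f a) = csc d (f (k' a))" "f (k' a) = csc c (k' (f a))"
proof -
  have "k (f (k' a)) = csc c (f a)" using commute inverse closed \<open>a \<in> S\<close> by simp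
  then show swapped: "f (k' a) = csc c (k' (f a))" using inverse(2)[of "f (k' a)"] closed scale \<open>a \<in> S\<close> by metis
  show "k' (f a) = csc d (f (k' a))" using \<open>c * d = 1\<close> by (simp add: swapped mult.commute)
qed

lemma cartan_sym: "cartan i j = cartan j i"
  by (simp add: cartan_def)

locale quantum_parameter =
  fixes q :: real
  assumes q_generic: "q \<notin> {-1, 0, 1}"
begin

abbreviation qc :: complex where "qc \<equiv> complex_of_real q"

abbreviation \<D> :: "fnl set" where "\<D> \<equiv> Uq_dual q"

lemma q_nonzero [simp]: "q \<noteq> 0"
  using q_generic by auto

lemma q_square_neq_1 [simp]: "qc * qc \<noteq> 1"
proof
  assume "qc * qc = 1"
  then have "q * q = 1" by (metis of_real_1 of_real_eq_iff of_real_mult)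
  then show False using q_generic square_eq_1_iff[of q] by auto
qed

lemma q_minus_inverse_nonzero [simp]: "qc - 1 / qc \<noteq> 0"
  using q_square_neq_1 by (simp add: field_simps)

lemma Uq_dual_iff: "a \<in> \<D> \<longleftrightarrow> (\<forall>u v. \<forall>r\<in>Uq_rels q. pair (mon u * r * mon v) a = 0)"
proof
  assume "a \<in> \<D>"
  then show "\<forall>u v. \<forall>r\<in>Uq_rels q. pair (mon u * r * mon v) a = 0"
    by (auto simp: Uq_dual_def Uq_ideal_def intro: ideal_gen_base)
next
  assume "\<forall>u v. \<forall>r\<in>Uq_rels q. pair (mon u * r * mon v) a = 0"
  then have "ideal_gen UNIV (Uq_rels q) \<subseteq> {X. pair X a = 0}"
    by (intro ideal_gen_minimal) (auto simp: flin.subspace_def pair_eq_lin_ext)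
  then show "a \<in> \<D>"
    by (auto simp: Uq_dual_def Uq_ideal_def)
qed

lemma subspace_Uq_dual: "fn.subspace \<D>"
  by (auto simp: fn.subspace_def Uq_dual_def pair_linear)

lemma rshift_Uq_dual [simp]:
  assumes "a \<in> \<D>" shows "rshift g a \<in> \<D>"
proof -
  have "pair (mon u * r * mon v) (rshift g a) = pair (mon u * r * mon (v + Word [g])) a" for u r v
    by (simp add: pair_eq_lin_ext lin_ext_mult rshift_def add.assoc)
  then show ?thesis using assms by (simp add: Uq_dual_iff)
qed

lemma lshift_Uq_dual [simp]:
  assumes "a \<in> \<D>" shows "lshift g a \<in> \<D>"
proof -
  have "pair (mon u * r * mon v) (lshift g a) = pair (mon (Word [g] + u) * r * mon v) a" for u r v
    by (simp add: pair_eq_lin_ext lin_ext_mult lshift_def add.assoc)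
  then show ?thesis using assms by (simp add: Uq_dual_iff)
qed

lemma Uq_rels_act:
  assumes "a \<in> \<D>" "r \<in> Uq_rels q" shows "r \<triangleright> a = 0"
proof
  fix w
  have "pair (mon w * r * mon 0) a = 0" using assms Uq_dual_iff by blast
  then show "(r \<triangleright> a) w = 0 w"
    by (simp add: pair_eq_lin_ext lin_ext_mult act_apply)
qed

lemma Uq_rels_right_act:
  assumes "a \<in> \<D>" "r \<in> Uq_rels q" shows "lin_ext (\<lambda>v. a (v + w)) r = 0"
proof -
  have "pair (mon 0 * r * mon w) a = 0" using assms Uq_dual_iff by blast
  then show ?thesis
    by (simp add: pair_eq_lin_ext lin_ext_mult)
qed

lemma Uq_relsE:
  assumes "r \<in> Uq_rels q"
  obtains (K_Kinv) i where "r = lett (K i) * lett (Kinv i) - 1"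
  | (Kinv_K) i where "r = lett (Kinv i) * lett (K i) - 1"
  | (K_K) i j where "r = lett (K i) * lett (K j) - lett (K j) * lett (K i)"
  | (K_E) i j where "r = lett (K i) * lett (E j) - fscale (qc powi cartan i j) (lett (E j) * lett (K i))"
  | (K_F) i j where "r = lett (K i) * lett (F j) - fscale (qc powi (- cartan i j)) (lett (F j) * lett (K i))"
  | (E_F) i j where "r = lett (E i) * lett (F j) - lett (F j) * lett (E i)
        - (if i = j then fscale (1 / (qc - 1 / qc)) (lett (K i) - lett (Kinv i)) else 0)"
  | (Serre_E) i j where "i \<noteq> j" "r = lett (E i) * lett (E i) * lett (E j)
        - fscale (qc + 1 / qc) (lett (E i) * lett (E j) * lett (E i)) + lett (E j) * lett (E i) * lett (E i)"
  | (Serre_F) i j where "i \<noteq> j" "r = lett (F i) * lett (F i) * lett (F j)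
        - fscale (qc + 1 / qc) (lett (F i) * lett (F j) * lett (F i)) + lett (F j) * lett (F i) * lett (F i)"
  using assms unfolding Uq_rels_def Let_def by blast

lemma Uq_rels_mem:
  "lett (K i) * lett (Kinv i) - 1 \<in> Uq_rels q"
  "lett (Kinv i) * lett (K i) - 1 \<in> Uq_rels q"
  "lett (K i) * lett (K j) - lett (K j) * lett (K i) \<in> Uq_rels q"
  "lett (K i) * lett (E j) - fscale (qc powi cartan i j) (lett (E j) * lett (K i)) \<in> Uq_rels q"
  "lett (K i) * lett (F j) - fscale (qc powi (- cartan i j)) (lett (F j) * lett (K i)) \<in> Uq_rels q"
  "lett (E i) * lett (F j) - lett (F j) * lett (E i)
        - (if i = j then fscale (1 / (qc - 1 / qc)) (lett (K i) - lett (Kinv i)) else 0) \<in> Uq_rels q"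
  "i \<noteq> j \<Longrightarrow> lett (E i) * lett (E i) * lett (E j) - fscale (qc + 1 / qc) (lett (E i) * lett (E j) * lett (E i))
        + lett (E j) * lett (E i) * lett (E i) \<in> Uq_rels q"
  "i \<noteq> j \<Longrightarrow> lett (F i) * lett (F i) * lett (F j) - fscale (qc + 1 / qc) (lett (F i) * lett (F j) * lett (F i))
        + lett (F j) * lett (F i) * lett (F i) \<in> Uq_rels q"
  unfolding Uq_rels_def Let_def by blast+

text \<open>The right-hand sides are ordered as \<open>F\<close>, \<open>E\<close>, \<open>K\<close>.\<close>

lemma rshift_K_Kinv [simp]:
  assumes "a \<in> \<D>"
  shows "rshift (K i) (rshift (Kinv i) a) = a" "rshift (Kinv i) (rshift (K i) a) = a"
  using Uq_rels_act[OF assms Uq_rels_mem(1)[of i]] Uq_rels_act[OF assms Uq_rels_mem(2)[of i]] by simp_all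

lemma rshift_K_K:
  assumes "a \<in> \<D>" shows "rshift (K i) (rshift (K j) a) = rshift (K j) (rshift (K i) a)"
  using Uq_rels_act[OF assms Uq_rels_mem(3)[of i j]] by simp

lemma rshift_K_E:
  assumes "a \<in> \<D>"
  shows "rshift (K i) (rshift (E j) a) = csc (qc powi cartan i j) (rshift (E j) (rshift (K i) a))"
  using Uq_rels_act[OF assms Uq_rels_mem(4)[of i j]] by simp

lemma rshift_K_F:
  assumes "a \<in> \<D>"
  shows "rshift (K i) (rshift (F j) a) = csc (qc powi (- cartan i j)) (rshift (F j) (rshift (K i) a))"
  using Uq_rels_act[OF assms Uq_rels_mem(5)[of i j]] by simp

lemma rshift_E_F:
  assumes "a \<in> \<D>"
  shows "rshift (E i) (rshift (F j) a) = rshift (F j) (rshift (E i) a)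
    + (if i = j then csc (1 / (qc - 1 / qc)) (rshift (K i) a - rshift (Kinv i) a) else 0)"
  using Uq_rels_act[OF assms Uq_rels_mem(6)[of i j]] by (simp add: algebra_simps split: if_splits)

lemma rshift_Serre_E:
  assumes "a \<in> \<D>" "i \<noteq> j"
  shows "rshift (E i) (rshift (E i) (rshift (E j) a))
    = csc (qc + 1 / qc) (rshift (E i) (rshift (E j) (rshift (E i) a))) - rshift (E j) (rshift (E i) (rshift (E i) a))"
  using Uq_rels_act[OF assms(1) Uq_rels_mem(7)[OF assms(2)]] by (simp add: algebra_simps eq_neg_iff_add_eq_0)

lemma rshift_Serre_F:
  assumes "a \<in> \<D>" "i \<noteq> j"
  shows "rshift (F i) (rshift (F i) (rshift (F j) a))
    = csc (qc + 1 / qc) (rshift (F i) (rshift (F j) (rshift (F i) a))) - rshift (F j) (rshift (F i) (rshift (F i) a))"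
  using Uq_rels_act[OF assms(1) Uq_rels_mem(8)[OF assms(2)]] by (simp add: algebra_simps eq_neg_iff_add_eq_0)

lemmas rshift_commute_Kinv =
  commute_inverse(1)[where S = \<D> and k = "rshift (K i)" and k' = "rshift (Kinv i)" for i]

lemma rshift_Kinv_E:
  assumes "a \<in> \<D>"
  shows "rshift (Kinv i) (rshift (E j) a) = csc (qc powi (- cartan i j)) (rshift (E j) (rshift (Kinv i) a))"
  using assms by (intro rshift_commute_Kinv[where f = "rshift (E j)" and c = "qc powi cartan i j"])
    (simp_all add: rshift_K_E flip: power_int_add)

lemma rshift_Kinv_F:
  assumes "a \<in> \<D>"
  shows "rshift (Kinv i) (rshift (F j) a) = csc (qc powi cartan i j) (rshift (F j) (rshift (Kinv i) a))"
  using assms by (intro rshift_commute_Kinv[where f = "rshift (F j)" and c = "qc powi (- cartan i j)"])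
    (simp_all add: rshift_K_F flip: power_int_add)

lemma rshift_Kinv_K:
  assumes "a \<in> \<D>" shows "rshift (Kinv i) (rshift (K j) a) = rshift (K j) (rshift (Kinv i) a)"
  using rshift_commute_Kinv[where f = "rshift (K j)" and c = 1 and d = 1] assms by (simp add: rshift_K_K)

lemma rshift_Kinv_Kinv:
  assumes "a \<in> \<D>" shows "rshift (Kinv i) (rshift (Kinv j) a) = rshift (Kinv j) (rshift (Kinv i) a)"
  using rshift_commute_Kinv[where f = "rshift (Kinv j)" and c = 1 and d = 1] assms by (simp add: rshift_Kinv_K)

lemma lshift_K_Kinv [simp]:
  assumes "a \<in> \<D>"
  shows "lshift (Kinv i) (lshift (K i) a) = a" "lshift (K i) (lshift (Kinv i) a) = a"
  using Uq_rels_right_act[OF assms Uq_rels_mem(1)[of i]] Uq_rels_right_act[OF assms Uq_rels_mem(2)[of i]]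
  by (simp_all add: fun_eq_iff lin_ext_mult lshift_apply flip: add.assoc)

lemma lshift_K_K:
  assumes "a \<in> \<D>" shows "lshift (K i) (lshift (K j) a) = lshift (K j) (lshift (K i) a)"
  using Uq_rels_right_act[OF assms Uq_rels_mem(3)[of i j]]
  by (simp add: fun_eq_iff lin_ext_mult lshift_apply flip: add.assoc)

lemma lshift_E_K:
  assumes "a \<in> \<D>"
  shows "lshift (E j) (lshift (K i) a) = csc (qc powi cartan i j) (lshift (K i) (lshift (E j) a))"
  using Uq_rels_right_act[OF assms Uq_rels_mem(4)[of i j]]
  by (simp add: fun_eq_iff lin_ext_mult lshift_apply flip: add.assoc)

lemma lshift_F_K:
  assumes "a \<in> \<D>"
  shows "lshift (F j) (lshift (K i) a) = csc (qc powi (- cartan i j)) (lshift (K i) (lshift (F j) a))"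
  using Uq_rels_right_act[OF assms Uq_rels_mem(5)[of i j]]
  by (simp add: fun_eq_iff lin_ext_mult lshift_apply flip: add.assoc)

lemma lshift_F_E:
  assumes "a \<in> \<D>"
  shows "lshift (F j) (lshift (E i) a) = lshift (E i) (lshift (F j) a)
    + (if i = j then csc (1 / (qc - 1 / qc)) (lshift (K i) a - lshift (Kinv i) a) else 0)"
  using Uq_rels_right_act[OF assms Uq_rels_mem(6)[of i j]]
  by (simp add: fun_eq_iff lin_ext_mult lshift_apply algebra_simps split: if_splits flip: add.assoc)

lemma lshift_Serre_E:
  assumes "a \<in> \<D>" "i \<noteq> j"
  shows "lshift (E j) (lshift (E i) (lshift (E i) a))
    = csc (qc + 1 / qc) (lshift (E i) (lshift (E j) (lshift (E i) a))) - lshift (E i) (lshift (E i) (lshift (E j) a))"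
  using Uq_rels_right_act[OF assms(1) Uq_rels_mem(7)[OF assms(2)]]
  by (simp add: fun_eq_iff lin_ext_mult lshift_apply algebra_simps eq_neg_iff_add_eq_0 flip: add.assoc)

lemma lshift_Serre_F:
  assumes "a \<in> \<D>" "i \<noteq> j"
  shows "lshift (F j) (lshift (F i) (lshift (F i) a))
    = csc (qc + 1 / qc) (lshift (F i) (lshift (F j) (lshift (F i) a))) - lshift (F i) (lshift (F i) (lshift (F j) a))"
  using Uq_rels_right_act[OF assms(1) Uq_rels_mem(8)[OF assms(2)]]
  by (simp add: fun_eq_iff lin_ext_mult lshift_apply algebra_simps eq_neg_iff_add_eq_0 flip: add.assoc)

lemmas lshift_commute_Kinv =
  commute_inverse(2)[where S = \<D> and k = "lshift (K i)" and k' = "lshift (Kinv i)" for i]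

lemma lshift_E_Kinv:
  assumes "a \<in> \<D>"
  shows "lshift (E j) (lshift (Kinv i) a) = csc (qc powi (- cartan i j)) (lshift (Kinv i) (lshift (E j) a))"
  using assms by (intro lshift_commute_Kinv[where f = "lshift (E j)" and d = "qc powi cartan i j"])
    (simp_all add: lshift_E_K flip: power_int_add)

lemma lshift_F_Kinv:
  assumes "a \<in> \<D>"
  shows "lshift (F j) (lshift (Kinv i) a) = csc (qc powi cartan i j) (lshift (Kinv i) (lshift (F j) a))"
  using assms by (intro lshift_commute_Kinv[where f = "lshift (F j)" and d = "qc powi (- cartan i j)"])
    (simp_all add: lshift_F_K flip: power_int_add)

lemma lshift_Kinv_K:
  assumes "a \<in> \<D>" shows "lshift (Kinv i) (lshift (K j) a) = lshift (K j) (lshift (Kinv i) a)"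
  using lshift_commute_Kinv[where f = "lshift (K j)" and c = 1 and d = 1] assms by (simp add: lshift_K_K)

lemma lshift_Kinv_Kinv:
  assumes "a \<in> \<D>" shows "lshift (Kinv i) (lshift (Kinv j) a) = lshift (Kinv j) (lshift (Kinv i) a)"
  using lshift_commute_Kinv[where f = "lshift (Kinv j)" and c = 1 and d = 1] assms by (simp add: lshift_Kinv_K)

lemma span_subset_Uq_dual:
  assumes shift: "\<And>a g. a \<in> G \<Longrightarrow> rshift g a \<in> fn.span G"
    and rels: "\<And>a r. a \<in> G \<Longrightarrow> r \<in> Uq_rels q \<Longrightarrow> r \<triangleright> a = 0"
  shows "fn.span G \<subseteq> \<D>"
proof
  fix a assume a: "a \<in> fn.span G"
  have "fn.span G \<subseteq> {b. rshift g b \<in> fn.span G}" for g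
    using shift by (intro fn.span_minimal)
      (auto simp: fn.subspace_def intro: fn.span_zero fn.span_add fn.span_scale)
  then have span_shift: "rshift g b \<in> fn.span G" if "b \<in> fn.span G" for g b
    using that by blast
  have "fn.span G \<subseteq> {b. r \<triangleright> b = 0}" if "r \<in> Uq_rels q" for r
    using rels that by (intro fn.span_minimal) (auto simp: fn.subspace_def)
  then have span_rels: "r \<triangleright> b = 0" if "b \<in> fn.span G" "r \<in> Uq_rels q" for r b
    using that by blast
  have "mon v \<triangleright> a \<in> fn.span G" for v
    by (induction v rule: word_induct) (simp_all only: a mon_0 act_1 mon_act_plus span_shift)
  moreover have "pair (mon u * r * mon v) a = (r \<triangleright> (mon v \<triangleright> a)) u" for u r v
    by (simp add: pair_eq_lin_ext lin_ext_mult act_apply add.assoc)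
  ultimately show "a \<in> \<D>" using span_rels by (simp add: Uq_dual_iff)
qed

lemma unit_Uq_dual [simp]: "unit \<in> \<D>"
proof -
  have "fn.span {unit} \<subseteq> \<D>"
    by (rule span_subset_Uq_dual) (auto elim!: Uq_relsE intro: fn.span_scale fn.span_base)
  then show ?thesis using fn.span_base[of unit "{unit}"] by blast
qed

lemma Uq_rels_act_conv:
  assumes ab [simp]: "a \<in> \<D>" "b \<in> \<D>" and r: "r \<in> Uq_rels q"
  shows "r \<triangleright> (a \<star> b) = 0"
proof -
  note K_rules = rshift_K_E rshift_K_F rshift_Kinv_E rshift_Kinv_F
  from r show ?thesis
  proof (cases rule: Uq_relsE)
    case (K_K i j)
    then show ?thesis by (simp add: rshift_conv rshift_K_K[of _ i j])
  next
    case (K_E i j)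
    then show ?thesis by (simp add: rshift_conv K_rules rshift_K_K[of _ i j] csc_add)
  next
    case (K_F i j)
    then show ?thesis by (simp add: rshift_conv K_rules rshift_Kinv_K csc_add)
  next
    case (E_F i j)
    then show ?thesis
      by (simp add: rshift_conv K_rules rshift_E_F conv_linear rshift_K_K[of _ i j] rshift_Kinv_K
            rshift_Kinv_Kinv[of _ i j])
        (simp add: fun_eq_iff field_simps cartan_sym[of j i] flip: power_int_add)
  next
    case (Serre_E i j)
    then show ?thesis
      by (simp add: rshift_conv K_rules conv_linear rshift_Serre_E cartan_def rshift_K_K[of _ j i]
            csc_add csc_minus)
        (simp add: fun_eq_iff field_simps power_int_minus power2_eq_square)
  next
    case (Serre_F i j)
    then show ?thesis
      by (simp add: rshift_conv K_rules conv_linear rshift_Serre_F cartan_def rshift_Kinv_Kinv[of _ j i]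
            csc_add csc_minus)
        (simp add: fun_eq_iff field_simps power_int_minus power2_eq_square)
  qed (simp_all add: rshift_conv K_rules conv_linear csc_add)
qed

lemma conv_Uq_dual [simp]:
  assumes "a \<in> \<D>" "b \<in> \<D>" shows "a \<star> b \<in> \<D>"
proof -
  let ?G = "{a \<star> b | a b. a \<in> \<D> \<and> b \<in> \<D>}"
  have base: "x \<star> y \<in> fn.span ?G" if "x \<in> \<D>" "y \<in> \<D>" for x y
    using that by (intro fn.span_base) auto
  have "fn.span ?G \<subseteq> \<D>"
  proof (rule span_subset_Uq_dual)
    fix x g assume "x \<in> ?G"
    then show "rshift g x \<in> fn.span ?G"
      by (cases g) (auto simp: rshift_conv intro!: fn.span_add base)
  qed (auto intro: Uq_rels_act_conv)
  then show ?thesis using base[OF assms] by auto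
qed

lemma Uq_rels_act_antip:
  assumes a [simp]: "a \<in> \<D>" and r: "r \<in> Uq_rels q"
  shows "r \<triangleright> antip a = 0"
proof -
  note K_rules = lshift_E_K lshift_F_K lshift_E_Kinv lshift_F_Kinv
  from r show ?thesis
  proof (cases rule: Uq_relsE)
    case (K_K i j)
    then show ?thesis by (simp add: rshift_antip lshift_Kinv_Kinv[of _ i j])
  next
    case (K_E i j)
    then show ?thesis by (simp add: rshift_antip K_rules lshift_Kinv_Kinv[of _ i j] flip: power_int_add)
  next
    case (K_F i j)
    then show ?thesis by (simp add: rshift_antip K_rules lshift_Kinv_K flip: power_int_add)
  next
    case (E_F i j)
    then show ?thesis
      by (simp add: rshift_antip K_rules lshift_F_E lshift_Kinv_K)
        (simp add: fun_eq_iff field_simps cartan_sym[of j i] flip: power_int_add)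
  next
    case (Serre_E i j)
    then show ?thesis
      by (simp add: rshift_antip K_rules lshift_Serre_E cartan_def lshift_Kinv_Kinv[of _ j i] csc_add csc_minus)
        (simp add: fun_eq_iff field_simps power_int_minus power2_eq_square)
  next
    case (Serre_F i j)
    then show ?thesis
      by (simp add: rshift_antip K_rules lshift_Serre_F cartan_def lshift_K_K[of _ j i] csc_add csc_minus)
        (simp add: fun_eq_iff field_simps power_int_minus power2_eq_square)
  qed (simp_all add: rshift_antip)
qed

lemma antip_Uq_dual [simp]:
  assumes "a \<in> \<D>" shows "antip a \<in> \<D>"
proof -
  have base: "antip x \<in> fn.span (antip ` \<D>)" if "x \<in> \<D>" for x
    using that by (intro fn.span_base) auto
  have "fn.span (antip ` \<D>) \<subseteq> \<D>"
  proof (rule span_subset_Uq_dual)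
    fix x g assume "x \<in> antip ` \<D>"
    then show "rshift g x \<in> fn.span (antip ` \<D>)"
      by (cases g) (auto simp: rshift_antip intro!: fn.span_neg base)
  qed (auto intro: Uq_rels_act_antip)
  then show ?thesis using base[OF assms] by auto
qed

lemma act_Uq_dual [simp]:
  assumes "a \<in> \<D>" shows "X \<triangleright> a \<in> \<D>"
proof -
  have mon: "mon w \<triangleright> a \<in> \<D>" for w
    by (induction w rule: word_induct) (simp_all only: mon_0 act_1 mon_act_plus rshift_Uq_dual assms)
  have "(\<Sum>w\<in>S. fscale (c w) (mon w)) \<triangleright> a \<in> \<D>" for S c
    by (induction S rule: infinite_finite_induct)
      (use subspace_Uq_dual mon in
        \<open>simp_all only: sum.infinite sum.empty sum.insert not_False_eq_True act_linear_left
          fn.subspace_0 fn.subspace_add fn.subspace_scale\<close>)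
  then show ?thesis using free_alg_decomp[of X] by metis
qed

end

section \<open>Simultaneous eigenvectors\<close>

lemma (in vector_space) simultaneous_eigenvectors_sum_zero:
  assumes "finite S" and linear: "\<And>i. module_hom scale scale (T i)"
    and eigen: "\<And>s i. s \<in> S \<Longrightarrow> T i (f s) = scale (c s i) (f s)"
    and distinct: "inj_on c S" and sum: "(\<Sum>s\<in>S. f s) = 0" and "s \<in> S"
  shows "f s = 0"
  using \<open>finite S\<close> eigen distinct sum \<open>s \<in> S\<close>
proof (induction S arbitrary: f s rule: finite_induct)
  case empty
  then show ?case by simp
next
  case (insert t S)
  have sum_S: "f t + (\<Sum>s\<in>S. f s) = 0" using insert.hyps insert.prems(3) by simp
  have zero: "f r = 0" if r: "r \<in> S" for r
  proof -
    have "c r \<noteq> c t" using insert.prems(2) insert.hyps(2) r by (auto simp: inj_on_def)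
    then obtain i where i: "c r i \<noteq> c t i" by auto
    define g where "g u = scale (c u i - c t i) (f u)" for u
    have "0 = T i (f t + (\<Sum>s\<in>S. f s)) - scale (c t i) (f t + (\<Sum>s\<in>S. f s))"
      by (simp add: sum_S module_hom.zero[OF linear])
    also have "T i (f t + (\<Sum>s\<in>S. f s)) = scale (c t i) (f t) + (\<Sum>s\<in>S. scale (c s i) (f s))"
      using insert.prems(1)[of _ i] by (simp only: module_hom.add[OF linear] module_hom.sum[OF linear]) simp
    also have "\<dots> - scale (c t i) (f t + (\<Sum>s\<in>S. f s)) = (\<Sum>s\<in>S. g s)"
      by (simp add: g_def scale_right_distrib scale_sum_right scale_left_diff_distrib sum_subtractf)
    finally have sum_g: "(\<Sum>s\<in>S. g s) = 0" ..
    have eigen_g: "T j (g s) = scale (c s j) (g s)" if "s \<in> S" for s j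
      using insert.prems(1) that by (simp add: g_def module_hom.scale[OF linear] mult.commute)
    have inj: "inj_on c S" using insert.prems(2) by simp
    have "g r = 0" by (rule insert.IH[of g r, OF eigen_g inj sum_g r])
    then show ?thesis using i by (simp add: g_def)
  qed
  then show ?case using sum_S insert.prems(4) by auto
qed

lemma (in module) span_UN_subspaceE:
  assumes subspace: "\<And>i. subspace (V i)" and "x \<in> span (\<Union>i. V i)"
  obtains S f where "finite S" "\<And>i. f i \<in> V i" "x = (\<Sum>i\<in>S. f i)"
proof -
  from assms(2) have "\<exists>S f. finite S \<and> (\<forall>i. f i \<in> V i) \<and> x = (\<Sum>i\<in>S. f i)"
  proof (induction rule: span_induct_alt)
    case base
    show ?case using subspace by (intro exI[of _ "{}"] exI[of _ "\<lambda>_. 0"]) (simp add: subspace_0)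
  next
    case (step k x y)
    then obtain j S f where x: "x \<in> V j" and S: "finite S" "\<And>i. f i \<in> V i" "y = (\<Sum>i\<in>S. f i)" by blast
    define g where "g i = (if i = j then k *s x else 0) + (if i \<in> S then f i else 0)" for i
    have "(\<Sum>i\<in>insert j S. if i \<in> S then f i else 0) = y"
      unfolding S(3) using S(1) by (intro sum.mono_neutral_cong_right) auto
    then have "k *s x + y = (\<Sum>i\<in>insert j S. g i)"
      using S(1) unfolding g_def sum.distrib by simp
    moreover have "g i \<in> V i" for i
      using subspace[of i] x S(2) by (auto simp: g_def intro!: subspace_add subspace_scale subspace_0)
    ultimately show ?case using S(1) by blast
  qed
  then show ?thesis using that by blast
qed

section \<open>Coproducts\<close>

definition coproduct_rep :: "fnl \<Rightarrow> (fnl \<times> fnl) list \<Rightarrow> bool"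
  where "coproduct_rep a ps \<longleftrightarrow> (\<forall>X Y. a (X + Y) = (\<Sum>(x, y)\<leftarrow>ps. x X * y Y))"

lemma sweedler_iff: "sweedler H H' a ps \<longleftrightarrow> set ps \<subseteq> H \<times> H' \<and> coproduct_rep a ps"
  by (simp add: sweedler_def coproduct_rep_def)

lemma coproduct_repD: "coproduct_rep a ps \<Longrightarrow> a (X + Y) = (\<Sum>(x, y)\<leftarrow>ps. x X * y Y)"
  by (simp add: coproduct_rep_def)

lemma coproduct_rep_conv:
  assumes "coproduct_rep a ps" "coproduct_rep b qs"
  shows "coproduct_rep (a \<star> b) (map (\<lambda>((x, y), (x', y')). (x \<star> x', y \<star> y')) (List.product ps qs))"
  unfolding coproduct_rep_def
proof (intro allI)
  fix X Y
  have factors: "a (fst p + fst p') * b (snd p + snd p') =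
      (\<Sum>((x, y), (x', y'))\<leftarrow>List.product ps qs. (x (fst p) * x' (snd p)) * (y (fst p') * y' (snd p')))" for p p'
    unfolding coproduct_repD[OF assms(1)] coproduct_repD[OF assms(2)] sum_list_times
    by (simp add: sum_list_product case_prod_unfold mult_ac)
  have "(a \<star> b) (X + Y) =
      lin_ext (\<lambda>p. lin_ext (\<lambda>p'. a (fst p + fst p') * b (snd p + snd p')) (cop_word Y)) (cop_word X)"
    by (simp add: conv_eq_lin_ext cop_word_plus lin_ext_mult)
  also have "\<dots> = (\<Sum>((x, y), (x', y'))\<leftarrow>List.product ps qs. (x \<star> x') X * (y \<star> y') Y)"
    unfolding factors lin_ext_sum_list_fun
    by (intro arg_cong[where f = sum_list] map_cong) (auto simp: conv_eq_lin_ext)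
  finally show "(a \<star> b) (X + Y) =
      (\<Sum>(x, y)\<leftarrow>map (\<lambda>((x, y), (x', y')). (x \<star> x', y \<star> y')) (List.product ps qs). x X * y Y)"
    by (simp add: comp_def case_prod_unfold)
qed

lemma coproduct_rep_antip:
  assumes "coproduct_rep a ps"
  shows "coproduct_rep (antip a) (map (\<lambda>(x, y). (antip y, antip x)) ps)"
  unfolding coproduct_rep_def
proof (intro allI)
  fix X Y
  have "antip a (X + Y) = (\<Sum>(x, y)\<leftarrow>ps. antip y X * antip x Y)"
    unfolding antip_plus coproduct_repD[OF assms] lin_ext_sum_list_fun
    by (intro arg_cong[where f = sum_list] map_cong) (auto simp: antip_apply)
  then show "antip a (X + Y) = (\<Sum>(x, y)\<leftarrow>map (\<lambda>(x, y). (antip y, antip x)) ps. x X * y Y)"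
    by (simp add: comp_def case_prod_unfold)
qed

lemma coproduct_rep_zero: "coproduct_rep 0 []"
  by (simp add: coproduct_rep_def)

lemma coproduct_rep_add: "coproduct_rep a ps \<Longrightarrow> coproduct_rep b qs \<Longrightarrow> coproduct_rep (a + b) (ps @ qs)"
  by (simp add: coproduct_rep_def)

lemma coproduct_rep_csc: "coproduct_rep a ps \<Longrightarrow> coproduct_rep (csc c a) (map (\<lambda>(x, y). (csc c x, y)) ps)"
  by (simp add: coproduct_rep_def comp_def case_prod_unfold mult.assoc sum_list_const_mult)

lemma subspace_coproduct_rep:
  assumes "fn.subspace H"
  shows "fn.subspace {a. \<exists>ps. coproduct_rep a ps \<and> set ps \<subseteq> H \<times> H'}"
  unfolding fn.subspace_def
proof (intro conjI ballI allI; clarify)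
  show "\<exists>ps. coproduct_rep 0 ps \<and> set ps \<subseteq> H \<times> H'"
    using coproduct_rep_zero by (intro exI[of _ "[]"]) simp
  fix a ps assume a: "coproduct_rep a ps" "set ps \<subseteq> H \<times> H'"
  show "\<exists>ps. coproduct_rep (csc c a) ps \<and> set ps \<subseteq> H \<times> H'" for c
    using coproduct_rep_csc[OF a(1), of c] a(2) fn.subspace_scale[OF assms]
    by (intro exI[of _ "map (\<lambda>(x, y). (csc c x, y)) ps"]) auto
  fix b qs assume b: "coproduct_rep b qs" "set qs \<subseteq> H \<times> H'"
  show "\<exists>ps. coproduct_rep (a + b) ps \<and> set ps \<subseteq> H \<times> H'"
    using coproduct_rep_add[OF a(1) b(1)] a(2) b(2) by (intro exI[of _ "ps @ qs"]) auto
qed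

lemma coproduct_rep_unit: "coproduct_rep unit [(unit, unit)]"
  by (simp add: coproduct_rep_def unit_def)

lemma coproduct_rep_act:
  assumes "coproduct_rep a ps" shows "X \<triangleright> a = (\<Sum>(x, y)\<leftarrow>ps. csc (pair X y) x)"
proof
  fix w
  have "(X \<triangleright> a) w = (\<Sum>(x, y)\<leftarrow>ps. x w * lin_ext y X)"
    unfolding act_apply coproduct_repD[OF assms] lin_ext_sum_list_fun
    by (intro arg_cong[where f = sum_list] map_cong) auto
  then show "(X \<triangleright> a) w = (\<Sum>(x, y)\<leftarrow>ps. csc (pair X y) x) w"
    by (simp add: sum_list_fun_apply case_prod_unfold pair_eq_lin_ext mult.commute)
qed

lemma coproduct_rep_act_right:
  assumes "coproduct_rep a ps" shows "coproduct_rep (X \<triangleright> a) (map (\<lambda>(x, y). (x, X \<triangleright> y)) ps)"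
  unfolding coproduct_rep_def
proof (intro allI)
  fix u v
  have "(X \<triangleright> a) (u + v) = (\<Sum>(x, y)\<leftarrow>ps. x u * (X \<triangleright> y) v)"
    unfolding act_apply add.assoc coproduct_repD[OF assms] lin_ext_sum_list_fun
    by (intro arg_cong[where f = sum_list] map_cong) (auto simp: act_apply)
  then show "(X \<triangleright> a) (u + v) = (\<Sum>(x, y)\<leftarrow>map (\<lambda>(x, y). (x, X \<triangleright> y)) ps. x u * y v)"
    by (simp add: comp_def case_prod_unfold)
qed

section \<open>The antipode axiom\<close>

lemma antipode_word_plus: "antipode_word (v + w) = antipode_word w * antipode_word v"
  by (simp add: antipode_word_def)

lemma antipode_word_0 [simp]: "antipode_word 0 = 1"
  by (simp add: antipode_word_def)

text \<open>\<open>S(a\<^sub>(\<^sub>1\<^sub>)) a\<^sub>(\<^sub>2\<^sub>)\<close> for functionals \<open>a\<close> that need not have a coproduct: \<open>w \<mapsto> \<langle>S(w\<^sub>(\<^sub>1\<^sub>)) w\<^sub>(\<^sub>2\<^sub>), a\<rangle>\<close>.\<close>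

definition antip_conv_id :: "fnl \<Rightarrow> fnl"
  where "antip_conv_id a = (\<lambda>w. lin_ext (\<lambda>p. lin_ext (\<lambda>v. a (v + snd p)) (antipode_word (fst p))) (cop_word w))"

lemma antip_conv_id_coproduct:
  assumes "coproduct_rep a ps"
  shows "antip_conv_id a = (\<Sum>(x, y)\<leftarrow>ps. antip x \<star> y)"
proof
  fix w
  have "(\<Sum>(x, y)\<leftarrow>ps. antip x \<star> y) w =
      (\<Sum>(x, y)\<leftarrow>ps. lin_ext (\<lambda>p. lin_ext (\<lambda>v. x v * y (snd p)) (antipode_word (fst p))) (cop_word w))"
    by (simp add: sum_list_fun_apply case_prod_unfold conv_eq_lin_ext antip_apply)
  then show "antip_conv_id a w = (\<Sum>(x, y)\<leftarrow>ps. antip x \<star> y) w"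
    unfolding antip_conv_id_def coproduct_repD[OF assms] lin_ext_sum_list_fun by (simp add: case_prod_unfold)
qed

lemma rshift_antip_conv_id:
  "rshift (E i) (antip_conv_id a) =
    antip_conv_id (rshift (E i) a) - antip_conv_id (rshift (K i) (lshift (Kinv i) (lshift (E i) a)))"
  "rshift (F i) (antip_conv_id a) =
    antip_conv_id (rshift (F i) (lshift (K i) a)) - antip_conv_id (lshift (F i) (lshift (K i) a))"
  "rshift (K i) (antip_conv_id a) = antip_conv_id (rshift (K i) (lshift (Kinv i) a))"
  "rshift (Kinv i) (antip_conv_id a) = antip_conv_id (rshift (Kinv i) (lshift (K i) a))"
proof -
  have Word_pair: "Word [x, y] = Word [x] + Word [y]" for x y :: gen by simp
  have uminus: "lin_ext (\<lambda>p. lin_ext (\<lambda>v. - f v p) (h p)) c = - lin_ext (\<lambda>p. lin_ext (\<lambda>v. f v p) (h p)) c"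
    for f :: "gen word \<Rightarrow> _" and h c by (simp add: lin_ext_uminus_fun)
  note expand = fun_eq_iff antip_conv_id_def rshift_def lshift_def cop_word_plus lin_ext_mult antipode_word_plus
    lin_ext_add_fun lin_ext_minus_fun uminus
  show "rshift (E i) (antip_conv_id a) =
    antip_conv_id (rshift (E i) a) - antip_conv_id (rshift (K i) (lshift (Kinv i) (lshift (E i) a)))"
    by (simp add: expand; simp add: add.assoc Word_pair del: word_plus)
  show "rshift (F i) (antip_conv_id a) =
    antip_conv_id (rshift (F i) (lshift (K i) a)) - antip_conv_id (lshift (F i) (lshift (K i) a))"
    by (simp add: expand; simp add: add.assoc Word_pair del: word_plus)
  show "rshift (K i) (antip_conv_id a) = antip_conv_id (rshift (K i) (lshift (Kinv i) a))"
    by (simp add: expand; simp add: add.assoc)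
  show "rshift (Kinv i) (antip_conv_id a) = antip_conv_id (rshift (Kinv i) (lshift (K i) a))"
    by (simp add: expand; simp add: add.assoc)
qed

context quantum_parameter
begin

lemma antip_conv_id_eq:
  assumes "a \<in> \<D>" shows "antip_conv_id a = csc (a 0) unit"
proof
  fix w
  show "antip_conv_id a w = csc (a 0) unit w"
    using assms
  proof (induction w arbitrary: a rule: word_rev_induct)
    case zero
    then show ?case by (simp add: antip_conv_id_def)
  next
    case (plus g w)
    have unit: "unit (w + Word [g]) = unit w * eps_gen g" by (simp add: unit_def)
    have cancel: "a (Word [K i, Kinv i]) = a 0" "a (Word [Kinv i, K i]) = a 0"
      "a (Word [E i, Kinv i, K i]) = a (Word [E i])" for i
      using fun_cong[OF rshift_K_Kinv(1)[OF plus.prems, of i], of 0]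
        fun_cong[OF rshift_K_Kinv(2)[OF plus.prems, of i], of 0]
        fun_cong[OF rshift_K_Kinv(2)[OF plus.prems, of i], of "Word [E i]"]
      by (simp_all add: rshift_apply)
    have "rshift g (antip_conv_id a) w = unit w * eps_gen g * a 0"
      using plus.prems
      by (cases g)
        (simp_all add: rshift_antip_conv_id plus.IH, simp_all add: rshift_apply lshift_apply cancel)
    then show ?case by (simp add: rshift_apply unit mult_ac)
  qed
qed

lemma antip_conv_coproduct:
  assumes "a \<in> \<D>" "coproduct_rep a ps"
  shows "(\<Sum>(x, y)\<leftarrow>ps. antip x \<star> y) = csc (a 0) unit"
  using antip_conv_id_eq[OF assms(1)] antip_conv_id_coproduct[OF assms(2)] by simp

end

section \<open>Matrix coefficients of the vector representation\<close>

lemma atLeastAtMost_1_3: "{1..3} = {1, 2, 3::nat}"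
  by auto

lemma index_mem: "(1::nat) \<in> {1..3}" "2 \<in> {1..3::nat}" "3 \<in> {1..3::nat}"
  "Suc 0 \<in> {1..3}" "Suc (Suc 0) \<in> {1..3}" "Suc 2 \<in> {1..3}"
  by auto

lemma num_in: "num i \<in> {1..3}" "num i + 1 \<in> {1..3}"
  by (cases i; simp)+

definition index_wt :: "nat \<Rightarrow> node \<Rightarrow> int"
  where "index_wt l = (\<lambda>i. of_bool (l = num i + 1) - of_bool (l = num i))"

lemma u_list_append: "k \<in> {1..3} \<Longrightarrow> u_list q k l (xs @ ys) = (\<Sum>m\<in>{1..3}. u_list q k m xs * u_list q m l ys)"
proof (induction xs arbitrary: k)
  case Nil
  then have "(\<Sum>m\<in>{1..3}. u_list q k m [] * u_list q m l ys) = u_list q k l ys"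
    unfolding atLeastAtMost_1_3 by auto
  then show ?case by simp
next
  case (Cons g xs)
  then show ?case
    by (simp add: sum_distrib_left sum_distrib_right mult.assoc del: One_nat_def) (rule sum.swap)
qed

lemma u_coef_plus: "k \<in> {1..3} \<Longrightarrow> u_coef q k l (X + Y) =
    u_coef q k 1 X * u_coef q 1 l Y + u_coef q k 2 X * u_coef q 2 l Y + u_coef q k 3 X * u_coef q 3 l Y"
  using u_list_append[of k q l "letters X" "letters Y"] unfolding atLeastAtMost_1_3
  by (simp add: u_coef_def)

lemma u_coef_gen: "l \<in> {1..3} \<Longrightarrow> u_coef q m l (Word [g]) = u_gen q g m l"
proof -
  have "u_coef q m l (Word [g]) = (\<Sum>k\<in>{1..3}. u_gen q g m k * of_bool (k = l))"
    by (simp add: u_coef_def)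
  then show "l \<in> {1..3} \<Longrightarrow> u_coef q m l (Word [g]) = u_gen q g m l"
    unfolding atLeastAtMost_1_3 by auto
qed

lemma u_coef_0: "u_coef q k l 0 = of_bool (k = l)"
  by (simp add: u_coef_def)

lemma coproduct_rep_u_coef:
  "k \<in> {1..3} \<Longrightarrow> coproduct_rep (u_coef q k l) (map (\<lambda>m. (u_coef q k m, u_coef q m l)) [1, 2, 3])"
  unfolding coproduct_rep_def by (simp add: u_coef_plus del: One_nat_def atLeastAtMost_iff)

lemma rshift_u_coef:
  assumes k: "k \<in> {1..3}" and l: "l \<in> {1..3}"
  shows "rshift (E i) (u_coef q k l) = (if l = num i then u_coef q k (num i + 1) else 0)"
  "rshift (F i) (u_coef q k l) = (if l = num i + 1 then u_coef q k (num i) else 0)"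
  "rshift (K i) (u_coef q k l) = csc (complex_of_real q powi index_wt l i) (u_coef q k l)"
  "rshift (Kinv i) (u_coef q k l) = csc (complex_of_real q powi (- index_wt l i)) (u_coef q k l)"
proof -
  have rshift: "rshift g (u_coef q k l) w =
      u_coef q k 1 w * u_gen q g 1 l + u_coef q k 2 w * u_gen q g 2 l + u_coef q k 3 w * u_gen q g 3 l" for g w
    unfolding rshift_apply u_coef_plus[OF k] u_coef_gen[OF l] ..
  from l have l: "l = 1 \<or> l = 2 \<or> l = 3" by auto
  show "rshift (E i) (u_coef q k l) = (if l = num i then u_coef q k (num i + 1) else 0)"
    "rshift (F i) (u_coef q k l) = (if l = num i + 1 then u_coef q k (num i) else 0)"
    "rshift (K i) (u_coef q k l) = csc (complex_of_real q powi index_wt l i) (u_coef q k l)"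
    "rshift (Kinv i) (u_coef q k l) = csc (complex_of_real q powi (- index_wt l i)) (u_coef q k l)"
    unfolding fun_eq_iff rshift using l
    by (cases i; elim disjE; simp add: index_wt_def numeral_2_eq_2[symmetric] numeral_3_eq_3[symmetric])+
qed

lemma lshift_u_coef:
  assumes k: "k \<in> {1..3}" and l: "l \<in> {1..3}"
  shows "lshift (E i) (u_coef q k l) = (if k = num i + 1 then u_coef q (num i) l else 0)"
  "lshift (F i) (u_coef q k l) = (if k = num i then u_coef q (num i + 1) l else 0)"
  "lshift (K i) (u_coef q k l) = csc (complex_of_real q powi index_wt k i) (u_coef q k l)"
  "lshift (Kinv i) (u_coef q k l) = csc (complex_of_real q powi (- index_wt k i)) (u_coef q k l)"
proof -
  have u_coef_letter: "u_coef q k 1 (Word [g]) = u_gen q g k 1" "u_coef q k 2 (Word [g]) = u_gen q g k 2"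
    "u_coef q k 3 (Word [g]) = u_gen q g k 3" for g by (intro u_coef_gen; simp)+
  have lshift: "lshift g (u_coef q k l) w =
      u_gen q g k 1 * u_coef q 1 l w + u_gen q g k 2 * u_coef q 2 l w + u_gen q g k 3 * u_coef q 3 l w" for g w
    unfolding lshift_apply u_coef_plus[OF k] u_coef_letter ..
  from k have k: "k = 1 \<or> k = 2 \<or> k = 3" by auto
  show "lshift (E i) (u_coef q k l) = (if k = num i + 1 then u_coef q (num i) l else 0)"
    "lshift (F i) (u_coef q k l) = (if k = num i then u_coef q (num i + 1) l else 0)"
    "lshift (K i) (u_coef q k l) = csc (complex_of_real q powi index_wt k i) (u_coef q k l)"
    "lshift (Kinv i) (u_coef q k l) = csc (complex_of_real q powi (- index_wt k i)) (u_coef q k l)"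
    unfolding fun_eq_iff lshift using k
    by (cases i; elim disjE; simp add: index_wt_def numeral_2_eq_2[symmetric] numeral_3_eq_3[symmetric])+
qed

context quantum_parameter
begin

lemma csc_q_difference:
  "csc (1 / (qc - 1 / qc)) (csc qc a - csc (inverse qc) a) = a"
  "csc (1 / (qc - 1 / qc)) (csc (inverse qc) a - csc qc a) = - a"
proof -
  have difference: "csc x a - csc y a = csc (x - y) a" for x y
    by (simp add: fun_eq_iff algebra_simps)
  have "1 / (qc - 1 / qc) * (1 / qc - qc) = - 1"
    using q_minus_inverse_nonzero
    by (metis minus_diff_eq nonzero_eq_divide_eq mult_minus_right times_divide_eq_left mult_1)
  then show "csc (1 / (qc - 1 / qc)) (csc qc a - csc (inverse qc) a) = a"
    "csc (1 / (qc - 1 / qc)) (csc (inverse qc) a - csc qc a) = - a"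
    using q_minus_inverse_nonzero unfolding difference csc_csc inverse_eq_divide by (simp_all add: fun_eq_iff)
qed

lemma Uq_rels_act_u_coef:
  assumes k: "k \<in> {1..3}" and l: "l \<in> {1..3}" and r: "r \<in> Uq_rels q"
  shows "r \<triangleright> u_coef q k l = 0"
proof -
  have l_cases: "l = 1 \<or> l = 2 \<or> l = 3" using l by auto
  note rules = rshift_u_coef[OF k] index_mem index_wt_def power_int_minus
  note more_rules = rules cartan_def power2_eq_square
  from r show ?thesis
  proof (cases rule: Uq_relsE)
    case (K_Kinv i)
    then show ?thesis using l_cases by (cases i) (elim disjE; simp add: more_rules)+
  next
    case (Kinv_K i)
    then show ?thesis using l_cases by (cases i) (elim disjE; simp add: more_rules)+
  next
    case (K_K i j)
    then show ?thesis using l_cases by (cases i; cases j) (elim disjE; simp add: more_rules)+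
  next
    case (K_E i j)
    then show ?thesis using l_cases by (cases i; cases j) (elim disjE; simp add: more_rules)+
  next
    case (K_F i j)
    then show ?thesis using l_cases by (cases i; cases j) (elim disjE; simp add: more_rules)+
  next
    case (E_F i j)
    have "Suc (Suc 0) = 2" by simp
    then show ?thesis unfolding E_F using l_cases
      by (cases i; cases j; elim disjE; hypsubst; simp add: rules; simp only: csc_q_difference)
  next
    case (Serre_E i j)
    then show ?thesis using l_cases by (cases i; cases j) (elim disjE; simp add: more_rules)+
  next
    case (Serre_F i j)
    then show ?thesis using l_cases by (cases i; cases j) (elim disjE; simp add: more_rules)+
  qed
qed

lemma u_coef_Uq_dual:
  assumes "k \<in> {1..3}" "l \<in> {1..3}" shows "u_coef q k l \<in> \<D>"
proof -
  let ?G = "{u_coef q k l | k l. k \<in> {1..3} \<and> l \<in> {1..3}}"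
  have base: "u_coef q k l \<in> fn.span ?G" if "k \<in> {1..3}" "l \<in> {1..3}" for k l
    using that by (intro fn.span_base) auto
  have "fn.span ?G \<subseteq> \<D>"
  proof (rule span_subset_Uq_dual)
    fix x g assume "x \<in> ?G"
    then obtain k l where x: "x = u_coef q k l" and kl: "k \<in> {1..3}" "l \<in> {1..3}" by auto
    show "rshift g x \<in> fn.span ?G"
      unfolding x using kl num_in
      by (cases g) (auto simp only: rshift_u_coef[OF kl] intro!: base fn.span_scale fn.span_zero split: if_splits)
  qed (auto intro: Uq_rels_act_u_coef)
  then show ?thesis using base[OF assms] by auto
qed

section \<open>Weights and the coordinate algebra\<close>

lemma q_powi_eq_1: "qc powi m = 1 \<longleftrightarrow> m = 0"
proof
  assume "qc powi m = 1"
  then have power: "\<bar>q\<bar> powi m = 1"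
    by (metis norm_of_real norm_one norm_power_int)
  then have inverse_power: "\<bar>q\<bar> powi (- m) = 1" by (simp add: power_int_minus)
  have q: "\<bar>q\<bar> \<noteq> 1" "\<bar>q\<bar> > 0" using q_generic by auto
  have "\<bar>q\<bar> ^ nat \<bar>m\<bar> = 1" using power inverse_power
    by (cases "m \<ge> 0") (auto simp: power_int_def abs_if split: if_splits)
  then have "nat \<bar>m\<bar> = 0"
    using q power_eq_1_iff[of "\<bar>q\<bar>" "nat \<bar>m\<bar>"] by (cases "nat \<bar>m\<bar> = 0") auto
  then show "m = 0" by simp
qed simp

lemma q_powi_inj: "qc powi m = qc powi n \<longleftrightarrow> m = n"
  using q_powi_eq_1[of "m - n"] by (auto simp: power_int_diff)

text \<open>In \<open>bihom \<mu> \<nu> a\<close>, multiplication by \<open>K\<^sub>i\<close> from the left and from the right scales \<open>a\<close> by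
  \<open>q\<close> to the power \<open>\<mu> i\<close> and \<open>\<nu> i\<close>.\<close>

inductive bihom :: "(node \<Rightarrow> int) \<Rightarrow> (node \<Rightarrow> int) \<Rightarrow> fnl \<Rightarrow> bool"
  where
    bihom_zero: "bihom \<mu> \<nu> 0"
  | bihom_unit: "bihom 0 0 unit"
  | bihom_u_coef: "k \<in> {1..3} \<Longrightarrow> l \<in> {1..3} \<Longrightarrow> bihom (index_wt k) (index_wt l) (u_coef q k l)"
  | bihom_add: "bihom \<mu> \<nu> a \<Longrightarrow> bihom \<mu> \<nu> b \<Longrightarrow> bihom \<mu> \<nu> (a + b)"
  | bihom_csc: "bihom \<mu> \<nu> a \<Longrightarrow> bihom \<mu> \<nu> (csc c a)"
  | bihom_conv: "bihom \<mu> \<nu> a \<Longrightarrow> bihom \<mu>' \<nu>' b \<Longrightarrow> bihom (\<mu> + \<mu>') (\<nu> + \<nu>') (a \<star> b)"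
  | bihom_antip: "bihom \<mu> \<nu> a \<Longrightarrow> bihom (- \<nu>) (- \<mu>) (antip a)"

lemma subspace_bihom: "fn.subspace {a. bihom \<mu> \<nu> a}"
  by (auto simp: fn.subspace_def intro: bihom_zero bihom_add bihom_csc)

lemma bihom_Uq_dual: "bihom \<mu> \<nu> a \<Longrightarrow> a \<in> \<D>"
  by (induction rule: bihom.induct)
    (use subspace_Uq_dual in \<open>simp_all only: unit_Uq_dual u_coef_Uq_dual conv_Uq_dual antip_Uq_dual
      fn.subspace_0 fn.subspace_add fn.subspace_scale\<close>)

lemma inverse_eigenvector:
  assumes "a = f (csc (qc powi n) a)" "\<And>c a. f (csc c a) = csc c (f a)"
  shows "f a = csc (qc powi (- n)) a"
proof -
  have "csc (qc powi (- n)) a = csc (qc powi (- n)) (csc (qc powi n) (f a))"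
    using assms by metis
  then show ?thesis by (simp flip: power_int_add)
qed

lemma rshift_Kinv_eq:
  assumes "a \<in> \<D>" "rshift (K i) a = csc (qc powi n) a"
  shows "rshift (Kinv i) a = csc (qc powi (- n)) a"
  using rshift_K_Kinv(2)[OF assms(1), of i] assms(2)
  by (intro inverse_eigenvector[where f = "rshift (Kinv i)"]) simp_all

lemma lshift_Kinv_eq:
  assumes "a \<in> \<D>" "lshift (K i) a = csc (qc powi n) a"
  shows "lshift (Kinv i) a = csc (qc powi (- n)) a"
  using lshift_K_Kinv(1)[OF assms(1), of i] assms(2)
  by (intro inverse_eigenvector[where f = "lshift (Kinv i)"]) simp_all

lemma bihom_weights:
  "bihom \<mu> \<nu> a \<Longrightarrow> lshift (K i) a = csc (qc powi \<mu> i) a \<and> rshift (K i) a = csc (qc powi \<nu> i) a"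
proof (induction rule: bihom.induct)
  case (bihom_zero \<mu> \<nu>)
  show ?case by (simp only: lshift_linear rshift_linear csc_zero simp_thms)
next
  case (bihom_u_coef k l)
  then show ?case by (simp only: lshift_u_coef rshift_u_coef simp_thms)
next
  case (bihom_add \<mu> \<nu> a b)
  then show ?case by (simp only: lshift_linear rshift_linear csc_add simp_thms)
next
  case (bihom_csc \<mu> \<nu> a c)
  then show ?case by (simp only: lshift_linear rshift_linear csc_csc mult.commute simp_thms)
next
  case (bihom_conv \<mu> \<nu> a \<mu>' \<nu>' b)
  then show ?case
    by (simp only: lshift_conv rshift_conv conv_csc_left conv_csc_right csc_csc plus_fun_apply simp_thms)
      (simp add: power_int_add mult.commute)
next
  case (bihom_antip \<mu> \<nu> a)
  then have "lshift (Kinv i) a = csc (qc powi (- \<mu> i)) a" "rshift (Kinv i) a = csc (qc powi (- \<nu> i)) a"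
    by (blast intro: lshift_Kinv_eq rshift_Kinv_eq bihom_Uq_dual)+
  then show ?case by (simp only: lshift_antip rshift_antip antip_linear) simp
qed simp_all

definition bihom_pairs :: "(node \<Rightarrow> int) \<Rightarrow> (node \<Rightarrow> int) \<Rightarrow> (fnl \<times> fnl) set"
  where "bihom_pairs \<mu> \<nu> = {(x, y). \<exists>\<kappa>. bihom \<mu> \<kappa> x \<and> bihom \<kappa> \<nu> y}"

lemma bihom_pairsI: "bihom \<mu> \<kappa> x \<Longrightarrow> bihom \<kappa> \<nu> y \<Longrightarrow> (x, y) \<in> bihom_pairs \<mu> \<nu>"
  by (auto simp: bihom_pairs_def)

lemma bihom_pairs_conv:
  "(x, y) \<in> bihom_pairs \<mu> \<nu> \<Longrightarrow> (x', y') \<in> bihom_pairs \<mu>' \<nu>' \<Longrightarrow>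
    (x \<star> x', y \<star> y') \<in> bihom_pairs (\<mu> + \<mu>') (\<nu> + \<nu>')"
  by (auto simp: bihom_pairs_def intro: bihom_conv)

lemma bihom_pairs_antip: "(x, y) \<in> bihom_pairs \<mu> \<nu> \<Longrightarrow> (antip y, antip x) \<in> bihom_pairs (- \<nu>) (- \<mu>)"
  by (auto simp: bihom_pairs_def intro: bihom_antip)

lemma bihom_pairs_u_coef:
  assumes "k \<in> {1..3}" "l \<in> {1..3}"
  shows "set (map (\<lambda>m. (u_coef q k m, u_coef q m l)) [1, 2, 3]) \<subseteq> bihom_pairs (index_wt k) (index_wt l)"
proof -
  have "(u_coef q k m, u_coef q m l) \<in> bihom_pairs (index_wt k) (index_wt l)" if "m \<in> {1..3}" for m
    using assms that by (blast intro: bihom_pairsI bihom_u_coef)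
  then show ?thesis using index_mem by simp
qed

lemma bihom_coproduct: "bihom \<mu> \<nu> a \<Longrightarrow> \<exists>ps. coproduct_rep a ps \<and> set ps \<subseteq> bihom_pairs \<mu> \<nu>"
proof (induction rule: bihom.induct)
  case (bihom_zero \<mu> \<nu>)
  have "set [] \<subseteq> bihom_pairs \<mu> \<nu>" by simp
  then show ?case using coproduct_rep_zero by blast
next
  case bihom_unit
  have "set [(unit, unit)] \<subseteq> bihom_pairs 0 0" by (simp add: bihom_pairsI[OF bihom.bihom_unit bihom.bihom_unit])
  then show ?case using coproduct_rep_unit by blast
next
  case (bihom_u_coef k l)
  then show ?case using coproduct_rep_u_coef bihom_pairs_u_coef by blast
next
  case (bihom_add \<mu> \<nu> a b)
  then obtain ps qs where "coproduct_rep a ps" "set ps \<subseteq> bihom_pairs \<mu> \<nu>"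
    "coproduct_rep b qs" "set qs \<subseteq> bihom_pairs \<mu> \<nu>" by blast
  then show ?case by (intro exI[of _ "ps @ qs"] conjI coproduct_rep_add) auto
next
  case (bihom_csc \<mu> \<nu> a c)
  then obtain ps where "coproduct_rep a ps" "set ps \<subseteq> bihom_pairs \<mu> \<nu>" by blast
  then show ?case
    by (intro exI[of _ "map (\<lambda>(x, y). (csc c x, y)) ps"] conjI coproduct_rep_csc)
      (auto simp: bihom_pairs_def intro: bihom.bihom_csc)
next
  case (bihom_conv \<mu> \<nu> a \<mu>' \<nu>' b)
  then obtain ps qs where coproduct: "coproduct_rep a ps" "coproduct_rep b qs"
    and pairs: "set ps \<subseteq> bihom_pairs \<mu> \<nu>" "set qs \<subseteq> bihom_pairs \<mu>' \<nu>'" by blast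
  from pairs have "set (map (\<lambda>((x, y), (x', y')). (x \<star> x', y \<star> y')) (List.product ps qs))
      \<subseteq> bihom_pairs (\<mu> + \<mu>') (\<nu> + \<nu>')" by (auto intro: bihom_pairs_conv)
  then show ?case using coproduct_rep_conv[OF coproduct] by blast
next
  case (bihom_antip \<mu> \<nu> a)
  then obtain ps where ps: "coproduct_rep a ps" "set ps \<subseteq> bihom_pairs \<mu> \<nu>" by blast
  then have "set (map (\<lambda>(x, y). (antip y, antip x)) ps) \<subseteq> bihom_pairs (- \<nu>) (- \<mu>)"
    by (auto intro: bihom_pairs_antip)
  then show ?case using coproduct_rep_antip[OF ps(1)] by blast
qed

definition bihomogeneous :: "fnl set" where "bihomogeneous = {a. \<exists>\<mu> \<nu>. bihom \<mu> \<nu> a}"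

lemma bihom_span: "bihom \<mu> \<nu> a \<Longrightarrow> a \<in> fn.span bihomogeneous"
  by (auto simp: bihomogeneous_def intro: fn.span_base)

lemma bihom_pairs_span: "bihom_pairs \<mu> \<nu> \<subseteq> fn.span bihomogeneous \<times> fn.span bihomogeneous"
  by (auto simp: bihom_pairs_def intro: bihom_span)

lemma coproduct_rep_span_bihomogeneous:
  assumes "a \<in> fn.span bihomogeneous"
  shows "\<exists>ps. coproduct_rep a ps \<and> set ps \<subseteq> fn.span bihomogeneous \<times> fn.span bihomogeneous"
proof -
  have "fn.span bihomogeneous
      \<subseteq> {a. \<exists>ps. coproduct_rep a ps \<and> set ps \<subseteq> fn.span bihomogeneous \<times> fn.span bihomogeneous}"
    using bihom_coproduct bihom_pairs_span
    by (intro fn.span_minimal subspace_coproduct_rep fn.subspace_span) (fastforce simp: bihomogeneous_def)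
  then show ?thesis using assms by blast
qed

lemma conv_span_bihomogeneous:
  assumes "a \<in> fn.span bihomogeneous" "b \<in> fn.span bihomogeneous"
  shows "a \<star> b \<in> fn.span bihomogeneous"
proof -
  have homogeneous: "x \<star> y \<in> fn.span bihomogeneous" if "x \<in> bihomogeneous" "y \<in> fn.span bihomogeneous" for x y
  proof -
    have "fn.span bihomogeneous \<subseteq> {y. x \<star> y \<in> fn.span bihomogeneous}"
      using that by (intro fn.span_minimal)
        (auto simp: bihomogeneous_def fn.subspace_def conv_add_right
          intro!: fn.span_zero fn.span_add fn.span_scale intro: fn.span_base bihom_conv)
    then show ?thesis using that by blast
  qed
  have "fn.span bihomogeneous \<subseteq> {x. x \<star> b \<in> fn.span bihomogeneous}"
    using assms(2) homogeneous by (intro fn.span_minimal)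
      (auto simp: fn.subspace_def conv_add_left intro!: fn.span_zero fn.span_add fn.span_scale)
  then show ?thesis using assms by blast
qed

lemma antip_span_bihomogeneous:
  assumes "a \<in> fn.span bihomogeneous" shows "antip a \<in> fn.span bihomogeneous"
proof -
  have "fn.span bihomogeneous \<subseteq> {x. antip x \<in> fn.span bihomogeneous}"
    by (intro fn.span_minimal)
      (auto simp: bihomogeneous_def fn.subspace_def
        intro!: fn.span_zero fn.span_add fn.span_scale intro: fn.span_base bihom_antip)
  then show ?thesis using assms by blast
qed

lemma span_bihomogeneous_Uq_dual: "fn.span bihomogeneous \<subseteq> \<D>"
  using subspace_Uq_dual by (intro fn.span_minimal) (auto simp: bihomogeneous_def bihom_Uq_dual)

lemma hopf_subalgebra_span_bihomogeneous: "hopf_subalgebra q (fn.span bihomogeneous)"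
  unfolding hopf_subalgebra_def
proof (intro conjI ballI allI)
  show "fn.span bihomogeneous \<subseteq> hopf_dual q"
    using coproduct_rep_span_bihomogeneous span_bihomogeneous_Uq_dual
    by (fastforce simp: hopf_dual_def sweedler_iff)
  show "unit \<in> fn.span bihomogeneous" by (rule bihom_span[OF bihom_unit])
  fix a assume a: "a \<in> fn.span bihomogeneous"
  show "\<exists>ps. sweedler (fn.span bihomogeneous) (fn.span bihomogeneous) a ps"
    using coproduct_rep_span_bihomogeneous[OF a] by (auto simp: sweedler_iff)
  show "csc c a \<in> fn.span bihomogeneous" for c using a by (rule fn.span_scale)
  show "antip a \<in> fn.span bihomogeneous" using a by (rule antip_span_bihomogeneous)
  fix b assume b: "b \<in> fn.span bihomogeneous"
  show "a + b \<in> fn.span bihomogeneous" using a b by (rule fn.span_add)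
  show "a \<star> b \<in> fn.span bihomogeneous" using a b by (rule conv_span_bihomogeneous)
qed

abbreviation \<A> :: "fnl set" where "\<A> \<equiv> OqSU3 q"

lemma OqSU3_eq: "\<A> = fn.span bihomogeneous"
proof
  have "\<forall>k\<in>{1..3}. \<forall>l\<in>{1..3}. u_coef q k l \<in> fn.span bihomogeneous"
    by (blast intro: bihom_span bihom_u_coef)
  then show "\<A> \<subseteq> fn.span bihomogeneous"
    unfolding OqSU3_def using hopf_subalgebra_span_bihomogeneous by blast
  show "fn.span bihomogeneous \<subseteq> \<A>"
    unfolding OqSU3_def
  proof (rule Inter_greatest)
    fix H assume "H \<in> {H. hopf_subalgebra q H \<and> (\<forall>k\<in>{1..3}. \<forall>l\<in>{1..3}. u_coef q k l \<in> H)}"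
    then have H: "hopf_subalgebra q H" and u_coef: "\<And>k l. k \<in> {1..3} \<Longrightarrow> l \<in> {1..3} \<Longrightarrow> u_coef q k l \<in> H" by auto
    have unit: "unit \<in> H" and add: "\<And>a b. a \<in> H \<Longrightarrow> b \<in> H \<Longrightarrow> a + b \<in> H"
      and conv: "\<And>a b. a \<in> H \<Longrightarrow> b \<in> H \<Longrightarrow> a \<star> b \<in> H"
      and csc: "\<And>c a. a \<in> H \<Longrightarrow> csc c a \<in> H" and antip: "\<And>a. a \<in> H \<Longrightarrow> antip a \<in> H"
      using H by (auto simp: hopf_subalgebra_def)
    have zero: "0 \<in> H" using csc[OF unit, of 0] by simp
    have "a \<in> H" if "bihom \<mu> \<nu> a" for \<mu> \<nu> a
      using that by induction (blast intro: zero unit add conv csc antip u_coef)+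
    then show "fn.span bihomogeneous \<subseteq> H"
      using zero add csc by (intro fn.span_minimal) (auto simp: fn.subspace_def bihomogeneous_def)
  qed
qed

lemma subspace_OqSU3: "fn.subspace \<A>"
  by (simp only: OqSU3_eq fn.subspace_span)

lemma OqSU3_zero [simp]: "0 \<in> \<A>"
  and OqSU3_csc [simp]: "a \<in> \<A> \<Longrightarrow> csc c a \<in> \<A>"
  and OqSU3_conv [simp]: "a \<in> \<A> \<Longrightarrow> b \<in> \<A> \<Longrightarrow> a \<star> b \<in> \<A>"
  and OqSU3_antip [simp]: "a \<in> \<A> \<Longrightarrow> antip a \<in> \<A>"
  and OqSU3_coproduct: "a \<in> \<A> \<Longrightarrow> \<exists>ps. coproduct_rep a ps \<and> set ps \<subseteq> \<A> \<times> \<A>"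
  and bihom_OqSU3: "bihom \<mu> \<nu> a \<Longrightarrow> a \<in> \<A>"
  by (simp_all only: OqSU3_eq fn.span_zero fn.span_scale conv_span_bihomogeneous antip_span_bihomogeneous
      coproduct_rep_span_bihomogeneous bihom_span)

lemma OqSU3_unit [simp]: "unit \<in> \<A>"
  by (rule bihom_OqSU3[OF bihom_unit])

lemma OqSU3_Uq_dual [simp]: "a \<in> \<A> \<Longrightarrow> a \<in> \<D>"
  using span_bihomogeneous_Uq_dual by (auto simp: OqSU3_eq)

definition weight_space :: "(node \<Rightarrow> int) \<Rightarrow> fnl set"
  where "weight_space \<nu> = {a \<in> \<A>. \<forall>i. rshift (K i) a = csc (qc powi \<nu> i) a}"

lemma weight_space_OqSU3: "a \<in> weight_space \<nu> \<Longrightarrow> a \<in> \<A>"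
  by (simp add: weight_space_def)

lemma bihom_weight_space: "bihom \<mu> \<nu> a \<Longrightarrow> a \<in> weight_space \<nu>"
  using bihom_weights bihom_OqSU3 by (simp add: weight_space_def)

lemma subspace_weight_space: "fn.subspace (weight_space \<nu>)"
  using subspace_OqSU3 by (auto simp: fn.subspace_def weight_space_def csc_add mult.commute)

lemmas weight_space_zero = fn.subspace_0[OF subspace_weight_space]
lemmas weight_space_csc = fn.subspace_scale[OF subspace_weight_space]

lemma OqSU3_act [simp]:
  assumes "a \<in> \<A>" shows "X \<triangleright> a \<in> \<A>"
proof -
  obtain ps where ps: "coproduct_rep a ps" "set ps \<subseteq> \<A> \<times> \<A>" using OqSU3_coproduct[OF assms] by blast
  show ?thesis
    unfolding coproduct_rep_act[OF ps(1)] using ps(2) subspace_OqSU3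
    by (intro fn.subspace_sum_list) auto
qed

lemma weight_space_conv: "a \<in> weight_space \<mu> \<Longrightarrow> b \<in> weight_space \<nu> \<Longrightarrow> a \<star> b \<in> weight_space (\<mu> + \<nu>)"
  by (auto simp: weight_space_def rshift_conv power_int_add mult.commute)

lemma weight_space_sum_zero:
  assumes "finite S" "\<And>\<nu>. \<nu> \<in> S \<Longrightarrow> f \<nu> \<in> weight_space \<nu>" "(\<Sum>\<nu>\<in>S. f \<nu>) = 0" "\<nu> \<in> S"
  shows "f \<nu> = 0"
proof (rule fn.simultaneous_eigenvectors_sum_zero
    [where T = "\<lambda>i. rshift (K i)" and c = "\<lambda>\<nu> i. qc powi \<nu> i" and f = f and S = S])
  show "module_hom csc csc (rshift (K i))" for i
    by unfold_locales simp_all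
  show "rshift (K i) (f s) = csc (qc powi s i) (f s)" if "s \<in> S" for s i
    using assms(2)[OF that] by (simp add: weight_space_def)
  show "inj_on (\<lambda>\<nu> i. qc powi \<nu> i) S"
    by (auto simp: inj_on_def fun_eq_iff q_powi_inj)
qed fact+

lemma weight_space_span:
  assumes "a \<in> weight_space \<nu>"
  shows "a \<in> fn.span (\<Union>\<mu>. {a. bihom \<mu> \<nu> a})"
proof -
  let ?H = "\<lambda>\<nu>. fn.span (\<Union>\<mu>. {a. bihom \<mu> \<nu> a})"
  have subset: "?H \<nu> \<subseteq> weight_space \<nu>" for \<nu>
    by (intro fn.span_minimal subspace_weight_space) (auto intro: bihom_weight_space)
  have "bihomogeneous \<subseteq> (\<Union>\<nu>. ?H \<nu>)" by (auto simp: bihomogeneous_def intro: fn.span_base)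
  then have "a \<in> fn.span (\<Union>\<nu>. ?H \<nu>)"
    using weight_space_OqSU3[OF assms] fn.span_mono unfolding OqSU3_eq by blast
  then obtain S f where S: "finite S" "\<And>\<nu>. f \<nu> \<in> ?H \<nu>" "a = (\<Sum>\<nu>\<in>S. f \<nu>)"
    by (rule fn.span_UN_subspaceE[rotated]) (auto simp: fn.subspace_span)
  define component where "component = (if \<nu> \<in> S then f \<nu> else 0)"
  have component: "component \<in> ?H \<nu>" using S(2) by (simp add: component_def fn.span_zero)
  have "component - a = 0"
  proof -
    let ?g = "\<lambda>\<kappa>. if \<kappa> = \<nu> then component - a else f \<kappa>"
    have "f \<kappa> \<in> weight_space \<kappa>" "component - a \<in> weight_space \<nu>" for \<kappa>
      using subset S(2) component assms fn.subspace_diff[OF subspace_weight_space] by blast+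
    then have weights: "?g \<kappa> \<in> weight_space \<kappa>" for \<kappa> by (simp only: split: if_split) blast
    have "(\<Sum>\<kappa>\<in>insert \<nu> S. ?g \<kappa>) = (component - a) + (\<Sum>\<kappa>\<in>S - {\<nu>}. f \<kappa>)"
      using S(1) by (simp add: sum.insert_remove)
    also have "\<dots> = 0" using S(1,3) by (auto simp: component_def sum.remove)
    finally have "?g \<nu> = 0"
      using S(1) weights by (intro weight_space_sum_zero[of "insert \<nu> S" ?g \<nu>]) simp_all
    then show ?thesis by simp
  qed
  then show ?thesis using component by simp
qed

lemma weight_space_decomp:
  assumes "a \<in> weight_space \<nu>"
  obtains S f where "finite S" "\<And>\<mu>. bihom \<mu> \<nu> (f \<mu>)" "a = (\<Sum>\<mu>\<in>S. f \<mu>)"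
  using fn.span_UN_subspaceE[OF subspace_bihom weight_space_span[OF assms]] by auto

lemma weight_space_coproduct:
  assumes "a \<in> weight_space \<nu>" shows "\<exists>ps. coproduct_rep a ps \<and> set ps \<subseteq> \<A> \<times> weight_space \<nu>"
proof -
  have "bihom_pairs \<mu> \<nu> \<subseteq> \<A> \<times> weight_space \<nu>" for \<mu>
    by (auto simp: bihom_pairs_def intro: bihom_OqSU3 bihom_weight_space)
  then have "fn.span (\<Union>\<mu>. {a. bihom \<mu> \<nu> a}) \<subseteq> {a. \<exists>ps. coproduct_rep a ps \<and> set ps \<subseteq> \<A> \<times> weight_space \<nu>}"
    using bihom_coproduct by (intro fn.span_minimal subspace_coproduct_rep subspace_OqSU3) fast
  then show ?thesis using weight_space_span[OF assms] by blast
qed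

abbreviation \<B> :: "fnl set" where "\<B> \<equiv> OqF3 q"

lemma OqF3_eq: "\<B> = weight_space 0"
proof -
  have "rshift (Kinv i) a = a" if "a \<in> \<A>" "\<forall>i. rshift (K i) a = a" for a i
    using rshift_Kinv_eq[of a i 0] that by simp
  then show ?thesis by (auto simp: OqF3_def weight_space_def)
qed

lemma OqF3_OqSU3: "b \<in> \<B> \<Longrightarrow> b \<in> \<A>"
  by (simp only: OqF3_eq weight_space_OqSU3)

lemma subspace_OqF3: "fn.subspace \<B>"
  by (simp only: OqF3_eq subspace_weight_space)

lemma OqF3_unit: "unit \<in> \<B>"
  using bihom_weight_space[OF bihom_unit] by (simp only: OqF3_eq)

lemma OqF3_conv: "a \<in> \<B> \<Longrightarrow> b \<in> \<B> \<Longrightarrow> a \<star> b \<in> \<B>"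
  using weight_space_conv[of a 0 b 0] by (simp add: OqF3_eq)

end

section \<open>Root vectors\<close>

lemma UNIV_rvec: "UNIV = {Eix A1, Eix A2, Eix A12, Fix A1, Fix A2, Fix A12}"
proof (rule UNIV_eq_I)
  show "r \<in> {Eix A1, Eix A2, Eix A12, Fix A1, Fix A2, Fix A12}" for r
    by (cases r; rename_tac \<gamma>; case_tac \<gamma>; simp)
qed

instance rvec :: finite
  by standard (simp add: UNIV_rvec)

lemma sum_rvec: "(\<Sum>r\<in>UNIV. f r) = f (Eix A1) + f (Eix A2) + f (Eix A12) + f (Fix A1) + f (Fix A2) + f (Fix A12)"
  for f :: "rvec \<Rightarrow> 'a::comm_monoid_add"
  by (simp add: UNIV_rvec add.assoc)

lemma UNIV_root: "UNIV = {A1, A2, A12}"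
proof (rule UNIV_eq_I)
  show "\<gamma> \<in> {A1, A2, A12}" for \<gamma> by (cases \<gamma>) simp_all
qed

instance root :: finite
  by standard (simp add: UNIV_root)

lemma sum_root: "(\<Sum>\<gamma>\<in>UNIV. f \<gamma>) = f A1 + f A2 + f A12" for f :: "root \<Rightarrow> 'a::comm_monoid_add"
  by (simp add: UNIV_root add.assoc)

fun root_wt :: "root \<Rightarrow> node \<Rightarrow> int"
  where "root_wt A1 i = cartan i N1" | "root_wt A2 i = cartan i N2" | "root_wt A12 i = cartan i N1 + cartan i N2"

fun wt :: "rvec \<Rightarrow> node \<Rightarrow> int"
  where "wt (Eix \<gamma>) i = root_wt \<gamma> i" | "wt (Fix \<gamma>) i = - root_wt \<gamma> i"

lemma wt_inj: "wt r = wt s \<longleftrightarrow> r = s"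
proof
  assume "wt r = wt s"
  then have "wt r N1 = wt s N1" "wt r N2 = wt s N2" by simp_all
  then show "r = s"
    by (cases r; cases s; rename_tac \<gamma> \<delta>; case_tac \<gamma>; case_tac \<delta>; simp add: cartan_def)
qed simp

lemma wt_nonzero: "wt r \<noteq> 0"
proof
  assume "wt r = 0"
  then have "wt r N1 = 0" "wt r N2 = 0" by simp_all
  then show False
    by (cases r; rename_tac \<gamma>; case_tac \<gamma>; simp add: cartan_def)
qed

definition all_rvecs :: "rvec list"
  where "all_rvecs = [Eix A1, Eix A2, Eix A12, Fix A1, Fix A2, Fix A12]"

lemma sum_all_rvecs: "(\<Sum>r\<leftarrow>all_rvecs. f r) = (\<Sum>r\<in>UNIV. f r)"
  for f :: "rvec \<Rightarrow> 'a::comm_monoid_add"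
  by (simp add: all_rvecs_def sum_rvec add.assoc)

lemma star_superset:
  assumes "finite S" "Poly_Mapping.keys X \<subseteq> S"
  shows "star X =
    (\<Sum>w\<in>S. fscale (cnj (Poly_Mapping.lookup X w)) (prod_list (rev (map star_gen (letters w)))))"
  unfolding star_def using assms
  by (intro sum.mono_neutral_left) (auto simp: in_keys_iff)

lemma star_minus: "star (X - Y) = star X - star Y"
proof -
  let ?S = "Poly_Mapping.keys X \<union> Poly_Mapping.keys Y"
  have "star Z = (\<Sum>w\<in>?S. fscale (cnj (Poly_Mapping.lookup Z w)) (prod_list (rev (map star_gen (letters w)))))"
    if "Z \<in> {X, Y, X - Y}" for Z
    using that keys_diff[of X Y] by (intro star_superset) auto
  then show ?thesis
    by (simp add: lookup_minus flin.scale_left_diff_distrib sum_subtractf)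
qed

lemma star_single:
  "star (Poly_Mapping.single w c) = fscale (cnj c) (prod_list (rev (map star_gen (letters w))))"
  by (cases "c = 0") (simp_all add: star_def)

lemma star_E: "star (lett (E i)) = lett (K i) * lett (F i)"
  by (simp add: lett_def mon_def star_single)

lemma star_E12: "star (Evec q A12) = lett (K N1) * lett (F N1) * (lett (K N2) * lett (F N2))
    - fscale (1 / complex_of_real q) (lett (K N2) * lett (F N2) * (lett (K N1) * lett (F N1)))"
proof -
  have "Evec q A12 = Poly_Mapping.single (Word [E N2, E N1]) 1
      - Poly_Mapping.single (Word [E N1, E N2]) (1 / complex_of_real q)"
    by (simp add: lett_mult fscale_mon) (simp add: mon_def)
  then show ?thesis by (simp add: star_minus star_single)
qed

lemma Xvec_act:
  "Xvec q (Eix A1) \<triangleright> a = rshift (E N1) a"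
  "Xvec q (Eix A2) \<triangleright> a = rshift (E N2) a"
  "Xvec q (Eix A12) \<triangleright> a =
    rshift (E N2) (rshift (E N1) a) - csc (1 / complex_of_real q) (rshift (E N1) (rshift (E N2) a))"
  "Xvec q (Fix A1) \<triangleright> a = rshift (K N1) (rshift (F N1) a)"
  "Xvec q (Fix A2) \<triangleright> a = rshift (K N2) (rshift (F N2) a)"
  "Xvec q (Fix A12) \<triangleright> a = rshift (K N1) (rshift (F N1) (rshift (K N2) (rshift (F N2) a)))
     - csc (1 / complex_of_real q) (rshift (K N2) (rshift (F N2) (rshift (K N1) (rshift (F N1) a))))"
  by (simp_all add: star_E star_E12 del: Evec.simps(3)) simp

declare Xvec.simps [simp del]

text \<open>\<open>\<Delta>(X\<^sub>s) = \<Sum>\<^sub>r X\<^sub>r \<otimes> Gvec r s + 1 \<otimes> X\<^sub>s\<close>, so that \<open>r c = \<Sum>\<^sub>s \<langle>Gvec r s, c\<rangle> s\<close> in \<open>\<Lambda>\<^sup>1\<close>.\<close>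

fun Kvec :: "root \<Rightarrow> gen free_alg"
  where "Kvec A1 = lett (K N1)" | "Kvec A2 = lett (K N2)" | "Kvec A12 = lett (K N1) * lett (K N2)"

fun root_of :: "rvec \<Rightarrow> root" where "root_of (Eix \<gamma>) = \<gamma>" | "root_of (Fix \<gamma>) = \<gamma>"

definition Gvec :: "real \<Rightarrow> rvec \<Rightarrow> rvec \<Rightarrow> gen free_alg"
  where "Gvec q r s = (if r = s then Kvec (root_of r)
     else if r = Eix A1 \<and> s = Eix A12
     then fscale (complex_of_real q - 1 / complex_of_real q) (lett (K N1) * lett (E N2))
     else if r = Fix A1 \<and> s = Fix A12
     then fscale (complex_of_real q - 1 / complex_of_real q) (lett (K N2) * lett (F N2) * lett (K N1))
     else 0)"

context quantum_parameter
begin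

lemmas rshift_K_rules = rshift_K_E rshift_K_F rshift_Kinv_E rshift_Kinv_F

lemma rshift_K2_K1: "a \<in> \<D> \<Longrightarrow> rshift (K N2) (rshift (K N1) a) = rshift (K N1) (rshift (K N2) a)"
  by (rule rshift_K_K)

lemma Xvec_conv:
  assumes "a \<in> \<D>" "b \<in> \<D>"
  shows "Xvec q t \<triangleright> (a \<star> b) = (\<Sum>r\<in>UNIV. (Xvec q r \<triangleright> a) \<star> (Gvec q r t \<triangleright> b)) + a \<star> (Xvec q t \<triangleright> b)"
  using assms
  by (cases t; rename_tac \<gamma>; case_tac \<gamma>)
    (simp_all add: sum_rvec Xvec_act Gvec_def rshift_conv conv_linear rshift_K_rules cartan_def rshift_K2_K1
      csc_add csc_minus,
     simp_all add: fun_eq_iff field_simps power_int_minus power2_eq_square)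

lemma Gvec_conv:
  assumes "a \<in> \<D>" "b \<in> \<D>"
  shows "Gvec q r t \<triangleright> (a \<star> b) = (\<Sum>s\<in>UNIV. (Gvec q r s \<triangleright> a) \<star> (Gvec q s t \<triangleright> b))"
  using assms
  by (cases r; cases t; rename_tac \<gamma> \<delta>; case_tac \<gamma>; case_tac \<delta>)
    (simp_all add: sum_rvec Gvec_def rshift_conv conv_linear rshift_K_rules cartan_def rshift_K2_K1
      csc_add csc_minus)

lemma Gvec_unit: "Gvec q r t \<triangleright> unit = (if r = t then unit else 0)"
  by (cases r; cases t; rename_tac \<gamma> \<delta>; case_tac \<gamma>; case_tac \<delta>; simp add: Gvec_def)

lemma Xvec_unit: "Xvec q r \<triangleright> unit = 0"
  by (cases r; rename_tac \<gamma>; case_tac \<gamma>) (simp_all add: Xvec_act)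

lemma rshift_K_Xvec:
  assumes "a \<in> \<D>"
  shows "rshift (K i) (Xvec q r \<triangleright> a) = csc (qc powi wt r i) (Xvec q r \<triangleright> rshift (K i) a)"
  using assms
  by (cases i; cases r; rename_tac \<gamma>; case_tac \<gamma>)
    (simp_all add: Xvec_act rshift_K_rules cartan_def rshift_K2_K1 csc_minus,
     simp_all add: fun_eq_iff field_simps power_int_minus power2_eq_square)

lemma rshift_K_Gvec:
  assumes "a \<in> \<D>"
  shows "rshift (K i) (Gvec q r s \<triangleright> a) = csc (qc powi (wt s i - wt r i)) (Gvec q r s \<triangleright> rshift (K i) a)"
  using assms
  by (cases i; cases r; cases s; rename_tac \<gamma> \<delta>; case_tac \<gamma>; case_tac \<delta>;
      simp add: Gvec_def rshift_K_rules cartan_def rshift_K2_K1 csc_minus;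
      simp add: fun_eq_iff field_simps power_int_minus power2_eq_square)

lemma Xvec_weight_space:
  assumes "a \<in> weight_space \<nu>" shows "Xvec q r \<triangleright> a \<in> weight_space (\<nu> + wt r)"
  using assms by (auto simp: weight_space_def rshift_K_Xvec power_int_add mult.commute)

lemma Gvec_weight_space:
  assumes "a \<in> weight_space \<nu>" shows "Gvec q r s \<triangleright> a \<in> weight_space (\<nu> + wt s - wt r)"
  using assms by (auto simp: weight_space_def rshift_K_Gvec power_int_add power_int_diff mult.commute)

lemma Xvec_OqF3: "a \<in> \<B> \<Longrightarrow> Xvec q r \<triangleright> a \<in> weight_space (wt r)"
  using Xvec_weight_space[of a 0 r] by (simp only: OqF3_eq add_0_left)

section \<open>Duals of the root vectors\<close>

lemma counit_zero_if_weights_differ: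
  assumes "a \<in> weight_space \<nu>" "\<And>i. lshift (K i) a = csc (qc powi \<mu> i) a" "\<mu> \<noteq> \<nu>"
  shows "a 0 = 0"
proof -
  from assms(3) obtain i where i: "\<mu> i \<noteq> \<nu> i" by (auto simp: fun_eq_iff)
  have "(rshift (K i) a) 0 = (lshift (K i) a) 0" by (simp add: rshift_apply lshift_apply)
  then have "qc powi \<nu> i * a 0 = qc powi \<mu> i * a 0"
    using assms(1) by (simp add: assms(2) weight_space_def)
  then show ?thesis using i by (simp add: q_powi_inj)
qed

lemma bihom_act_counit:
  assumes "bihom \<mu> 0 b" "\<And>b. b \<in> \<B> \<Longrightarrow> X \<triangleright> b \<in> weight_space \<nu>" "\<mu> \<noteq> \<nu>"
  shows "(X \<triangleright> b) 0 = 0"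
proof (rule counit_zero_if_weights_differ)
  show "X \<triangleright> b \<in> weight_space \<nu>"
    using assms(2) bihom_weight_space[OF assms(1)] by (simp only: OqF3_eq)
  show "lshift (K i) (X \<triangleright> b) = csc (qc powi \<mu> i) (X \<triangleright> b)" for i
    using bihom_weights[OF assms(1), of i] by (simp only: lshift_act act_linear simp_thms)
qed fact

lemma bihom_counit: "bihom \<mu> 0 b \<Longrightarrow> \<mu> \<noteq> 0 \<Longrightarrow> b 0 = 0"
  using bihom_act_counit[of \<mu> b 1 0] by (simp add: OqF3_eq)

lemma pair_Xvec_weight: "bihom \<mu> 0 b \<Longrightarrow> \<mu> \<noteq> wt r \<Longrightarrow> pair (Xvec q r) b = 0"
  using bihom_act_counit[of \<mu> b "Xvec q r" "wt r"] Xvec_OqF3 by (simp add: act_apply_0)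

lemma cot_act: "cot q y r = (Xvec q r \<triangleright> y) 0"
  by (simp add: cot_def act_apply_0)

lemma bihom_u_antip:
  assumes "i \<in> {1..3}" "j \<in> {1..3}" "k \<in> {1..3}"
  shows "bihom (index_wt i - index_wt k) 0 (u_coef q i j \<star> antip (u_coef q j k))"
  using bihom_conv[OF bihom_u_coef[OF assms(1,2)] bihom_antip[OF bihom_u_coef[OF assms(2,3)]]] by simp

lemma rshift_K_antip_u_coef:
  assumes "j \<in> {1..3}"
  shows "rshift (K i) (antip (u_coef q j j)) = csc (qc powi (- index_wt j i)) (antip (u_coef q j j))"
  using bihom_weights[OF bihom_antip[OF bihom_u_coef[OF assms assms]], of i] by simp

end

text \<open>The entry of the vector representation in which a root vector is nonzero.\<close>

fun entry_row :: "rvec \<Rightarrow> nat"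
  where "entry_row (Eix \<gamma>) = (case \<gamma> of A1 \<Rightarrow> 2 | A2 \<Rightarrow> 3 | A12 \<Rightarrow> 3)"
  | "entry_row (Fix \<gamma>) = (case \<gamma> of A1 \<Rightarrow> 1 | A2 \<Rightarrow> 2 | A12 \<Rightarrow> 1)"

fun entry_col :: "rvec \<Rightarrow> nat"
  where "entry_col (Eix \<gamma>) = entry_row (Fix \<gamma>)" | "entry_col (Fix \<gamma>) = entry_row (Eix \<gamma>)"

lemma entry_mem: "entry_row r \<in> {1..3}" "entry_col r \<in> {1..3}"
  and entry_off_diagonal: "entry_row r \<noteq> entry_col r"
  by (cases r; rename_tac \<gamma>; case_tac \<gamma>; simp)+

lemma wt_eq_index_wt: "wt r = index_wt (entry_row r) - index_wt (entry_col r)"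
proof
  show "wt r n = (index_wt (entry_row r) - index_wt (entry_col r)) n" for n
    by (cases n; cases r; rename_tac \<gamma>; case_tac \<gamma>; simp add: index_wt_def cartan_def)
qed

context quantum_parameter
begin

lemma pair_Xvec_u_antip_nonzero:
  "pair (Xvec q r) (u_coef q (entry_row r) (entry_col r) \<star> antip (u_coef q (entry_col r) (entry_col r))) \<noteq> 0"
proof -
  let ?i = "entry_row r" and ?j = "entry_col r"
  have dual: "u_coef q ?i ?j \<in> \<D>" "antip (u_coef q ?j ?j) \<in> \<D>"
    using u_coef_Uq_dual entry_mem by simp_all
  have "antip (u_coef q ?j ?j) 0 = 1" by (simp add: antip_0 u_coef_0)
  moreover have "pair (Xvec q r) (u_coef q ?i ?j \<star> antip (u_coef q ?j ?j)) =
      (\<Sum>s\<in>UNIV. (Xvec q s \<triangleright> u_coef q ?i ?j) 0 * (Gvec q s r \<triangleright> antip (u_coef q ?j ?j)) 0)"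
    unfolding act_apply_0[symmetric] Xvec_conv[OF dual] using entry_off_diagonal by (simp add: conv_0 u_coef_0)
  ultimately show ?thesis
    by (cases r; rename_tac \<gamma>; case_tac \<gamma>)
      (simp_all add: sum_rvec Xvec_act Gvec_def rshift_u_coef rshift_K_antip_u_coef u_coef_0 index_wt_def index_mem)
qed

lemma exists_dual_element: "\<exists>b. bihom (wt r) 0 b \<and> pair (Xvec q r) b = 1"
proof -
  let ?b = "u_coef q (entry_row r) (entry_col r) \<star> antip (u_coef q (entry_col r) (entry_col r))"
  have "bihom (wt r) 0 (csc (1 / pair (Xvec q r) ?b) ?b)"
    unfolding wt_eq_index_wt by (intro bihom_csc bihom_u_antip entry_mem)
  moreover have "pair (Xvec q r) (csc (1 / pair (Xvec q r) ?b) ?b) = 1"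
    using pair_Xvec_u_antip_nonzero[of r] by (simp add: pair_linear)
  ultimately show ?thesis by blast
qed

definition dual_element :: "rvec \<Rightarrow> fnl"
  where "dual_element r = (SOME b. bihom (wt r) 0 b \<and> pair (Xvec q r) b = 1)"

lemma dual_element: "bihom (wt r) 0 (dual_element r)" "pair (Xvec q r) (dual_element r) = 1"
  using someI_ex[OF exists_dual_element[of r]] by (simp_all add: dual_element_def)

lemma cot_dual_element: "cot q (dual_element r) = unitvec r"
proof
  fix s
  show "cot q (dual_element r) s = unitvec r s"
    using dual_element(2)[of r] pair_Xvec_weight[OF dual_element(1), of r s] wt_inj[of r s]
    by (auto simp: cot_def unitvec_def)
qed

lemma dual_element_mem:
  "dual_element r \<in> \<B>" "dual_element r \<in> \<A>" "dual_element r 0 = 0" "dual_element r \<in> OqF3_plus q"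
proof -
  show mem: "dual_element r \<in> \<B>" using bihom_weight_space[OF dual_element(1)] by (simp only: OqF3_eq)
  show counit: "dual_element r 0 = 0" by (rule bihom_counit[OF dual_element(1) wt_nonzero])
  show "dual_element r \<in> OqF3_plus q" using mem counit by (simp add: OqF3_plus_def counit_def)
  show "dual_element r \<in> \<A>" by (rule bihom_OqSU3[OF dual_element(1)])
qed

section \<open>One-forms\<close>

lemma Lambda_act_eq:
  assumes "c \<in> \<A>" shows "Lambda_act q r c s = pair (Gvec q r s) c"
proof -
  let ?P = "\<lambda>y. y \<in> OqSU3_plus q \<and> cot q y = unitvec r"
  have "?P (dual_element r)"
    using dual_element_mem[of r] cot_dual_element by (simp add: OqSU3_plus_def counit_def)
  then have "?P (Lambda_rep q r)" unfolding Lambda_rep_def by (rule someI[where P = ?P])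
  then have rep: "Lambda_rep q r \<in> \<D>" "Lambda_rep q r 0 = 0"
    "\<And>t. (Xvec q t \<triangleright> Lambda_rep q r) 0 = of_bool (t = r)"
    by (simp_all add: OqSU3_plus_def counit_def fun_eq_iff cot_act unitvec_def)
  have "Lambda_act q r c s = (Xvec q s \<triangleright> (Lambda_rep q r \<star> c)) 0"
    by (simp add: Lambda_act_def cot_act)
  also have "\<dots> = (\<Sum>t\<in>UNIV. of_bool (t = r) * pair (Gvec q t s) c)"
    using assms rep by (simp add: Xvec_conv conv_0 act_apply_0)
  also have "\<dots> = pair (Gvec q r s) c" by (simp add: of_bool_def if_distrib if_distribR cong: if_cong)
  finally show ?thesis .
qed

definition right_mult :: "form1 \<Rightarrow> fnl \<Rightarrow> form1"
  where "right_mult \<omega> c = (\<lambda>s. \<Sum>r\<in>UNIV. \<omega> r \<star> (Gvec q r s \<triangleright> c))"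

lemma rmult_eq_right_mult:
  assumes "c \<in> \<A>" shows "rmult q \<omega> c = right_mult \<omega> c"
proof
  fix s
  define ps where "ps = (SOME ps. sweedler \<A> \<A> c ps)"
  have "\<exists>ps. sweedler \<A> \<A> c ps" using OqSU3_coproduct[OF assms] by (auto simp: sweedler_iff)
  then have "sweedler \<A> \<A> c ps" unfolding ps_def by (rule someI_ex)
  then have ps: "coproduct_rep c ps" "set ps \<subseteq> \<A> \<times> \<A>" by (auto simp: sweedler_iff)
  have "(\<Sum>(c1, c2)\<leftarrow>ps. csc (Lambda_act q r c2 s) (\<omega> r \<star> c1)) = \<omega> r \<star> (Gvec q r s \<triangleright> c)" for r
  proof -
    have "(\<Sum>(c1, c2)\<leftarrow>ps. csc (Lambda_act q r c2 s) (\<omega> r \<star> c1))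
        = (\<Sum>(c1, c2)\<leftarrow>ps. \<omega> r \<star> csc (pair (Gvec q r s) c2) c1)"
      using ps(2) by (intro arg_cong[where f = sum_list] map_cong) (auto simp: Lambda_act_eq)
    then show ?thesis
      unfolding coproduct_rep_act[OF ps(1)] conv_sum_list_right by (simp only: case_prod_unfold)
  qed
  then show "rmult q \<omega> c s = right_mult \<omega> c s"
    by (simp only: rmult_def right_mult_def flip: ps_def)
qed

lemma right_mult_right_mult:
  assumes "a \<in> \<D>" "b \<in> \<D>" shows "right_mult (right_mult \<omega> a) b = right_mult \<omega> (a \<star> b)"
proof
  fix s
  have "right_mult (right_mult \<omega> a) b s =
      (\<Sum>t\<in>UNIV. \<Sum>r\<in>UNIV. \<omega> r \<star> ((Gvec q r t \<triangleright> a) \<star> (Gvec q t s \<triangleright> b)))"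
    by (simp only: right_mult_def conv_sum_left conv_assoc)
  also have "\<dots> = (\<Sum>r\<in>UNIV. \<Sum>t\<in>UNIV. \<omega> r \<star> ((Gvec q r t \<triangleright> a) \<star> (Gvec q t s \<triangleright> b)))"
    by (rule sum.swap)
  also have "\<dots> = right_mult \<omega> (a \<star> b) s"
    by (simp only: right_mult_def Gvec_conv[OF assms] conv_sum_right)
  finally show "right_mult (right_mult \<omega> a) b s = right_mult \<omega> (a \<star> b) s" .
qed

lemma right_mult_unit [simp]: "right_mult \<omega> unit = \<omega>"
proof
  fix s
  have "(\<Sum>r\<in>UNIV. \<omega> r \<star> (if r = s then unit else 0)) = (\<Sum>r\<in>UNIV. if r = s then \<omega> r else 0)"
    by (intro sum.cong) simp_all
  then show "right_mult \<omega> unit s = \<omega> s" by (simp only: right_mult_def Gvec_unit sum.delta finite if_True UNIV_I)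
qed

lemma right_mult_linear:
  "right_mult (\<omega> + \<eta>) c = right_mult \<omega> c + right_mult \<eta> c"
  "right_mult (\<lambda>r. csc k (\<omega> r)) c = (\<lambda>r. csc k (right_mult \<omega> c r))"
  "right_mult (- \<omega>) c = - right_mult \<omega> c"
  "right_mult 0 c = 0"
  "right_mult \<omega> (c + d) = right_mult \<omega> c + right_mult \<omega> d"
  "right_mult \<omega> (c - d) = right_mult \<omega> c - right_mult \<omega> d"
  "right_mult \<omega> (csc k c) = (\<lambda>r. csc k (right_mult \<omega> c r))"
  "right_mult \<omega> 0 = 0"
  by (simp_all add: fun_eq_iff right_mult_def conv_linear sum.distrib sum_subtractf sum_distrib_left sum_negf)

lemma right_mult_sum_list_right: "right_mult \<omega> (\<Sum>i\<leftarrow>is. f i) = (\<Sum>i\<leftarrow>is. right_mult \<omega> (f i))"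
  by (induction "is") (simp_all only: list.map sum_list.Nil sum_list.Cons right_mult_linear)

lemma right_mult_sum_list_left: "right_mult (\<Sum>i\<leftarrow>is. f i) c = (\<Sum>i\<leftarrow>is. right_mult (f i) c)"
  by (induction "is") (simp_all only: list.map sum_list.Nil sum_list.Cons right_mult_linear)

lemma lmult_linear:
  "lmult a (\<omega> + \<eta>) = lmult a \<omega> + lmult a \<eta>" "lmult (- a) \<omega> = - lmult a \<omega>"
  by (rule ext, simp only: lmult_def conv_linear conv_uminus_left plus_fun_apply uminus_apply)+

lemma lmult_sum_list_left: "lmult (\<Sum>i\<leftarrow>is. f i) \<omega> = (\<Sum>i\<leftarrow>is. lmult (f i) \<omega>)"
  by (rule ext) (simp only: lmult_def conv_sum_list_left sum_list_fun_apply)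

lemma lmult_lmult: "lmult a (lmult b \<omega>) = lmult (a \<star> b) \<omega>"
  by (simp add: lmult_def conv_assoc)

lemma lmult_unit [simp]: "lmult unit \<omega> = \<omega>"
  by (simp add: lmult_def)

lemma right_mult_lmult: "right_mult (lmult a \<omega>) c = lmult a (right_mult \<omega> c)"
  by (rule ext) (simp only: right_mult_def lmult_def conv_assoc conv_sum_right)

lemma diff_conv:
  assumes "a \<in> \<D>" "b \<in> \<D>" shows "diff q (a \<star> b) = right_mult (diff q a) b + lmult a (diff q b)"
  by (rule ext) (simp only: diff_def Xvec_conv[OF assms] right_mult_def lmult_def plus_fun_apply)

lemma diff_zero: "diff q 0 = 0"
  by (simp add: diff_def fun_eq_iff)

lemma diff_uminus: "diff q (- a) = - diff q a"
proof
  have "X \<triangleright> (- a) = - (X \<triangleright> a)" for X using act_minus[of X 0 a] by (simp only: act_linear diff_0)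
  then show "diff q (- a) r = (- diff q a) r" for r by (simp only: diff_def uminus_apply)
qed

lemma diff_sum_list: "diff q (\<Sum>i\<leftarrow>is. f i) = (\<Sum>i\<leftarrow>is. diff q (f i))"
  by (rule ext) (simp only: diff_def act_sum_list sum_list_fun_apply)

text \<open>The coefficients of \<open>\<Omega>\<^sup>1\<close> as an associated bundle \<open>A \<box> V\<^sup>1\<close>.\<close>

definition Forms1 :: "form1 set"
  where "Forms1 = {\<omega>. \<forall>r. \<omega> r \<in> weight_space (wt r)}"

lemma right_mult_weight_space:
  assumes "\<And>r. \<omega> r \<in> weight_space (wt r + \<mu>)" "c \<in> weight_space \<nu>"
  shows "right_mult \<omega> c s \<in> weight_space (wt s + (\<mu> + \<nu>))"
proof -
  have "\<omega> r \<star> (Gvec q r s \<triangleright> c) \<in> weight_space (wt s + (\<mu> + \<nu>))" for r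
    using weight_space_conv[OF assms(1)[of r] Gvec_weight_space[OF assms(2), of r s]] by (simp add: algebra_simps)
  then show ?thesis unfolding right_mult_def by (intro fn.subspace_sum subspace_weight_space)
qed

lemma Forms1_right_mult: "\<omega> \<in> Forms1 \<Longrightarrow> b \<in> \<B> \<Longrightarrow> right_mult \<omega> b \<in> Forms1"
  using right_mult_weight_space[of \<omega> 0 b 0] by (auto simp: Forms1_def OqF3_eq)

lemma Omega1_Forms1: "\<omega> \<in> Omega1 q \<Longrightarrow> \<omega> \<in> Forms1"
proof (induction rule: Omega1.induct)
  case (diff b)
  then show ?case using Xvec_OqF3 by (simp only: Forms1_def diff_def mem_Collect_eq simp_thms)
next
  case (add \<omega> \<eta>)
  then have "\<omega> r + \<eta> r \<in> weight_space (wt r)" for r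
    using subspace_weight_space fn.subspace_add by (auto simp: Forms1_def)
  then show ?case unfolding Forms1_def plus_fun_def[of \<omega> \<eta>] by blast
next
  case (left b \<omega>)
  then have "b \<star> \<omega> r \<in> weight_space (0 + wt r)" for r
    by (intro weight_space_conv) (auto simp: OqF3_eq Forms1_def)
  then show ?case by (simp only: Forms1_def mem_Collect_eq lmult_def add_0_left simp_thms)
next
  case (right b \<omega>)
  then have "right_mult \<omega> b \<in> Forms1" by (intro Forms1_right_mult)
  then show ?case using right rmult_eq_right_mult[OF OqF3_OqSU3] by metis
qed

text \<open>\<open>a \<otimes> [b] = \<Sum> a S(b\<^sub>(\<^sub>1\<^sub>)) d b\<^sub>(\<^sub>2\<^sub>)\<close>.\<close>

lemma sum_conv_antip_act:
  assumes "b \<in> \<D>" "coproduct_rep b ps"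
  shows "(\<Sum>(x, y)\<leftarrow>ps. a \<star> antip x \<star> (X \<triangleright> y)) = csc (pair X b) a"
proof -
  have "(\<Sum>(x, y)\<leftarrow>ps. a \<star> antip x \<star> (X \<triangleright> y)) = a \<star> (\<Sum>(x, y)\<leftarrow>map (\<lambda>(x, y). (x, X \<triangleright> y)) ps. antip x \<star> y)"
    unfolding conv_sum_list_right by (simp only: case_prod_unfold conv_assoc map_map comp_def fst_conv snd_conv)
  also have "\<dots> = a \<star> csc ((X \<triangleright> b) 0) unit"
    using antip_conv_coproduct[OF act_Uq_dual[OF assms(1)] coproduct_rep_act_right[OF assms(2)]] by simp
  finally show ?thesis by (simp add: act_apply_0)
qed

definition dual_coproduct :: "rvec \<Rightarrow> (fnl \<times> fnl) list"
  where "dual_coproduct r = (SOME ps. coproduct_rep (dual_element r) ps \<and> set ps \<subseteq> bihom_pairs (wt r) 0)"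

lemma dual_coproduct:
  "coproduct_rep (dual_element r) (dual_coproduct r)"
  "set (dual_coproduct r) \<subseteq> bihom_pairs (wt r) 0"
  using someI_ex[OF bihom_coproduct[OF dual_element(1)], of r] by (simp_all add: dual_coproduct_def)

lemma dual_coproduct_mem:
  assumes "(x, y) \<in> set (dual_coproduct r)"
  shows "x \<in> \<A>" "antip x \<in> weight_space (- wt r)" "y \<in> \<B>"
proof -
  from assms obtain \<kappa> where "bihom (wt r) \<kappa> x" "bihom \<kappa> 0 y"
    using dual_coproduct(2) by (auto simp: bihom_pairs_def)
  then show "x \<in> \<A>" "antip x \<in> weight_space (- wt r)" "y \<in> \<B>"
    using bihom_OqSU3 bihom_weight_space bihom_antip OqF3_eq by blast+
qed

lemma dual_coproduct_antipode:
  "(\<Sum>(x, y)\<leftarrow>dual_coproduct r. a \<star> antip x \<star> (Xvec q s \<triangleright> y)) = (if r = s then a else 0)"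
proof -
  have "pair (Xvec q s) (dual_element r) = of_bool (s = r)"
    using fun_cong[OF cot_dual_element[of r], of s] by (simp add: cot_def unitvec_def)
  then show ?thesis
    using sum_conv_antip_act[OF bihom_Uq_dual[OF dual_element(1)] dual_coproduct(1), of a "Xvec q s"] by auto
qed

lemma Omega1_zero: "0 \<in> Omega1 q"
  using Omega1.diff[OF fn.subspace_0[OF subspace_OqF3]] by (simp only: diff_zero)

lemma form1_expansion:
  "\<omega> = (\<Sum>r\<leftarrow>all_rvecs. \<Sum>(x, y)\<leftarrow>dual_coproduct r. lmult (\<omega> r \<star> antip x) (diff q y))"
proof
  fix s
  have "(\<Sum>r\<leftarrow>all_rvecs. \<Sum>(x, y)\<leftarrow>dual_coproduct r. lmult (\<omega> r \<star> antip x) (diff q y)) s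
      = (\<Sum>r\<leftarrow>all_rvecs. \<Sum>(x, y)\<leftarrow>dual_coproduct r. \<omega> r \<star> antip x \<star> (Xvec q s \<triangleright> y))"
    by (simp only: sum_list_fun_apply lmult_def diff_def case_prod_unfold)
  also have "\<dots> = (\<Sum>r\<in>UNIV. if r = s then \<omega> r else 0)"
    unfolding dual_coproduct_antipode sum_all_rvecs ..
  also have "\<dots> = \<omega> s" by (simp only: sum.delta finite if_True UNIV_I)
  finally show "\<omega> s = (\<Sum>r\<leftarrow>all_rvecs. \<Sum>(x, y)\<leftarrow>dual_coproduct r. lmult (\<omega> r \<star> antip x) (diff q y)) s" ..
qed

lemma weight_space_antip_OqF3:
  assumes "a \<in> weight_space (wt r)" "(x, y) \<in> set (dual_coproduct r)" shows "a \<star> antip x \<in> \<B>"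
  using weight_space_conv[OF assms(1) dual_coproduct_mem(2)[OF assms(2)]] by (simp add: OqF3_eq)

lemma Omega1_eq: "Omega1 q = Forms1"
proof
  show "Omega1 q \<subseteq> Forms1" using Omega1_Forms1 by blast
  show "Forms1 \<subseteq> Omega1 q"
  proof
    fix \<omega> assume \<omega>: "\<omega> \<in> Forms1"
    have summand: "lmult (\<omega> r \<star> antip x) (diff q y) \<in> Omega1 q" if "(x, y) \<in> set (dual_coproduct r)" for r x y
    proof -
      have "\<omega> r \<star> antip x \<in> \<B>" using \<omega> that by (intro weight_space_antip_OqF3) (auto simp: Forms1_def)
      then show ?thesis using dual_coproduct_mem(3)[OF that] by (intro Omega1.left Omega1.diff)
    qed
    have "(\<Sum>r\<leftarrow>all_rvecs. \<Sum>(x, y)\<leftarrow>dual_coproduct r. lmult (\<omega> r \<star> antip x) (diff q y)) \<in> Omega1 q"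
      using summand by (intro sum_list_mem[OF Omega1_zero Omega1.add]) auto
    then show "\<omega> \<in> Omega1 q" by (simp only: form1_expansion[of \<omega>, symmetric])
  qed
qed

lemma Forms1_zero: "0 \<in> Forms1"
  and Forms1_add: "\<omega> \<in> Forms1 \<Longrightarrow> \<eta> \<in> Forms1 \<Longrightarrow> \<omega> + \<eta> \<in> Forms1"
  and Forms1_diff: "b \<in> \<B> \<Longrightarrow> diff q b \<in> Forms1"
  and Forms1_lmult: "b \<in> \<B> \<Longrightarrow> \<omega> \<in> Forms1 \<Longrightarrow> lmult b \<omega> \<in> Forms1"
  unfolding Omega1_eq[symmetric] by (auto intro: Omega1_zero Omega1.add Omega1.diff Omega1.left)

lemma Forms1_Uq_dual: "\<omega> \<in> Forms1 \<Longrightarrow> \<omega> r \<in> \<D>"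
  using weight_space_OqSU3 OqSU3_Uq_dual unfolding Forms1_def by blast

end

section \<open>Ideals of free algebras\<close>

lemma cls_eq_iff_diff:
  assumes "\<And>x y. x \<in> Z \<Longrightarrow> y \<in> Z \<Longrightarrow> x + y \<in> Z" "\<And>x. x \<in> Z \<Longrightarrow> - x \<in> Z" "0 \<in> Z"
  shows "cls Z x = cls Z y \<longleftrightarrow> x - y \<in> Z"
proof
  assume "cls Z x = cls Z y"
  moreover have "x \<in> cls Z x" using assms by (simp add: cls_def)
  ultimately show "x - y \<in> Z" by (simp add: cls_def)
next
  assume xy: "x - y \<in> Z"
  have "z - x \<in> Z \<longleftrightarrow> z - y \<in> Z" for z
    using assms(1)[of "z - x" "x - y"] assms(1)[of "z - y" "- (x - y)"] assms(2)[OF xy] xy by auto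
  then show "cls Z x = cls Z y" by (simp add: cls_def)
qed

locale word_ideal =
  fixes M :: "'m set" and S :: "'m free_alg set"
begin

abbreviation J :: "'m free_alg set" where "J \<equiv> ideal_gen M S"

lemma subspace_J: "flin.subspace J"
  by (simp add: ideal_gen_def)

lemmas J_zero = flin.subspace_0[OF subspace_J]
lemmas J_add = flin.subspace_add[OF subspace_J]
lemmas J_minus = flin.subspace_diff[OF subspace_J]
lemmas J_scale = flin.subspace_scale[OF subspace_J]
lemmas J_uminus = flin.subspace_neg[OF subspace_J]

lemma J_base: "s \<in> S \<Longrightarrow> s \<in> J"
  using ideal_gen_base[of s S 0 M 0] by simp

lemma J_lett_left:
  assumes "x \<in> J" "a \<in> M" shows "lett a * x \<in> J"
proof -
  have "J \<subseteq> {x. lett a * x \<in> J}"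
  proof (rule ideal_gen_minimal)
    show "flin.subspace {x. lett a * x \<in> J}"
      by (auto simp: flin.subspace_def J_zero distrib_left J_add fscale_mult_right J_scale)
    fix u s v assume "set (letters u) \<subseteq> M" "s \<in> S" "set (letters v) \<subseteq> M"
    then have "mon (Word [a] + u) * s * mon v \<in> J" using assms(2) by (intro ideal_gen_base) auto
    then show "mon u * s * mon v \<in> {x. lett a * x \<in> J}" by (simp add: mon_plus lett_def mult.assoc)
  qed
  then show ?thesis using assms(1) by blast
qed

lemma J_lett_right:
  assumes "x \<in> J" "a \<in> M" shows "x * lett a \<in> J"
proof -
  have "J \<subseteq> {x. x * lett a \<in> J}"
  proof (rule ideal_gen_minimal)
    show "flin.subspace {x. x * lett a \<in> J}"
      by (auto simp: flin.subspace_def J_zero distrib_right J_add fscale_mult_left J_scale)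
    fix u s v assume "set (letters u) \<subseteq> M" "s \<in> S" "set (letters v) \<subseteq> M"
    then have "mon u * s * mon (v + Word [a]) \<in> J" using assms(2) by (intro ideal_gen_base) auto
    then show "mon u * s * mon v \<in> {x. x * lett a \<in> J}" by (simp add: mon_plus lett_def mult.assoc)
  qed
  then show ?thesis using assms(1) by blast
qed

definition cong :: "'m free_alg \<Rightarrow> 'm free_alg \<Rightarrow> bool"  (infix \<open>\<approx>\<close> 50)
  where "x \<approx> y \<longleftrightarrow> x - y \<in> J"

lemma cong_refl [simp]: "x \<approx> x"
  by (simp add: cong_def J_zero)

lemma cong_sym: "x \<approx> y \<Longrightarrow> y \<approx> x"
  using J_uminus[of "x - y"] by (simp add: cong_def)

lemma cong_trans [trans]: "x \<approx> y \<Longrightarrow> y \<approx> z \<Longrightarrow> x \<approx> z"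
  using J_add[of "x - y" "y - z"] by (simp add: cong_def)

lemma cong_add: "x \<approx> y \<Longrightarrow> x' \<approx> y' \<Longrightarrow> x + x' \<approx> y + y'"
  using J_add[of "x - y" "x' - y'"] by (simp add: cong_def algebra_simps)

lemma cong_scale: "x \<approx> y \<Longrightarrow> fscale c x \<approx> fscale c y"
  using J_scale[of "x - y" c] by (simp add: cong_def flin.scale_right_diff_distrib)

lemma cong_sum_list: "(\<And>i. i \<in> set is \<Longrightarrow> f i \<approx> g i) \<Longrightarrow> (\<Sum>i\<leftarrow>is. f i) \<approx> (\<Sum>i\<leftarrow>is. g i)"
  by (induction "is") (auto intro: cong_add)

lemma cong_lett_left: "x \<approx> y \<Longrightarrow> a \<in> M \<Longrightarrow> lett a * x \<approx> lett a * y"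
  using J_lett_left[of "x - y" a] by (simp add: cong_def right_diff_distrib)

lemma cong_lett_right: "x \<approx> y \<Longrightarrow> a \<in> M \<Longrightarrow> x * lett a \<approx> y * lett a"
  using J_lett_right[of "x - y" a] by (simp add: cong_def left_diff_distrib)

lemma cong_mem: "x \<approx> y \<Longrightarrow> x \<in> J \<longleftrightarrow> y \<in> J"
  using J_add[of "x - y" y] J_minus[of x "x - y"] by (auto simp: cong_def)

lemma cls_eq_iff: "cls J x = cls J y \<longleftrightarrow> x \<approx> y"
  unfolding cong_def by (intro cls_eq_iff_diff J_add J_uminus J_zero)

lemma qspan_cls_image: "qspan J (cls J ` B) = cls J ` flin.span B"
proof -
  let ?T = "{x. cls J x \<in> cls J ` B}" and ?U = "{x. \<exists>y\<in>flin.span B. x \<approx> y}"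
  have "flin.span ?T \<subseteq> ?U"
  proof (rule flin.span_minimal)
    show "?T \<subseteq> ?U" by (auto simp: cls_eq_iff intro: flin.span_base)
    show "flin.subspace ?U"
      unfolding flin.subspace_def
      by (auto intro: cong_add cong_scale flin.span_zero flin.span_add flin.span_scale cong_refl)
  qed
  moreover have "flin.span B \<subseteq> flin.span ?T" by (intro flin.span_mono) auto
  ultimately show ?thesis unfolding qspan_def by (fastforce simp: cls_eq_iff)
qed

lemma qdimI:
  assumes "finite A" and Q: "Q = qspan J (cls J ` b ` A)"
    and independent: "\<And>c i. (\<Sum>i\<in>A. fscale (c i) (b i)) \<in> J \<Longrightarrow> i \<in> A \<Longrightarrow> c i = 0"
  shows "qdim J Q (card A)"
proof -
  obtain h where h: "bij_betw h {..<card A} A"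
    using ex_bij_betw_nat_finite[OF \<open>finite A\<close>] by (auto simp: atLeast0LessThan)
  have "(\<lambda>n. cls J (b (h n))) ` {..<card A} = cls J ` b ` h ` {..<card A}"
    by (simp add: image_image)
  also have "\<dots> = cls J ` b ` A" using h by (simp add: bij_betw_imp_surj_on)
  finally have "Q = qspan J ((\<lambda>n. cls J (b (h n))) ` {..<card A})" using Q by simp
  moreover have "c n = 0" if c: "cls J (\<Sum>n<card A. fscale (c n) (b (h n))) = cls J 0" and n: "n < card A" for c n
  proof -
    let ?h' = "inv_into {..<card A} h"
    have inverse: "?h' (h m) = m" if "m < card A" for m
      using h that by (simp add: bij_betw_inv_into_left)
    have "(\<Sum>i\<in>A. fscale (c (?h' i)) (b i)) = (\<Sum>m<card A. fscale (c (?h' (h m))) (b (h m)))"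
      by (rule sum.reindex_bij_betw[OF h, symmetric])
    also have "\<dots> = (\<Sum>m<card A. fscale (c m) (b (h m)))" by (intro sum.cong) (simp_all add: inverse)
    finally have "(\<Sum>i\<in>A. fscale (c (?h' i)) (b i)) \<in> J"
      using c by (simp add: cls_eq_iff cong_def)
    then have "c (?h' (h n)) = 0"
      using independent[of "\<lambda>i. c (?h' i)" "h n"] bij_betwE[OF h] n by simp
    then show ?thesis using n by (simp add: inverse)
  qed
  ultimately show ?thesis unfolding qdim_def by (intro exI[of _ "\<lambda>n. b (h n)"]) blast
qed

end

text \<open>Quotients of tensor algebras: \<open>sc\<close> is the scaling of the vector space \<open>M\<close> of letters.\<close>

locale tensor_ideal = word_ideal M S for M :: "'m::ab_group_add set" and S +
  fixes sc :: "complex \<Rightarrow> 'm \<Rightarrow> 'm"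
  assumes lin_rels: "lin_rels sc M \<subseteq> S"
    and M_zero: "0 \<in> M" and M_add: "x \<in> M \<Longrightarrow> y \<in> M \<Longrightarrow> x + y \<in> M"
begin

lemma cong_lett_add: "x \<in> M \<Longrightarrow> y \<in> M \<Longrightarrow> lett (x + y) \<approx> lett x + lett y"
  using J_base[of "lett (x + y) - lett x - lett y"] lin_rels
  by (auto simp: lin_rels_def cong_def diff_diff_eq)

lemma cong_lett_scale: "x \<in> M \<Longrightarrow> lett (sc c x) \<approx> fscale c (lett x)"
  using J_base[of "lett (sc c x) - fscale c (lett x)"] lin_rels
  by (auto simp: lin_rels_def cong_def)

lemma cong_lett_zero: "lett 0 \<approx> 0"
  using cong_lett_add[OF M_zero M_zero] J_uminus by (fastforce simp: cong_def)

lemma cong_lett_sum_list: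
  assumes "\<And>i. i \<in> set is \<Longrightarrow> f i \<in> M"
  shows "lett (\<Sum>i\<leftarrow>is. f i) \<approx> (\<Sum>i\<leftarrow>is. lett (f i))"
  using assms
proof (induction "is")
  case Nil
  show ?case using cong_lett_zero by simp
next
  case (Cons i "is")
  have "(\<Sum>i\<leftarrow>is. f i) \<in> M" using Cons.prems by (intro sum_list_mem M_zero M_add) auto
  then have "lett (f i + (\<Sum>i\<leftarrow>is. f i)) \<approx> lett (f i) + lett (\<Sum>i\<leftarrow>is. f i)"
    using Cons.prems by (intro cong_lett_add) auto
  also have "\<dots> \<approx> lett (f i) + (\<Sum>i\<leftarrow>is. lett (f i))"
    using Cons by (intro cong_add cong_refl) auto
  finally show ?case by simp
qed

end

section \<open>Elements of degree two\<close>

lemma subspace_words_deg: "flin.subspace (words_deg M k)"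
  unfolding flin.subspace_def
proof (intro conjI ballI allI)
  show "0 \<in> words_deg M k" by (simp add: words_deg_def words_on_def)
  show "x + y \<in> words_deg M k" if "x \<in> words_deg M k" "y \<in> words_deg M k" for x y
    using that keys_add[of x y] unfolding words_deg_def words_on_def by simp blast
  show "fscale c x \<in> words_deg M k" if "x \<in> words_deg M k" for c x
    using that by (auto simp: words_deg_def words_on_def in_keys_iff)
qed

lemma words_deg_2_lett: "a \<in> M \<Longrightarrow> b \<in> M \<Longrightarrow> lett a * lett b \<in> words_deg M 2"
  by (simp add: lett_mult mon_def words_deg_def words_on_def)

lemma words_deg_2_keysE:
  assumes "x \<in> words_deg M 2" "w \<in> Poly_Mapping.keys x"
  obtains a b where "w = Word [a, b]" "a \<in> M" "b \<in> M"
proof -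
  have "length (letters w) = 2" "set (letters w) \<subseteq> M" using assms by (auto simp: words_deg_def words_on_def)
  then show ?thesis using that by (cases w) (auto simp: numeral_2_eq_2 length_Suc_conv)
qed

lemma words_deg_2_induct [consumes 1, case_names zero add]:
  assumes "x \<in> words_deg M 2" "P 0"
    and step: "\<And>c a b y. a \<in> M \<Longrightarrow> b \<in> M \<Longrightarrow> y \<in> words_deg M 2 \<Longrightarrow> P y \<Longrightarrow> P (fscale c (lett a * lett b) + y)"
  shows "P x"
proof -
  have "P (\<Sum>w\<in>K. fscale (Poly_Mapping.lookup x w) (mon w)) \<and>
      (\<Sum>w\<in>K. fscale (Poly_Mapping.lookup x w) (mon w)) \<in> words_deg M 2"
    if "finite K" "K \<subseteq> Poly_Mapping.keys x" for K
    using that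
  proof (induction K rule: finite_induct)
    case empty
    show ?case using assms(2) flin.subspace_0[OF subspace_words_deg] by simp
  next
    case (insert w K)
    then obtain a b where "w = Word [a, b]" "a \<in> M" "b \<in> M"
      using words_deg_2_keysE[OF assms(1), of w] by blast
    then show ?case
      using insert step[of a b] words_deg_2_lett[of a M b]
      by (auto simp: lett_mult flin.subspace_add flin.subspace_scale subspace_words_deg)
  qed
  from this[of "Poly_Mapping.keys x"] show ?thesis using free_alg_decomp[of x] by simp
qed

definition on_pairs :: "('m \<Rightarrow> 'm \<Rightarrow> complex) \<Rightarrow> 'm word \<Rightarrow> complex"
  where "on_pairs \<beta> w = (case letters w of [a, b] \<Rightarrow> \<beta> a b | _ \<Rightarrow> 0)"

definition bilin_ext :: "('m \<Rightarrow> 'm \<Rightarrow> complex) \<Rightarrow> 'm free_alg \<Rightarrow> complex"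
  where "bilin_ext \<beta> x = lin_ext (on_pairs \<beta>) x"

lemma on_pairs_Word [simp]: "on_pairs \<beta> (Word [a, b]) = \<beta> a b"
  by (simp add: on_pairs_def)

lemma on_pairs_length: "length (letters w) \<noteq> 2 \<Longrightarrow> on_pairs \<beta> w = 0"
  by (auto simp: on_pairs_def split: list.splits)

lemma bilin_ext_linear [simp]:
  "bilin_ext \<beta> (x + y) = bilin_ext \<beta> x + bilin_ext \<beta> y" "bilin_ext \<beta> (x - y) = bilin_ext \<beta> x - bilin_ext \<beta> y"
  "bilin_ext \<beta> (fscale c x) = c * bilin_ext \<beta> x" "bilin_ext \<beta> 0 = 0"
  by (simp_all add: bilin_ext_def)

lemma bilin_ext_sum_list: "bilin_ext \<beta> (\<Sum>i\<leftarrow>is. f i) = (\<Sum>i\<leftarrow>is. bilin_ext \<beta> (f i))"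
  by (simp add: bilin_ext_def lin_ext_sum_list)

lemma bilin_ext_sum: "bilin_ext \<beta> (\<Sum>i\<in>A. f i) = (\<Sum>i\<in>A. bilin_ext \<beta> (f i))"
  by (simp add: bilin_ext_def)

lemma bilin_ext_lett [simp]: "bilin_ext \<beta> (lett a * lett b) = \<beta> a b"
  by (simp add: bilin_ext_def lett_mult)

lemma bilin_ext_context: "bilin_ext \<beta> (mon u * x * mon v) = lin_ext (\<lambda>k. on_pairs \<beta> (u + k + v)) x"
  by (simp add: bilin_ext_def lin_ext_mult add.assoc)

lemma bilin_ext_context_words_deg_2:
  assumes "x \<in> words_deg M 2" "u \<noteq> 0 \<or> v \<noteq> 0"
  shows "bilin_ext \<beta> (mon u * x * mon v) = 0"
proof -
  have "on_pairs \<beta> (u + k + v) = 0" if k: "k \<in> Poly_Mapping.keys x" for k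
  proof (rule on_pairs_length)
    have "length (letters k) = 2" using assms(1) k by (simp add: words_deg_def)
    moreover have "letters u \<noteq> [] \<or> letters v \<noteq> []" using assms(2) by (metis word.collapse Word_Nil)
    ultimately show "length (letters (u + k + v)) \<noteq> 2" by auto
  qed
  then show ?thesis by (simp add: bilin_ext_context lin_ext_def)
qed

definition bilinear_form :: "(complex \<Rightarrow> 'm \<Rightarrow> 'm::plus) \<Rightarrow> ('m \<Rightarrow> 'm \<Rightarrow> complex) \<Rightarrow> bool"
  where "bilinear_form sc \<beta> \<longleftrightarrow>
    (\<forall>a a' b. \<beta> (a + a') b = \<beta> a b + \<beta> a' b \<and> \<beta> b (a + a') = \<beta> b a + \<beta> b a') \<and>
    (\<forall>c a b. \<beta> (sc c a) b = c * \<beta> a b \<and> \<beta> a (sc c b) = c * \<beta> a b)"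

lemma bilin_ext_context_lin_rels:
  assumes "bilinear_form sc \<beta>" "r \<in> lin_rels sc M"
  shows "bilin_ext \<beta> (mon u * r * mon v) = 0"
proof -
  obtain us vs where uv: "u = Word us" "v = Word vs" by (cases u; cases v)
  consider (right) b where "us = []" "vs = [b]" | (left) a where "us = [a]" "vs = []"
    | (other) "length us + length vs \<noteq> 1"
    by (cases us; cases vs) auto
  then show ?thesis
  proof cases
    case right
    then show ?thesis
      using assms by (auto simp: uv bilin_ext_context lin_rels_def bilinear_form_def)
  next
    case left
    then show ?thesis
      using assms by (auto simp: uv bilin_ext_context lin_rels_def bilinear_form_def)
  next
    case other
    then have "on_pairs \<beta> (u + Word [m] + v) = 0" for m by (intro on_pairs_length) (simp add: uv)
    then show ?thesis using assms(2) by (auto simp: bilin_ext_context lin_rels_def)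
  qed
qed

section \<open>Coactions\<close>

definition eval_otimes :: "gen word \<Rightarrow> ('m word \<Rightarrow> complex) \<Rightarrow> ('m word \<Rightarrow>\<^sub>0 fnl) \<Rightarrow> complex"
  where "eval_otimes X L T = (\<Sum>w\<in>Poly_Mapping.keys T. Poly_Mapping.lookup T w X * L w)"

lemma eval_otimes_superset:
  assumes "finite S" "Poly_Mapping.keys T \<subseteq> S"
  shows "eval_otimes X L T = (\<Sum>w\<in>S. Poly_Mapping.lookup T w X * L w)"
  unfolding eval_otimes_def using assms
  by (intro sum.mono_neutral_left) (auto simp: in_keys_iff)

lemma eval_otimes_zero [simp]: "eval_otimes X L 0 = 0"
  by (simp add: eval_otimes_def)

lemma eval_otimes_add: "eval_otimes X L (s + t) = eval_otimes X L s + eval_otimes X L t"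
proof -
  let ?S = "Poly_Mapping.keys s \<union> Poly_Mapping.keys t"
  have "eval_otimes X L z = (\<Sum>k\<in>?S. Poly_Mapping.lookup z k X * L k)" if "z \<in> {s, t, s + t}" for z
    using that keys_add[of s t] by (intro eval_otimes_superset) auto
  then show ?thesis
    by (simp add: lookup_add algebra_simps sum.distrib)
qed

lemma eval_otimes_minus: "eval_otimes X L (s - t) = eval_otimes X L s - eval_otimes X L t"
  using eval_otimes_add[of X L "s - t" t] by simp

lemma eval_otimes_sum: "eval_otimes X L (\<Sum>i\<in>A. f i) = (\<Sum>i\<in>A. eval_otimes X L (f i))"
  by (induction A rule: infinite_finite_induct) (simp_all add: eval_otimes_add)

lemma eval_otimes_sum_list: "eval_otimes X L (\<Sum>i\<leftarrow>is. f i) = (\<Sum>i\<leftarrow>is. eval_otimes X L (f i))"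
  by (induction "is") (simp_all add: eval_otimes_add)

lemma eval_otimes_single: "eval_otimes X L (Poly_Mapping.single w a) = a X * L w"
  by (cases "a = 0") (simp_all add: eval_otimes_def)

lemma lookup_otimes: "Poly_Mapping.lookup (otimes a x) w = csc (Poly_Mapping.lookup x w) a"
  unfolding otimes_def by (simp add: map.rep_eq when_def)

lemma eval_otimes_otimes: "eval_otimes X L (otimes a x) = a X * lin_ext L x"
proof -
  have "eval_otimes X L (otimes a x) = (\<Sum>w\<in>Poly_Mapping.keys x. Poly_Mapping.lookup (otimes a x) w X * L w)"
    by (intro eval_otimes_superset) (auto simp: in_keys_iff lookup_otimes)
  then show ?thesis by (simp add: lookup_otimes lin_ext_def sum_distrib_left mult_ac)
qed

lemma otimes_linear:
  "otimes (a + b) x = otimes a x + otimes b x" "otimes a (x + y) = otimes a x + otimes a y"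
  "otimes (csc c a) x = otimes a (fscale c x)" "otimes 0 x = 0" "otimes a 0 = 0"
  "otimes a (x - y) = otimes a x - otimes a y" "otimes (a - b) x = otimes a x - otimes b x"
  "otimes (- a) x = - otimes a x" "otimes a (- x) = - otimes a x"
  by (rule poly_mapping_eqI, simp add: lookup_otimes lookup_add lookup_minus fun_eq_iff algebra_simps)+

lemma otimes_sum_left: "otimes (\<Sum>i\<in>A. f i) x = (\<Sum>i\<in>A. otimes (f i) x)"
  by (induction A rule: infinite_finite_induct)
    (simp_all only: sum.infinite sum.empty sum.insert not_False_eq_True otimes_linear)

lemma otimes_sum_right: "otimes a (\<Sum>i\<in>A. f i) = (\<Sum>i\<in>A. otimes a (f i))"
  by (induction A rule: infinite_finite_induct)
    (simp_all only: sum.infinite sum.empty sum.insert not_False_eq_True otimes_linear)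

lemma single_otimes: "Poly_Mapping.single w (csc c a) = otimes a (fscale c (mon w))"
  by (rule poly_mapping_eqI) (simp add: lookup_otimes mon_def lookup_single when_def)

lemma eval_otimes_coact:
  "eval_otimes X L (coact \<delta> x) = lin_ext (\<lambda>w. \<Sum>(a, ms)\<leftarrow>coact_list \<delta> (letters w). a X * L (Word ms)) x"
  by (simp add: coact_def eval_otimes_sum eval_otimes_sum_list eval_otimes_single case_prod_unfold lin_ext_def
      mult.assoc flip: sum_list_const_mult)

lemma coact_superset:
  assumes "finite S" "Poly_Mapping.keys x \<subseteq> S"
  shows "coact \<delta> x = (\<Sum>w\<in>S. \<Sum>(a, ms)\<leftarrow>coact_list \<delta> (letters w).
    otimes a (fscale (Poly_Mapping.lookup x w) (mon (Word ms))))"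
  unfolding coact_def single_otimes using assms
  by (intro sum.mono_neutral_left) (auto simp: in_keys_iff case_prod_unfold otimes_linear(5) sum_list_0)

lemma coact_add: "coact \<delta> (x + y) = coact \<delta> x + coact \<delta> y"
proof -
  let ?S = "Poly_Mapping.keys x \<union> Poly_Mapping.keys y"
  have "coact \<delta> z = (\<Sum>w\<in>?S. \<Sum>(a, ms)\<leftarrow>coact_list \<delta> (letters w).
      otimes a (fscale (Poly_Mapping.lookup z w) (mon (Word ms))))" if "z \<in> {x, y, x + y}" for z
    using that keys_add[of x y] by (intro coact_superset) auto
  then show ?thesis
    by (simp add: lookup_add case_prod_unfold flin.scale_left_distrib otimes_linear(2) sum_list_addf sum.distrib)
qed

lemma coact_zero [simp]: "coact \<delta> 0 = 0"
  by (simp add: coact_def)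

lemma coact_mon:
  "coact \<delta> (fscale c (mon w)) = (\<Sum>(a, ms)\<leftarrow>coact_list \<delta> (letters w). otimes a (fscale c (mon (Word ms))))"
proof -
  have "coact \<delta> (fscale c (mon w)) = (\<Sum>v\<in>{w}. \<Sum>(a, ms)\<leftarrow>coact_list \<delta> (letters v).
      otimes a (fscale (Poly_Mapping.lookup (fscale c (mon w)) v) (mon (Word ms))))"
    by (rule coact_superset) (simp_all add: fscale_mon)
  then show ?thesis by (simp add: mon_def)
qed

lemma coact_list_pair:
  "(\<Sum>(a, ms)\<leftarrow>coact_list \<delta> [m, n]. f a ms) = (\<Sum>(a, m')\<leftarrow>\<delta> m. \<Sum>(b, n')\<leftarrow>\<delta> n. f (a \<star> b) [m', n'])"
  for f :: "fnl \<Rightarrow> 'm list \<Rightarrow> 'b::comm_monoid_add"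
  by (simp add: sum_list_concat_map case_prod_unfold comp_def)

lemma otimes_set_zero: "0 \<in> otimes_set N P"
  unfolding otimes_set_def by (intro CollectI exI[of _ "[]"]) simp

lemma otimes_set_add:
  assumes "s \<in> otimes_set N P" "t \<in> otimes_set N P" shows "s + t \<in> otimes_set N P"
proof -
  from assms obtain ps qs where "s = (\<Sum>(a, x)\<leftarrow>ps. otimes a x)" "set ps \<subseteq> N \<times> P"
    "t = (\<Sum>(a, x)\<leftarrow>qs. otimes a x)" "set qs \<subseteq> N \<times> P"
    by (auto simp: otimes_set_def)
  then show ?thesis unfolding otimes_set_def by (intro CollectI exI[of _ "ps @ qs"]) auto
qed

lemma otimes_set_base: "a \<in> N \<Longrightarrow> x \<in> P \<Longrightarrow> otimes a x \<in> otimes_set N P"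
  unfolding otimes_set_def by (intro CollectI exI[of _ "[(a, x)]"]) auto

lemma otimes_set_sum: "(\<And>i. i \<in> A \<Longrightarrow> f i \<in> otimes_set N P) \<Longrightarrow> (\<Sum>i\<in>A. f i) \<in> otimes_set N P"
  by (induction A rule: infinite_finite_induct) (auto intro: otimes_set_zero otimes_set_add)

lemmas otimes_set_sum_list = sum_list_mem[OF otimes_set_zero otimes_set_add]

lemma otimes_set_uminus:
  assumes "\<And>x. x \<in> P \<Longrightarrow> - x \<in> P" "s \<in> otimes_set N P" shows "- s \<in> otimes_set N P"
proof -
  obtain ps where ps: "s = (\<Sum>(a, x)\<leftarrow>ps. otimes a x)" "set ps \<subseteq> N \<times> P" using assms(2) by (auto simp: otimes_set_def)
  have "- s = (\<Sum>p\<leftarrow>ps. otimes (fst p) (- snd p))"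
    unfolding ps(1) case_prod_unfold uminus_sum_list_map comp_def otimes_linear(9) ..
  also have "\<dots> \<in> otimes_set N P" using ps(2) assms(1) by (intro otimes_set_sum_list otimes_set_base) auto
  finally show ?thesis .
qed

lemma coact_words_deg_2:
  assumes "x \<in> words_deg M 2" "\<And>m. m \<in> M \<Longrightarrow> set (\<delta> m) \<subseteq> H \<times> M"
    and "\<And>a b. a \<in> H \<Longrightarrow> b \<in> H \<Longrightarrow> a \<star> b \<in> H"
  shows "coact \<delta> x \<in> otimes_set H (words_deg M 2)"
  using assms(1)
proof (induction rule: words_deg_2_induct)
  case zero
  show ?case by (simp add: otimes_set_zero)
next
  case (add c m n y)
  have "otimes (a \<star> b) (fscale c (lett m' * lett n')) \<in> otimes_set H (words_deg M 2)"
    if "(a, m') \<in> set (\<delta> m)" "(b, n') \<in> set (\<delta> n)" for a m' b n'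
    using that assms(2)[OF add(1)] assms(2)[OF add(2)]
    by (intro otimes_set_base assms(3) flin.subspace_scale[OF subspace_words_deg] words_deg_2_lett) auto
  then have "(\<Sum>(a, m')\<leftarrow>\<delta> m. \<Sum>(b, n')\<leftarrow>\<delta> n. otimes (a \<star> b) (fscale c (lett m' * lett n')))
      \<in> otimes_set H (words_deg M 2)"
    by (fastforce intro!: otimes_set_sum_list)
  then have "coact \<delta> (fscale c (lett m * lett n)) \<in> otimes_set H (words_deg M 2)"
    unfolding lett_mult coact_mon word.sel coact_list_pair .
  then show ?case using add.IH by (simp add: coact_add otimes_set_add)
qed

definition coinvariance_kernel :: "fnl set \<Rightarrow> fnl set \<Rightarrow> 'm set \<Rightarrow> 'm free_alg set \<Rightarrow> ('m word \<Rightarrow>\<^sub>0 fnl) set"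
  where "coinvariance_kernel H N M J = {s + t | s t. s \<in> otimes_set N (words_on M) \<and> t \<in> otimes_set H J}"

lemma coinvariance_kernelI:
  "s \<in> otimes_set N (words_on M) \<Longrightarrow> t \<in> otimes_set H J \<Longrightarrow> s + t \<in> coinvariance_kernel H N M J"
  by (auto simp: coinvariance_kernel_def)

lemma (in word_ideal) coinvariants_iff:
  "C \<in> coinvariants H N \<delta> M J k \<longleftrightarrow>
    (\<exists>x\<in>words_deg M k. C = cls J x \<and> coact \<delta> x - otimes unit x \<in> coinvariance_kernel H N M J)"
proof -
  let ?Z = "coinvariance_kernel H N M J"
  have "cls ?Z x = cls ?Z y \<longleftrightarrow> x - y \<in> ?Z" for x y
  proof (rule cls_eq_iff_diff)
    show "0 \<in> ?Z" using coinvariance_kernelI[OF otimes_set_zero otimes_set_zero] by (metis add_0_left)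
    fix z assume "z \<in> ?Z"
    then obtain s t where z: "z = s + t" "s \<in> otimes_set N (words_on M)" "t \<in> otimes_set H J"
      by (auto simp: coinvariance_kernel_def)
    have "- s \<in> otimes_set N (words_on M)" "- t \<in> otimes_set H J"
      using z J_uminus by (auto intro!: otimes_set_uminus simp: words_on_def)
    then show "- z \<in> ?Z" unfolding z(1) minus_add_distrib by (rule coinvariance_kernelI)
    fix z' assume "z' \<in> ?Z"
    then obtain s' t' where z': "z' = s' + t'" "s' \<in> otimes_set N (words_on M)" "t' \<in> otimes_set H J"
      by (auto simp: coinvariance_kernel_def)
    have "z + z' = (s + s') + (t + t')" by (simp add: z(1) z'(1) add_ac)
    also have "\<dots> \<in> ?Z" using z z' by (intro coinvariance_kernelI otimes_set_add)
    finally show "z + z' \<in> ?Z" .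
  qed
  then show ?thesis
    unfolding coinvariants_def Let_def coinvariance_kernel_def[symmetric] by auto
qed

text \<open>The first factors of \<open>T\<close> are expanded in a basis of their span.\<close>

lemma otimes_set_kernel:
  assumes P: "flin.subspace P" and T: "T \<in> otimes_set H P"
    and zero: "\<And>X i. eval_otimes X (L i) T = 0"
    and J: "\<And>x. x \<in> P \<Longrightarrow> (\<And>i. lin_ext (L i) x = 0) \<Longrightarrow> x \<in> J"
  shows "T \<in> otimes_set H J"
proof -
  obtain ps where ps: "T = (\<Sum>(a, x)\<leftarrow>ps. otimes a x)" "set ps \<subseteq> H \<times> P"
    using T by (auto simp: otimes_set_def)
  let ?I = "{..<length ps}"
  define a where "a n = fst (ps ! n)" for n
  define x where "x n = snd (ps ! n)" for n
  have mem: "a n \<in> H" "x n \<in> P" if "n \<in> ?I" for n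
  proof -
    have "ps ! n \<in> H \<times> P" using that ps(2) nth_mem by blast
    then show "a n \<in> H" "x n \<in> P" by (simp_all add: a_def x_def mem_Times_iff)
  qed
  have T_eq: "T = (\<Sum>n\<in>?I. otimes (a n) (x n))"
    unfolding ps(1) sum_list_sum_nth by (simp add: atLeast0LessThan case_prod_unfold a_def x_def)
  obtain B where B: "B \<subseteq> a ` ?I" "fn.independent B" "a ` ?I \<subseteq> fn.span B"
    using fn.maximal_independent_subset by blast
  then have finite: "finite B" using finite_subset by blast
  define y where "y b = (\<Sum>n\<in>?I. fscale (fn.representation B (a n) b) (x n))" for b
  have "otimes (a n) (x n) = (\<Sum>b\<in>B. otimes b (fscale (fn.representation B (a n) b) (x n)))" if "n \<in> ?I" for n
  proof -
    have "a n = (\<Sum>b\<in>B. csc (fn.representation B (a n) b) b)"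
      using B that finite by (intro fn.sum_representation_eq[symmetric]) auto
    from arg_cong[OF this, of "\<lambda>a. otimes a (x n)"] show ?thesis
      by (simp only: otimes_sum_left otimes_linear(3))
  qed
  then have T_basis: "T = (\<Sum>b\<in>B. otimes b (y b))"
    unfolding T_eq y_def otimes_sum_right by (simp add: sum.swap[of _ B])
  have "y b \<in> J" if b: "b \<in> B" for b
  proof (rule J)
    show "y b \<in> P" using mem(2) unfolding y_def by (intro flin.subspace_sum flin.subspace_scale P)
    fix i
    have "(\<Sum>b\<in>B. csc (lin_ext (L i) (y b)) b) X = eval_otimes X (L i) T" for X
      unfolding T_basis eval_otimes_sum eval_otimes_otimes by (simp add: mult.commute)
    then have "(\<Sum>b\<in>B. csc (lin_ext (L i) (y b)) b) = 0" using zero by (simp add: fun_eq_iff)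
    then show "lin_ext (L i) (y b) = 0"
      using fn.independentD[OF B(2) finite subset_refl, of "\<lambda>b. lin_ext (L i) (y b)"] b by blast
  qed
  then show ?thesis using B(1) mem(1) unfolding T_basis by (intro otimes_set_sum otimes_set_base) auto
qed

section \<open>Matrices\<close>

definition mscale :: "complex \<Rightarrow> ('i \<Rightarrow> 'j \<Rightarrow> complex) \<Rightarrow> 'i \<Rightarrow> 'j \<Rightarrow> complex"
  where "mscale c m = (\<lambda>t s. c * m t s)"

lemma mscale_apply [simp]: "mscale c m t s = c * m t s"
  by (simp add: mscale_def)

global_interpretation mat: vector_space mscale
  by standard (simp_all add: fun_eq_iff algebra_simps)

lemma (in module) span_rangeE:
  fixes b :: "'i::finite \<Rightarrow> 'b"
  assumes "x \<in> span (range b)"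
  obtains c where "x = (\<Sum>i\<in>UNIV. c i *s b i)"
proof -
  from assms have "\<exists>c. x = (\<Sum>i\<in>UNIV. c i *s b i)"
  proof (induction rule: span_induct_alt)
    case base
    show ?case by (intro exI[of _ "\<lambda>_. 0"]) simp
  next
    case (step k x y)
    then obtain j c where "x = b j" "y = (\<Sum>i\<in>UNIV. c i *s b i)" by auto
    then have "k *s x + y = (\<Sum>i\<in>UNIV. ((if i = j then k else 0) + c i) *s b i)"
      by (simp add: scale_left_distrib sum.distrib if_distrib[of "\<lambda>k. k *s _"] cong: if_cong)
    then show ?case by (rule exI[of _ "\<lambda>i. (if i = j then k else 0) + c i"])
  qed
  then show ?thesis using that by blast
qed

lemma matrix_expansion:
  fixes m :: "'i::finite \<Rightarrow> 'j::finite \<Rightarrow> complex"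
  shows "m = (\<Sum>t\<in>UNIV. \<Sum>s\<in>UNIV. mscale (m t s) (\<lambda>t' s'. of_bool (t' = t \<and> s' = s)))"
proof (intro ext)
  fix t' s'
  have "(\<Sum>t\<in>UNIV. \<Sum>s\<in>UNIV. m t s * of_bool (t' = t \<and> s' = s))
      = (\<Sum>t\<in>UNIV. if t' = t then \<Sum>s\<in>UNIV. if s' = s then m t s else 0 else 0)"
    by (intro sum.cong refl) auto
  then show "m t' s' = (\<Sum>t\<in>UNIV. \<Sum>s\<in>UNIV. mscale (m t s) (\<lambda>t' s'. of_bool (t' = t \<and> s' = s))) t' s'"
    by simp
qed

lemma matrix_projection:
  fixes V :: "('i::finite \<Rightarrow> 'j::finite \<Rightarrow> complex) set"
  assumes "mat.subspace V"
  obtains P where "\<forall>t s. P t s \<in> V" "\<forall>v\<in>V. v = (\<Sum>t\<in>UNIV. \<Sum>s\<in>UNIV. mscale (v t s) (P t s))"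
proof -
  interpret vector_space_pair "mscale :: _ \<Rightarrow> ('i \<Rightarrow> 'j \<Rightarrow> complex) \<Rightarrow> _" "mscale :: _ \<Rightarrow> ('i \<Rightarrow> 'j \<Rightarrow> complex) \<Rightarrow> _"
    by unfold_locales
  have "Vector_Spaces.linear mscale mscale (\<lambda>v :: 'i \<Rightarrow> 'j \<Rightarrow> complex. v)" by (rule mat.linear_ident)
  then obtain g where g: "range g \<subseteq> V" "Vector_Spaces.linear mscale mscale g" "\<forall>v\<in>V. g v = v"
    using linear_exists_left_inverse_on[of "\<lambda>v. v" V] assms by auto
  let ?e = "\<lambda>t s t' s'. of_bool (t' = t \<and> s' = s)"
  have expand: "v = (\<Sum>t\<in>UNIV. \<Sum>s\<in>UNIV. mscale (v t s) (g (?e t s)))" if "v \<in> V" for v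
  proof -
    have "g (\<Sum>t\<in>UNIV. \<Sum>s\<in>UNIV. mscale (v t s) (?e t s)) = (\<Sum>t\<in>UNIV. \<Sum>s\<in>UNIV. mscale (v t s) (g (?e t s)))"
      by (simp only: linear_sum[OF g(2)] linear_scale[OF g(2)])
    then show ?thesis using matrix_expansion[of v] g(3) that by metis
  qed
  show ?thesis
    using g(1) expand by (intro that[of "\<lambda>t s. g (?e t s)"]) blast+
qed

lemma bilin_ext_ideal_gen:
  assumes W: "mat.subspace W" and bilinear: "\<And>t s. bilinear_form sc (\<beta> t s)"
    and R: "\<And>r. r \<in> R \<Longrightarrow> r \<in> words_deg M 2" "\<And>r. r \<in> R \<Longrightarrow> (\<lambda>t s. bilin_ext (\<beta> t s) r) \<in> W"
    and x: "x \<in> ideal_gen M (lin_rels sc M \<union> R)"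
  shows "(\<lambda>t s. bilin_ext (\<beta> t s) x) \<in> W"
proof -
  let ?m = "\<lambda>x t s. bilin_ext (\<beta> t s) x"
  have linear: "?m 0 = 0" "?m (x + y) = ?m x + ?m y" "?m (fscale c x) = mscale c (?m x)" for x y c
    by (simp_all add: fun_eq_iff)
  have "ideal_gen M (lin_rels sc M \<union> R) \<subseteq> {x. ?m x \<in> W}"
  proof (rule ideal_gen_minimal)
    show "flin.subspace {x. ?m x \<in> W}"
      unfolding flin.subspace_def mem_Collect_eq linear
      using mat.subspace_0[OF W] mat.subspace_add[OF W] mat.subspace_scale[OF W] by blast
    fix u r v assume "r \<in> lin_rels sc M \<union> R"
    then consider "u = 0" "v = 0" "r \<in> R" | "?m (mon u * r * mon v) = 0"
      using bilin_ext_context_lin_rels[OF bilinear] bilin_ext_context_words_deg_2 R(1)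
      by (fastforce simp: fun_eq_iff)
    then show "mon u * r * mon v \<in> {x. ?m x \<in> W}"
      using R(2) mat.subspace_0[OF W] by cases simp_all
  qed
  then show ?thesis using x by blast
qed

lemma eval_otimes_coact_words_deg_2:
  assumes "x \<in> words_deg M 2"
    and pairs: "\<And>m n. m \<in> M \<Longrightarrow> n \<in> M \<Longrightarrow> (\<Sum>(a, m')\<leftarrow>\<delta> m. \<Sum>(b, n')\<leftarrow>\<delta> n. (a \<star> b) X * \<beta> m' n') = \<gamma> m n"
  shows "eval_otimes X (on_pairs \<beta>) (coact \<delta> x) = bilin_ext \<gamma> x"
  unfolding eval_otimes_coact bilin_ext_def lin_ext_def
proof (rule sum.cong)
  fix w assume "w \<in> Poly_Mapping.keys x"
  then obtain m n where w: "w = Word [m, n]" "m \<in> M" "n \<in> M" using words_deg_2_keysE[OF assms(1)] by blast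
  show "Poly_Mapping.lookup x w * (\<Sum>(a, ms)\<leftarrow>coact_list \<delta> (letters w). a X * on_pairs \<beta> (Word ms))
      = Poly_Mapping.lookup x w * on_pairs \<gamma> w"
    unfolding w(1) word.sel coact_list_pair on_pairs_Word pairs[OF w(2,3)] ..
qed simp

lemma eval_coinvariance_kernel:
  assumes "z \<in> coinvariance_kernel H N M J" "\<And>n. n \<in> N \<Longrightarrow> n X = 0"
    and W: "mat.subspace W" "\<And>x. x \<in> J \<Longrightarrow> (\<lambda>t s. bilin_ext (\<beta> t s) x) \<in> W"
  shows "(\<lambda>t s. eval_otimes X (on_pairs (\<beta> t s)) z) \<in> W"
proof -
  obtain ns ts where z: "z = (\<Sum>(a, x)\<leftarrow>ns. otimes a x) + (\<Sum>(a, x)\<leftarrow>ts. otimes a x)"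
    and mem: "set ns \<subseteq> N \<times> words_on M" "set ts \<subseteq> H \<times> J"
    using assms(1) by (auto simp: coinvariance_kernel_def otimes_set_def)
  have "(\<Sum>p\<leftarrow>ns. fst p X * lin_ext L (snd p)) = (\<Sum>p\<leftarrow>ns. 0)" for L
    using mem(1) assms(2) by (intro arg_cong[where f = sum_list] map_cong) fastforce+
  then have "(\<lambda>t s. eval_otimes X (on_pairs (\<beta> t s)) z) =
      (\<Sum>p\<leftarrow>ts. mscale (fst p X) (\<lambda>t s. bilin_ext (\<beta> t s) (snd p)))"
    by (simp add: z fun_eq_iff eval_otimes_add eval_otimes_sum_list eval_otimes_otimes case_prod_unfold
        sum_list_fun_apply bilin_ext_def)
  also have "\<dots> \<in> W"
    using mem(2) by (intro mat.subspace_sum_list mat.subspace_scale W) auto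
  finally show ?thesis .
qed

lemma (in word_ideal) coinvariants_eq_qspan:
  fixes b :: "'i::finite \<Rightarrow> 'm free_alg"
  assumes "\<And>x. x \<in> words_deg M k \<Longrightarrow> coact \<delta> x - otimes unit x \<in> coinvariance_kernel H N M J
      \<Longrightarrow> \<exists>c. x \<approx> (\<Sum>i\<in>UNIV. fscale (c i) (b i))"
    and "\<And>c. (\<Sum>i\<in>UNIV. fscale (c i) (b i)) \<in> words_deg M k"
    and "\<And>c. coact \<delta> (\<Sum>i\<in>UNIV. fscale (c i) (b i)) - otimes unit (\<Sum>i\<in>UNIV. fscale (c i) (b i))
      \<in> coinvariance_kernel H N M J"
  shows "coinvariants H N \<delta> M J k = qspan J (cls J ` range b)"
proof -
  have span: "(\<Sum>i\<in>UNIV. fscale (c i) (b i)) \<in> flin.span (range b)" for c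
    by (intro flin.span_sum flin.span_scale flin.span_base rangeI)
  have "C \<in> coinvariants H N \<delta> M J k \<longleftrightarrow> C \<in> cls J ` flin.span (range b)" for C
  proof
    assume "C \<in> coinvariants H N \<delta> M J k"
    then obtain x c where "C = cls J x" "x \<approx> (\<Sum>i\<in>UNIV. fscale (c i) (b i))"
      using assms(1) unfolding coinvariants_iff by blast
    then have "C = cls J (\<Sum>i\<in>UNIV. fscale (c i) (b i))" by (simp add: cls_eq_iff)
    then show "C \<in> cls J ` flin.span (range b)" using span by blast
  next
    assume "C \<in> cls J ` flin.span (range b)"
    then obtain z where z: "C = cls J z" "z \<in> flin.span (range b)" by blast
    from z(2) obtain c where "z = (\<Sum>i\<in>UNIV. fscale (c i) (b i))" by (rule flin.span_rangeE)
    then show "C \<in> coinvariants H N \<delta> M J k" using z(1) assms(2,3) unfolding coinvariants_iff by blast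
  qed
  then show ?thesis unfolding qspan_cls_image by blast
qed

section \<open>The quadratic relations\<close>

type_synonym matrix = "rvec \<Rightarrow> rvec \<Rightarrow> complex"

definition weight_part :: "(node \<Rightarrow> int) \<Rightarrow> matrix \<Rightarrow> matrix"
  where "weight_part \<mu> m = (\<lambda>t s. if wt t + wt s = \<mu> then m t s else 0)"

lemma weight_part_linear: "weight_part \<mu> (m + n) = weight_part \<mu> m + weight_part \<mu> n"
  "weight_part \<mu> (m - n) = weight_part \<mu> m - weight_part \<mu> n" "weight_part \<mu> (- m) = - weight_part \<mu> m"
  "weight_part \<mu> (mscale c m) = mscale c (weight_part \<mu> m)" "weight_part \<mu> 0 = 0"
  by (simp_all add: weight_part_def fun_eq_iff)

lemma weight_part_sum: "weight_part \<mu> (\<Sum>i\<in>A. f i) = (\<Sum>i\<in>A. weight_part \<mu> (f i))"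
  by (induction A rule: infinite_finite_induct)
    (simp_all only: sum.infinite sum.empty sum.insert not_False_eq_True weight_part_linear)

definition pair_weights :: "(node \<Rightarrow> int) set"
  where "pair_weights = range (\<lambda>(t, s). wt t + wt s)"

lemma finite_pair_weights: "finite pair_weights"
  by (simp add: pair_weights_def)

lemma wt_add_in_pair_weights: "wt t + wt s \<in> pair_weights"
  by (force simp: pair_weights_def)

lemma sum_weight_parts: "(\<Sum>\<mu>\<in>pair_weights. weight_part \<mu> m) = m"
proof (intro ext)
  fix t s
  have "(\<Sum>\<mu>\<in>pair_weights. weight_part \<mu> m) t s = (\<Sum>\<mu>\<in>pair_weights. if \<mu> = wt t + wt s then m t s else 0)"
    unfolding sum_fun_apply weight_part_def by (intro sum.cong) auto
  also have "\<dots> = m t s" using finite_pair_weights wt_add_in_pair_weights by simp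
  finally show "(\<Sum>\<mu>\<in>pair_weights. weight_part \<mu> m) t s = m t s" .
qed

fun opposite :: "rvec \<Rightarrow> rvec"
  where "opposite (Eix \<gamma>) = Fix \<gamma>" | "opposite (Fix \<gamma>) = Eix \<gamma>"

lemma wt_add_eq_0_iff: "wt t + wt s = 0 \<longleftrightarrow> t = opposite s"
proof -
  have "wt (opposite s) = - wt s" by (rule ext, cases s) simp_all
  then have "wt t + wt s = 0 \<longleftrightarrow> wt t = wt (opposite s)" by (metis eq_neg_iff_add_eq_0)
  then show ?thesis by (simp add: wt_inj)
qed

definition fe_matrix :: "root \<Rightarrow> matrix"
  where "fe_matrix \<gamma> = (\<lambda>t s. of_bool (t = Fix \<gamma> \<and> s = Eix \<gamma>))"

definition ef_matrix :: "root \<Rightarrow> matrix"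
  where "ef_matrix \<gamma> = (\<lambda>t s. of_bool (t = Eix \<gamma> \<and> s = Fix \<gamma>))"

lemma weight_part_0: "weight_part 0 m =
    (\<Sum>\<gamma>\<in>UNIV. mscale (m (Eix \<gamma>) (Fix \<gamma>)) (ef_matrix \<gamma>) + mscale (m (Fix \<gamma>) (Eix \<gamma>)) (fe_matrix \<gamma>))"
proof (intro ext)
  show "weight_part 0 m t s =
      (\<Sum>\<gamma>\<in>UNIV. mscale (m (Eix \<gamma>) (Fix \<gamma>)) (ef_matrix \<gamma>) + mscale (m (Fix \<gamma>) (Eix \<gamma>)) (fe_matrix \<gamma>)) t s" for t s
    by (cases t; cases s; rename_tac \<gamma> \<delta>; case_tac \<gamma>; case_tac \<delta>;
        simp add: weight_part_def wt_add_eq_0_iff sum_root ef_matrix_def fe_matrix_def)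
qed

lemma weight_part_0_matrix_units:
  "weight_part 0 (ef_matrix \<gamma>) = ef_matrix \<gamma>" "weight_part 0 (fe_matrix \<gamma>) = fe_matrix \<gamma>"
  by (auto simp: weight_part_def wt_add_eq_0_iff ef_matrix_def fe_matrix_def fun_eq_iff)

lemma matrix_eqI_weight_0:
  assumes "weight_part 0 m = m" "weight_part 0 n = n" "\<And>t. m t (opposite t) = n t (opposite t)"
  shows "m = n"
  using weight_part_0[of m] weight_part_0[of n] assms(3)[of "Eix _"] assms(3)[of "Fix _"] by (simp add: assms(1,2))

context quantum_parameter
begin

text \<open>The second-order part of \<open>y\<close>, which is its image in \<open>V\<^sup>1 \<otimes> V\<^sup>1\<close> under
  \<open>y \<mapsto> [y\<^sub>(\<^sub>1\<^sub>)\<^sup>+] \<otimes> [y\<^sub>(\<^sub>2\<^sub>)\<^sup>+]\<close>; thus \<open>quad_rels\<close> is \<open>I\<^sup>(\<^sup>2\<^sup>)\<close>.\<close>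

definition quad_matrix :: "fnl \<Rightarrow> matrix"
  where "quad_matrix y = (\<lambda>t s. (Xvec q t \<triangleright> (Xvec q s \<triangleright> y)) 0)"

definition quad_rels :: "matrix set"
  where "quad_rels = quad_matrix ` cot_ideal q"

lemma quad_matrix_linear: "quad_matrix (a + b) = quad_matrix a + quad_matrix b"
  "quad_matrix (csc c a) = mscale c (quad_matrix a)" "quad_matrix 0 = 0"
  by (simp_all add: quad_matrix_def fun_eq_iff)

lemma quad_matrix_coproduct:
  assumes "coproduct_rep y ps"
  shows "quad_matrix y = (\<Sum>(x, z)\<leftarrow>ps. (\<lambda>t s. cot q x t * cot q z s))"
proof (intro ext)
  fix t s
  have "quad_matrix y t s = (\<Sum>p\<leftarrow>ps. pair (Xvec q s) (snd p) * (Xvec q t \<triangleright> fst p) 0)"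
    unfolding quad_matrix_def coproduct_rep_act[OF assms] act_sum_list
    by (simp add: sum_list_fun_apply case_prod_unfold)
  then show "quad_matrix y t s = (\<Sum>(x, z)\<leftarrow>ps. (\<lambda>t s. cot q x t * cot q z s)) t s"
    by (simp add: sum_list_fun_apply case_prod_unfold cot_def act_apply_0 mult.commute)
qed

lemma cot_ideal_iff: "y \<in> cot_ideal q \<longleftrightarrow> y \<in> \<B> \<and> y 0 = 0 \<and> (\<forall>r. (Xvec q r \<triangleright> y) 0 = 0)"
proof -
  have "(\<forall>X\<in>Tspace q. pair X y = 0) \<longleftrightarrow> (\<forall>r. pair (Xvec q r) y = 0)"
  proof
    assume "\<forall>r. pair (Xvec q r) y = 0"
    then have "flin.span (range (Xvec q)) \<subseteq> {X. pair X y = 0}"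
      by (intro flin.span_minimal) (auto simp: flin.subspace_def pair_eq_lin_ext)
    then show "\<forall>X\<in>Tspace q. pair X y = 0" by (auto simp: Tspace_def)
  qed (auto simp: Tspace_def intro: flin.span_base)
  then show ?thesis by (simp add: cot_ideal_def OqF3_plus_def counit_def act_apply_0)
qed

lemma subspace_cot_ideal: "fn.subspace (cot_ideal q)"
  using subspace_OqF3 by (auto simp: fn.subspace_def cot_ideal_iff)

lemma subspace_quad_rels: "mat.subspace quad_rels"
proof -
  have "module_hom csc mscale quad_matrix" by unfold_locales (simp_all add: quad_matrix_linear)
  then show ?thesis unfolding quad_rels_def by (rule module_hom.subspace_image[OF _ subspace_cot_ideal])
qed

lemma OqF3_weight_component:
  assumes "y \<in> \<B>"
  obtains z where "bihom \<mu> 0 z"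
    and "\<And>X \<nu>. (\<And>b. b \<in> \<B> \<Longrightarrow> X \<triangleright> b \<in> weight_space \<nu>) \<Longrightarrow> (X \<triangleright> z) 0 = (if \<nu> = \<mu> then (X \<triangleright> y) 0 else 0)"
proof -
  obtain S f where S: "finite S" and f: "\<And>\<mu>. bihom \<mu> 0 (f \<mu>)" and y: "y = (\<Sum>\<mu>\<in>S. f \<mu>)"
    using weight_space_decomp[of y 0] assms by (auto simp: OqF3_eq)
  define z where "z = (if \<mu> \<in> S then f \<mu> else 0)"
  show ?thesis
  proof (rule that[of z])
    show "bihom \<mu> 0 z" using f by (simp add: z_def bihom_zero)
    fix X \<nu> assume X: "\<And>b. b \<in> \<B> \<Longrightarrow> X \<triangleright> b \<in> weight_space \<nu>"
    have zero: "(X \<triangleright> f \<kappa>) 0 = 0" if "\<kappa> \<noteq> \<nu>" for \<kappa> using bihom_act_counit[OF f X that] .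
    have "(X \<triangleright> y) 0 = (\<Sum>\<kappa>\<in>S. if \<kappa> = \<nu> then (X \<triangleright> f \<nu>) 0 else 0)"
      unfolding y act_sum sum_fun_apply using zero by (intro sum.cong) auto
    then show "(X \<triangleright> z) 0 = (if \<nu> = \<mu> then (X \<triangleright> y) 0 else 0)"
      using S zero by (auto simp: z_def)
  qed
qed

lemma cot_ideal_weight_part:
  assumes "y \<in> cot_ideal q"
  obtains z where "z \<in> cot_ideal q" "bihom \<mu> 0 z" "quad_matrix z = weight_part \<mu> (quad_matrix y)"
proof -
  have y: "y \<in> \<B>" "y 0 = 0" "\<And>r. (Xvec q r \<triangleright> y) 0 = 0" using assms by (auto simp: cot_ideal_iff)
  obtain z where z: "bihom \<mu> 0 z"
    "\<And>X \<nu>. (\<And>b. b \<in> \<B> \<Longrightarrow> X \<triangleright> b \<in> weight_space \<nu>) \<Longrightarrow> (X \<triangleright> z) 0 = (if \<nu> = \<mu> then (X \<triangleright> y) 0 else 0)"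
    using OqF3_weight_component[OF y(1)] by blast
  have "z 0 = 0" using z(2)[of 1 0] y(2) by (simp add: OqF3_eq)
  moreover have "(Xvec q r \<triangleright> z) 0 = 0" for r using z(2)[OF Xvec_OqF3] y(3) by simp
  ultimately have "z \<in> cot_ideal q" using bihom_weight_space[OF z(1)] by (simp add: cot_ideal_iff OqF3_eq)
  moreover have "quad_matrix z t s = weight_part \<mu> (quad_matrix y) t s" for t s
  proof -
    have "(Xvec q t * Xvec q s) \<triangleright> b \<in> weight_space (wt t + wt s)" if "b \<in> \<B>" for b
      using Xvec_weight_space[OF Xvec_OqF3[OF that, of s], of t] by (simp add: add.commute)
    from z(2)[OF this] show ?thesis by (simp add: quad_matrix_def weight_part_def)
  qed
  ultimately show ?thesis using z(1) that by blast
qed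

lemma quad_matrix_bihom:
  assumes "bihom \<mu> 0 y" shows "weight_part \<mu> (quad_matrix y) = quad_matrix y"
proof -
  have "quad_matrix y t s = 0" if "wt t + wt s \<noteq> \<mu>" for t s
  proof -
    have "(Xvec q t * Xvec q s) \<triangleright> b \<in> weight_space (wt t + wt s)" if "b \<in> \<B>" for b
      using Xvec_weight_space[OF Xvec_OqF3[OF that, of s], of t] by (simp add: add.commute)
    from bihom_act_counit[OF assms this] that show ?thesis by (auto simp: quad_matrix_def)
  qed
  then show ?thesis by (auto simp: weight_part_def fun_eq_iff)
qed

lemma quad_rels_weight_part:
  assumes "m \<in> quad_rels" shows "weight_part \<mu> m \<in> quad_rels"
proof -
  obtain y where "y \<in> cot_ideal q" "m = quad_matrix y" using assms by (auto simp: quad_rels_def)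
  then show ?thesis using cot_ideal_weight_part[of y \<mu>] unfolding quad_rels_def by (metis image_eqI)
qed

lemma quad_rels_graded_projection:
  obtains P where "\<forall>t s. P t s \<in> quad_rels \<and> weight_part (wt t + wt s) (P t s) = P t s"
    and "\<forall>v\<in>quad_rels. v = (\<Sum>t\<in>UNIV. \<Sum>s\<in>UNIV. mscale (v t s) (P t s))"
proof -
  obtain Q where Q: "\<forall>t s. Q t s \<in> quad_rels"
    "\<forall>v\<in>quad_rels. v = (\<Sum>t\<in>UNIV. \<Sum>s\<in>UNIV. mscale (v t s) (Q t s))"
    by (rule matrix_projection[OF subspace_quad_rels])
  define P where "P t s = weight_part (wt t + wt s) (Q t s)" for t s
  have expand: "v = (\<Sum>t\<in>UNIV. \<Sum>s\<in>UNIV. mscale (v t s) (P t s))" if v: "v \<in> quad_rels" for v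
  proof -
    have idem: "weight_part \<mu> v = weight_part \<mu> (weight_part \<mu> v)" for \<mu> by (simp add: weight_part_def fun_eq_iff)
    have "v = (\<Sum>\<mu>\<in>pair_weights. weight_part \<mu> (weight_part \<mu> v))"
      by (simp only: idem[symmetric] sum_weight_parts)
    also have "\<dots> = (\<Sum>\<mu>\<in>pair_weights. \<Sum>t\<in>UNIV. \<Sum>s\<in>UNIV. mscale (weight_part \<mu> v t s) (weight_part \<mu> (Q t s)))"
      by (subst Q(2)[rule_format, OF quad_rels_weight_part[OF v]]) (simp only: weight_part_sum weight_part_linear)
    also have "\<dots> = (\<Sum>t\<in>UNIV. \<Sum>s\<in>UNIV. \<Sum>\<mu>\<in>pair_weights. mscale (weight_part \<mu> v t s) (weight_part \<mu> (Q t s)))"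
      by (subst sum.swap, intro sum.cong refl, rule sum.swap)
    also have "\<dots> = (\<Sum>t\<in>UNIV. \<Sum>s\<in>UNIV. mscale (v t s) (P t s))"
    proof (intro sum.cong refl)
      fix t s
      have "(\<Sum>\<mu>\<in>pair_weights. mscale (weight_part \<mu> v t s) (weight_part \<mu> (Q t s)))
          = (\<Sum>\<mu>\<in>pair_weights. if \<mu> = wt t + wt s then mscale (v t s) (P t s) else 0)"
        by (intro sum.cong) (auto simp: weight_part_def[of _ v] P_def)
      then show "(\<Sum>\<mu>\<in>pair_weights. mscale (weight_part \<mu> v t s) (weight_part \<mu> (Q t s))) = mscale (v t s) (P t s)"
        using finite_pair_weights wt_add_in_pair_weights by simp
    qed
    finally show ?thesis .
  qed
  have graded: "weight_part (wt t + wt s) (P t s) = P t s" for t s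
    by (simp add: P_def weight_part_def fun_eq_iff)
  have "P t s \<in> quad_rels" for t s using Q(1) by (simp add: P_def quad_rels_weight_part)
  then show ?thesis using graded expand by (intro that[of P]) blast+
qed

lemma quad_rels_nonzero_weights:
  assumes "\<And>i. (\<lambda>t s. (qc powi (wt t i + wt s i) - 1) * m t s) \<in> quad_rels"
  shows "m - weight_part 0 m \<in> quad_rels"
proof -
  have "weight_part \<mu> m \<in> quad_rels" if "\<mu> \<noteq> 0" for \<mu>
  proof -
    from that obtain i where i: "\<mu> i \<noteq> 0" by (auto simp: fun_eq_iff)
    have "weight_part \<mu> (\<lambda>t s. (qc powi (wt t i + wt s i) - 1) * m t s) = mscale (qc powi \<mu> i - 1) (weight_part \<mu> m)"
      by (auto simp: weight_part_def fun_eq_iff)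
    then have "mscale (qc powi \<mu> i - 1) (weight_part \<mu> m) \<in> quad_rels"
      using quad_rels_weight_part[OF assms[of i], of \<mu>] by simp
    then have "mscale (1 / (qc powi \<mu> i - 1)) (mscale (qc powi \<mu> i - 1) (weight_part \<mu> m)) \<in> quad_rels"
      by (rule mat.subspace_scale[OF subspace_quad_rels])
    then show ?thesis using i by (simp add: q_powi_eq_1)
  qed
  then have "(\<Sum>\<mu>\<in>pair_weights - {0}. weight_part \<mu> m) \<in> quad_rels"
    by (intro mat.subspace_sum subspace_quad_rels) auto
  moreover have "wt (Eix A1) + wt (Fix A1) = 0" by (simp add: wt_add_eq_0_iff)
  then have "0 \<in> pair_weights" using wt_add_in_pair_weights[of "Eix A1" "Fix A1"] by simp
  then have "m = weight_part 0 m + (\<Sum>\<mu>\<in>pair_weights - {0}. weight_part \<mu> m)"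
    using sum.remove[OF finite_pair_weights, of 0 "\<lambda>\<mu>. weight_part \<mu> m"] by (simp only: sum_weight_parts)
  then have "m - weight_part 0 m = (\<Sum>\<mu>\<in>pair_weights - {0}. weight_part \<mu> m)"
    by (metis add_diff_cancel_left')
  ultimately show ?thesis by simp
qed

section \<open>The quadratic relations of weight zero\<close>

definition u_antip :: "nat \<Rightarrow> nat \<Rightarrow> fnl"
  where "u_antip i j = u_coef q i j \<star> antip (u_coef q j i)"

lemma bihom_u_antip_0: "i \<in> {1..3} \<Longrightarrow> j \<in> {1..3} \<Longrightarrow> bihom 0 0 (u_antip i j)"
  using bihom_u_antip[of i j i] by (simp add: u_antip_def)

lemma u_antip_cot_ideal:
  assumes "i \<in> {1..3}" "j \<in> {1..3}" "i \<noteq> j"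
  shows "u_antip i j \<in> cot_ideal q"
proof -
  note bihom = bihom_u_antip_0[OF assms(1,2)]
  have "u_antip i j 0 = 0" using assms(3) by (simp add: u_antip_def conv_0 u_coef_0)
  moreover have "pair (Xvec q r) (u_antip i j) = 0" for r
    using pair_Xvec_weight[OF bihom, of r] wt_nonzero[of r] by metis
  ultimately show ?thesis
    using bihom_weight_space[OF bihom] by (simp add: cot_ideal_iff OqF3_eq act_apply_0)
qed

lemmas quad_matrix_u_simps = quad_matrix_def u_antip_def Xvec_act rshift_conv rshift_u_coef rshift_antip lshift_u_coef
  index_mem conv_0 antip_0 u_coef_0 index_wt_def power_int_minus

lemma quad_matrix_u_antip_eqI:
  assumes "i \<in> {1..3}" "j \<in> {1..3}" "weight_part 0 m = m"
    and "\<And>t. quad_matrix (u_antip i j) t (opposite t) = m t (opposite t)"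
  shows "quad_matrix (u_antip i j) = m"
  by (rule matrix_eqI_weight_0[OF quad_matrix_bihom[OF bihom_u_antip_0[OF assms(1,2)]] assms(3,4)])

lemma quad_matrix_u_antip:
  shows "quad_matrix (u_antip 1 3) = mscale (- (1 / qc\<^sup>2)) (ef_matrix A12) - fe_matrix A12" (is "_ = ?m13")
    and "quad_matrix (u_antip 1 2) = mscale ((qc\<^sup>2 - 1) / qc ^ 4) (ef_matrix A12)
      - mscale (1 / qc) (ef_matrix A1) - mscale qc (fe_matrix A1)" (is "_ = ?m12")
    and "quad_matrix (u_antip 2 3) = mscale (- (qc\<^sup>2 - 1) / qc ^ 4) (ef_matrix A12)
      - mscale (1 / qc) (ef_matrix A2) - mscale qc (fe_matrix A2)" (is "_ = ?m23")
proof -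
  note entries = quad_matrix_u_simps ef_matrix_def fe_matrix_def
  note arith = field_simps power2_eq_square power4_eq_xxxx
  note weights = weight_part_linear weight_part_0_matrix_units
  show "quad_matrix (u_antip 1 3) = ?m13"
  proof (rule quad_matrix_u_antip_eqI)
    show "quad_matrix (u_antip 1 3) t (opposite t) = ?m13 t (opposite t)" for t
      by (cases t; rename_tac \<gamma>; case_tac \<gamma>; simp add: entries; simp add: arith)
  qed (simp_all add: weights)
  show "quad_matrix (u_antip 1 2) = ?m12"
  proof (rule quad_matrix_u_antip_eqI)
    show "quad_matrix (u_antip 1 2) t (opposite t) = ?m12 t (opposite t)" for t
      by (cases t; rename_tac \<gamma>; case_tac \<gamma>; simp add: entries; simp add: arith)
  qed (simp_all add: weights)
  show "quad_matrix (u_antip 2 3) = ?m23"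
  proof (rule quad_matrix_u_antip_eqI)
    show "quad_matrix (u_antip 2 3) t (opposite t) = ?m23 t (opposite t)" for t
      by (cases t; rename_tac \<gamma>; case_tac \<gamma>; simp add: entries; simp add: arith)
  qed (simp_all add: weights)
qed

lemma ef_matrix_span: "ef_matrix \<gamma> \<in> mat.span (quad_rels \<union> range fe_matrix)"
proof -
  let ?U = "mat.span (quad_rels \<union> range fe_matrix)"
  have fe: "fe_matrix \<gamma> \<in> ?U" for \<gamma> by (intro mat.span_base) auto
  have u_antip: "quad_matrix (u_antip i j) \<in> ?U" if "i \<in> {1..3}" "j \<in> {1..3}" "i \<noteq> j" for i j
    using u_antip_cot_ideal[OF that] by (intro mat.span_base) (simp add: quad_rels_def)
  note closed = mat.span_add mat.span_diff mat.span_scale fe u_antip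
  have "ef_matrix A12 = mscale (- qc\<^sup>2) (quad_matrix (u_antip 1 3)) - mscale (qc\<^sup>2) (fe_matrix A12)"
    unfolding quad_matrix_u_antip by (simp add: fun_eq_iff field_simps)
  also have "\<dots> \<in> ?U" by (intro closed) auto
  finally have ef_A12: "ef_matrix A12 \<in> ?U" .
  have "ef_matrix A1 = mscale (- qc) (quad_matrix (u_antip 1 2)) + mscale ((qc\<^sup>2 - 1) / qc ^ 3) (ef_matrix A12)
      - mscale (qc\<^sup>2) (fe_matrix A1)"
    unfolding quad_matrix_u_antip by (simp add: fun_eq_iff field_simps power2_eq_square power3_eq_cube power4_eq_xxxx)
  also have "\<dots> \<in> ?U" by (intro closed ef_A12) auto
  finally have ef_A1: "ef_matrix A1 \<in> ?U" .
  have "ef_matrix A2 = mscale (- qc) (quad_matrix (u_antip 2 3)) - mscale ((qc\<^sup>2 - 1) / qc ^ 3) (ef_matrix A12)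
      - mscale (qc\<^sup>2) (fe_matrix A2)"
    unfolding quad_matrix_u_antip by (simp add: fun_eq_iff field_simps power2_eq_square power3_eq_cube power4_eq_xxxx)
  also have "\<dots> \<in> ?U" by (intro closed ef_A12) auto
  finally have "ef_matrix A2 \<in> ?U" .
  with ef_A12 ef_A1 show ?thesis by (cases \<gamma>) auto
qed

lemma quad_rels_normal_form:
  assumes "\<And>i. (\<lambda>t s. (qc powi (wt t i + wt s i) - 1) * m t s) \<in> quad_rels"
  obtains c where "m - (\<Sum>\<gamma>\<in>UNIV. mscale (c \<gamma>) (fe_matrix \<gamma>)) \<in> quad_rels"
proof -
  let ?U = "mat.span (quad_rels \<union> range fe_matrix)"
  have "m - weight_part 0 m \<in> ?U" using quad_rels_nonzero_weights[OF assms] by (intro mat.span_base) auto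
  moreover have "weight_part 0 m \<in> ?U"
    unfolding weight_part_0 by (intro mat.span_sum mat.span_add mat.span_scale ef_matrix_span mat.span_base) auto
  ultimately have "(m - weight_part 0 m) + weight_part 0 m \<in> ?U" by (rule mat.span_add)
  then obtain x y where m: "m = x + y" and x: "x \<in> mat.span quad_rels" and y: "y \<in> mat.span (range fe_matrix)"
    unfolding mat.span_Un diff_add_cancel by blast
  from y obtain c where "y = (\<Sum>\<gamma>\<in>UNIV. mscale (c \<gamma>) (fe_matrix \<gamma>))" by (rule mat.span_rangeE)
  then show ?thesis
    using that[of c] m x subspace_quad_rels by (metis add_diff_cancel_right' mat.span_eq_iff)
qed

text \<open>Evaluating the commutators \<open>[E\<^sub>\<gamma>, F\<^sub>\<gamma>]\<close> on \<open>I\<close>.\<close>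

lemma quad_matrix_relations:
  assumes "y \<in> cot_ideal q"
  shows "quad_matrix y (Fix A1) (Eix A1) = qc\<^sup>2 * quad_matrix y (Eix A1) (Fix A1)"
    "quad_matrix y (Fix A2) (Eix A2) = qc\<^sup>2 * quad_matrix y (Eix A2) (Fix A2)"
    "quad_matrix y (Fix A12) (Eix A12) =
      (qc - 1 / qc) * (quad_matrix y (Eix A1) (Fix A1) - quad_matrix y (Eix A2) (Fix A2))
       + qc\<^sup>2 * quad_matrix y (Eix A12) (Fix A12)"
proof -
  have dual: "y \<in> \<D>" using assms OqF3_OqSU3 by (simp add: cot_ideal_iff)
  have K: "rshift (K i) y = y" for i using assms by (simp add: cot_ideal_iff OqF3_eq weight_space_def)
  have Kinv: "rshift (Kinv i) y = y" for i using rshift_Kinv_eq[OF dual, of i 0] K by simp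
  have nonzero: "qc * qc - 1 \<noteq> 0" by simp
  have coefficient: "1 / (qc - 1 / qc) = qc / (qc * qc - 1)" using nonzero by (simp add: field_simps)
  note expand = quad_matrix_def Xvec_act rshift_K_rules rshift_E_F[unfolded coefficient] cartan_def
    dual K Kinv csc_add csc_minus
  show "quad_matrix y (Fix A1) (Eix A1) = qc\<^sup>2 * quad_matrix y (Eix A1) (Fix A1)"
    by (simp add: expand; simp add: field_simps power_int_minus power2_eq_square)
  show "quad_matrix y (Fix A2) (Eix A2) = qc\<^sup>2 * quad_matrix y (Eix A2) (Fix A2)"
    by (simp add: expand; simp add: field_simps power_int_minus power2_eq_square)
  define h where "h = inverse (qc * qc - 1)"
  define p where "p = inverse qc"
  have inverses: "h * (qc * qc - 1) = 1" "p * qc = 1" using nonzero by (simp_all add: h_def p_def)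
  have divisions: "inverse qc = p" "x / qc = x * p" "x / (qc * qc - 1) = x * h" for x
    by (simp_all add: p_def h_def divide_inverse)
  show "quad_matrix y (Fix A12) (Eix A12) =
      (qc - 1 / qc) * (quad_matrix y (Eix A1) (Fix A1) - quad_matrix y (Eix A2) (Fix A2))
       + qc\<^sup>2 * quad_matrix y (Eix A12) (Fix A12)"
    by (simp add: expand,
        simp only: power_int_minus power2_eq_square power_int_1_right power_int_numeral
          inverse_mult_distrib divisions,
        use inverses in algebra)
qed

lemma fe_matrix_independent:
  assumes "(\<Sum>\<delta>\<in>UNIV. mscale (c \<delta>) (fe_matrix \<delta>)) \<in> quad_rels"
  shows "c \<delta> = 0"
proof -
  obtain y where y: "y \<in> cot_ideal q" "quad_matrix y = (\<Sum>\<delta>\<in>UNIV. mscale (c \<delta>) (fe_matrix \<delta>))"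
    using assms by (auto simp: quad_rels_def)
  show ?thesis
    using quad_matrix_relations[OF y(1)] unfolding y(2) by (cases \<delta>) (simp_all add: sum_root fe_matrix_def)
qed

end

section \<open>The quantum exterior algebra\<close>

definition matrix_of_tensor :: "coords free_alg \<Rightarrow> matrix"
  where "matrix_of_tensor x = (\<lambda>t s. bilin_ext (\<lambda>a b. a t * b s) x)"

definition tensor_of_matrix :: "matrix \<Rightarrow> coords free_alg"
  where "tensor_of_matrix m = (\<Sum>t\<in>UNIV. \<Sum>s\<in>UNIV. fscale (m t s) (lett (unitvec t) * lett (unitvec s)))"

lemma matrix_of_tensor_linear:
  "matrix_of_tensor (x + y) = matrix_of_tensor x + matrix_of_tensor y"
  "matrix_of_tensor (x - y) = matrix_of_tensor x - matrix_of_tensor y"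
  "matrix_of_tensor (fscale c x) = mscale c (matrix_of_tensor x)" "matrix_of_tensor 0 = 0"
  by (simp_all add: matrix_of_tensor_def fun_eq_iff)

lemma matrix_of_tensor_sum: "matrix_of_tensor (\<Sum>i\<in>A. f i) = (\<Sum>i\<in>A. matrix_of_tensor (f i))"
  by (simp add: matrix_of_tensor_def fun_eq_iff bilin_ext_sum)

lemma matrix_of_tensor_lett: "matrix_of_tensor (lett a * lett b) = (\<lambda>t s. a t * b s)"
  by (simp add: matrix_of_tensor_def)

lemma matrix_of_tensor_fe: "matrix_of_tensor (lett (f_form \<gamma>) * lett (e_form \<gamma>)) = fe_matrix \<gamma>"
  by (simp add: matrix_of_tensor_lett fe_matrix_def f_form_def e_form_def unitvec_def fun_eq_iff)

lemma tensor_of_matrix_linear: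
  "tensor_of_matrix (m + n) = tensor_of_matrix m + tensor_of_matrix n"
  "tensor_of_matrix (mscale c m) = fscale c (tensor_of_matrix m)" "tensor_of_matrix 0 = 0"
  by (simp_all add: tensor_of_matrix_def flin.scale_left_distrib sum.distrib flin.scale_sum_right)

lemma tensor_of_matrix_sum_list: "tensor_of_matrix (\<Sum>i\<leftarrow>is. f i) = (\<Sum>i\<leftarrow>is. tensor_of_matrix (f i))"
  by (induction "is") (simp_all only: list.map sum_list.Nil sum_list.Cons tensor_of_matrix_linear)

context quantum_parameter
begin

lemma V1_eq: "V1 q = UNIV"
proof -
  have "v \<in> V1 q" for v
  proof -
    define y where "y = (\<Sum>r\<in>UNIV. csc (v r) (dual_element r))"
    have "y \<in> \<B>"
      unfolding y_def by (intro fn.subspace_sum fn.subspace_scale subspace_OqF3 dual_element_mem)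
    moreover have "y 0 = 0" by (simp add: y_def dual_element_mem)
    ultimately have "y \<in> OqF3_plus q" by (simp add: OqF3_plus_def counit_def)
    moreover have "cot q y = v"
    proof
      fix s
      have "cot q y s = (\<Sum>r\<in>UNIV. v r * cot q (dual_element r) s)"
        unfolding y_def cot_act act_sum by simp
      also have "\<dots> = (\<Sum>r\<in>UNIV. if r = s then v r else 0)"
        by (intro sum.cong) (auto simp: cot_dual_element unitvec_def)
      finally show "cot q y s = v s" by simp
    qed
    ultimately show ?thesis by (auto simp: V1_def)
  qed
  then show ?thesis by auto
qed

abbreviation V_rels :: "coords free_alg set"
  where "V_rels \<equiv> lin_rels (\<lambda>c v r. c * v r) UNIV \<union> I2 q"

lemma V_ideal_eq: "V_ideal q = ideal_gen UNIV V_rels"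
  by (simp only: V_ideal_def V1_eq)

sublocale V: tensor_ideal UNIV V_rels "\<lambda>c v r. c * v r"
  by unfold_locales auto

lemma cot_plus_part [simp]: "cot q (plus_part y) = cot q y"
  by (simp add: fun_eq_iff cot_act plus_part_def Xvec_unit)

lemma matrix_of_tensor_V_ideal:
  assumes "x \<in> V_ideal q" shows "matrix_of_tensor x \<in> quad_rels"
  unfolding matrix_of_tensor_def
proof (rule bilin_ext_ideal_gen[where R = "I2 q", OF subspace_quad_rels])
  show "bilinear_form (\<lambda>c v r. c * v r) (\<lambda>a b. a t * b s)" for t s :: rvec
    by (simp add: bilinear_form_def algebra_simps)
  fix r assume "r \<in> I2 q"
  then obtain y ps where y: "y \<in> cot_ideal q" "coproduct_rep y ps"
    and r: "r = (\<Sum>(y1, y2)\<leftarrow>ps. lett (cot q y1) * lett (cot q y2))"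
    by (auto simp: I2_def sweedler_iff)
  show "r \<in> words_deg UNIV 2"
    unfolding r case_prod_unfold by (intro flin.subspace_sum_list subspace_words_deg words_deg_2_lett) simp_all
  have "(\<lambda>t s. bilin_ext (\<lambda>a b. a t * b s) r) = quad_matrix y"
    unfolding r quad_matrix_coproduct[OF y(2)]
    by (simp add: fun_eq_iff bilin_ext_sum_list sum_list_fun_apply case_prod_unfold)
  then show "(\<lambda>t s. bilin_ext (\<lambda>a b. a t * b s) r) \<in> quad_rels"
    using y(1) by (simp add: quad_rels_def)
qed (use assms V_ideal_eq in simp)

lemma lett_expansion: "V.cong (lett a) (\<Sum>t\<leftarrow>all_rvecs. fscale (a t) (lett (unitvec t)))"
proof -
  have "a s = (\<Sum>t\<in>UNIV. if t = s then a t else 0)" for s by simp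
  then have "a = (\<Sum>t\<leftarrow>all_rvecs. (\<lambda>r. a t * unitvec t r))"
    unfolding sum_all_rvecs by (auto simp: fun_eq_iff unitvec_def intro!: sum.cong)
  then have "V.cong (lett a) (\<Sum>t\<leftarrow>all_rvecs. lett (\<lambda>r. a t * unitvec t r))"
    using V.cong_lett_sum_list[of all_rvecs "\<lambda>t r. a t * unitvec t r"] by simp
  also have "V.cong \<dots> (\<Sum>t\<leftarrow>all_rvecs. fscale (a t) (lett (unitvec t)))"
    by (intro V.cong_sum_list V.cong_lett_scale) simp
  finally show ?thesis .
qed

lemma lett_lett_expansion: "V.cong (lett a * lett b) (tensor_of_matrix (\<lambda>t s. a t * b s))"
proof -
  have "V.cong (lett a * lett b) ((\<Sum>t\<leftarrow>all_rvecs. fscale (a t) (lett (unitvec t))) * lett b)"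
    by (intro V.cong_lett_right lett_expansion) simp
  also have "\<dots> = (\<Sum>t\<leftarrow>all_rvecs. fscale (a t) (lett (unitvec t) * lett b))"
    by (simp add: sum_list_mult_const[symmetric] fscale_mult_left)
  also have "V.cong \<dots>
      (\<Sum>t\<leftarrow>all_rvecs. fscale (a t) (lett (unitvec t) * (\<Sum>s\<leftarrow>all_rvecs. fscale (b s) (lett (unitvec s)))))"
    by (intro V.cong_sum_list V.cong_scale V.cong_lett_left lett_expansion) simp
  also have "\<dots> = tensor_of_matrix (\<lambda>t s. a t * b s)"
    by (simp add: tensor_of_matrix_def sum_all_rvecs sum_distrib_left fscale_mult_right flin.scale_sum_right)
  finally show ?thesis .
qed

lemma tensor_of_matrix_of_tensor:
  "x \<in> words_deg UNIV 2 \<Longrightarrow> V.cong x (tensor_of_matrix (matrix_of_tensor x))"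
proof (induction rule: words_deg_2_induct)
  case zero
  show ?case by (simp only: matrix_of_tensor_linear tensor_of_matrix_linear V.cong_refl)
next
  case (add c a b y)
  then have "V.cong (fscale c (lett a * lett b) + y)
      (fscale c (tensor_of_matrix (\<lambda>t s. a t * b s)) + tensor_of_matrix (matrix_of_tensor y))"
    by (intro V.cong_add V.cong_scale lett_lett_expansion)
  then show ?case
    by (simp only: matrix_of_tensor_linear tensor_of_matrix_linear matrix_of_tensor_lett)
qed

lemma tensor_of_matrix_quad_rels:
  assumes "m \<in> quad_rels" shows "tensor_of_matrix m \<in> V_ideal q"
proof -
  obtain y where y: "y \<in> cot_ideal q" "m = quad_matrix y" using assms by (auto simp: quad_rels_def)
  then have "y \<in> \<A>" using OqF3_OqSU3 by (simp add: cot_ideal_iff)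
  then obtain ps where ps: "coproduct_rep y ps" "set ps \<subseteq> \<A> \<times> \<A>" using OqSU3_coproduct by blast
  let ?z = "\<Sum>(y1, y2)\<leftarrow>ps. lett (cot q (plus_part y1)) * lett (cot q (plus_part y2))"
  have "?z \<in> I2 q" using ps y(1) unfolding I2_def by (auto simp: sweedler_iff)
  then have "?z \<in> V.J" by (intro V.J_base) blast
  moreover have "V.cong ?z (\<Sum>p\<leftarrow>ps. tensor_of_matrix (\<lambda>t s. cot q (fst p) t * cot q (snd p) s))"
    unfolding case_prod_unfold cot_plus_part by (intro V.cong_sum_list lett_lett_expansion)
  moreover have "(\<Sum>p\<leftarrow>ps. tensor_of_matrix (\<lambda>t s. cot q (fst p) t * cot q (snd p) s)) = tensor_of_matrix m"
    unfolding y(2) quad_matrix_coproduct[OF ps(1)] tensor_of_matrix_sum_list case_prod_unfold ..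
  ultimately show ?thesis using V.cong_mem by (simp add: V_ideal_eq)
qed

lemma V_ideal_iff:
  assumes "x \<in> words_deg UNIV 2" shows "x \<in> V_ideal q \<longleftrightarrow> matrix_of_tensor x \<in> quad_rels"
  using matrix_of_tensor_V_ideal tensor_of_matrix_quad_rels V.cong_mem[OF tensor_of_matrix_of_tensor[OF assms]]
  unfolding V_ideal_eq by blast

section \<open>The coaction of the torus\<close>

definition coact_cot_coeff :: "coords \<Rightarrow> rvec \<Rightarrow> fnl"
  where "coact_cot_coeff v t = (\<Sum>(a, n)\<leftarrow>coact_cot q v. csc (n t) a)"

lemma coact_cot_rep:
  obtains b qs where "b \<in> \<B>" "cot q b = v" "coproduct_rep b qs" "set qs \<subseteq> \<A> \<times> \<B>"
    and "coact_cot q v = map (\<lambda>(x, y). (x, cot q y)) qs"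
proof -
  let ?P = "\<lambda>ps. \<exists>b qs. b \<in> OqF3_plus q \<and> cot q b = v \<and>
     sweedler \<A> \<B> b qs \<and> ps = map (\<lambda>(x, y). (x, cot q (plus_part y))) qs"
  have "v \<in> V1 q" by (simp only: V1_eq UNIV_I)
  then obtain b where b: "b \<in> OqF3_plus q" "cot q b = v" by (auto simp: V1_def)
  then obtain qs where "coproduct_rep b qs" "set qs \<subseteq> \<A> \<times> \<B>"
    using weight_space_coproduct[of b 0] by (auto simp: OqF3_plus_def OqF3_eq)
  then have "?P (map (\<lambda>(x, y). (x, cot q (plus_part y))) qs)" using b by (auto simp: sweedler_iff)
  then have "?P (coact_cot q v)" unfolding coact_cot_def by (rule someI)
  then show ?thesis using that by (auto simp: sweedler_iff OqF3_plus_def)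
qed

lemma coact_cot_mem: "set (coact_cot q v) \<subseteq> \<A> \<times> UNIV"
  by (rule coact_cot_rep[of v]) auto

lemma coact_cot_coeff: "coact_cot_coeff v t \<in> weight_space (wt t)" "coact_cot_coeff v t 0 = v t"
proof -
  obtain b qs where b: "b \<in> \<B>" "cot q b = v" "coproduct_rep b qs" "set qs \<subseteq> \<A> \<times> \<B>"
    and coact: "coact_cot q v = map (\<lambda>(x, y). (x, cot q y)) qs" by (rule coact_cot_rep)
  have "coact_cot_coeff v t = Xvec q t \<triangleright> b"
    unfolding coact_cot_coeff_def coact coproduct_rep_act[OF b(3)]
    by (simp only: map_map comp_def case_prod_unfold fst_conv snd_conv cot_def)
  then show "coact_cot_coeff v t \<in> weight_space (wt t)" "coact_cot_coeff v t 0 = v t"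
    using Xvec_OqF3[OF b(1)] by (simp_all add: b(2)[symmetric] cot_act)
qed

definition coact_cot_matrix :: "coords free_alg \<Rightarrow> rvec \<Rightarrow> rvec \<Rightarrow> fnl"
  where "coact_cot_matrix x = (\<lambda>t s X. eval_otimes X (on_pairs (\<lambda>a b. a t * b s)) (coact (coact_cot q) x))"

lemma coact_cot_matrix_eq:
  assumes "x \<in> words_deg UNIV 2"
  shows "coact_cot_matrix x t s = (\<lambda>X. bilin_ext (\<lambda>m n. (coact_cot_coeff m t \<star> coact_cot_coeff n s) X) x)"
  unfolding coact_cot_matrix_def coact_cot_coeff_def conv_sum_list_left unfolding conv_sum_list_right
  by (intro ext eval_otimes_coact_words_deg_2[OF assms]) (simp add: sum_list_fun_apply case_prod_unfold mult_ac)

lemma coact_cot_matrix_weight: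
  "x \<in> words_deg UNIV 2 \<Longrightarrow> coact_cot_matrix x t s \<in> weight_space (wt t + wt s)"
  unfolding coact_cot_matrix_eq
proof (induction rule: words_deg_2_induct)
  case zero
  show ?case using weight_space_zero by (simp add: zero_fun_def)
next
  case (add c m n y)
  let ?f = "\<lambda>x X. bilin_ext (\<lambda>m n. (coact_cot_coeff m t \<star> coact_cot_coeff n s) X) x"
  have "?f (fscale c (lett m * lett n) + y) = csc c (coact_cot_coeff m t \<star> coact_cot_coeff n s) + ?f y"
    by (simp add: fun_eq_iff)
  then show ?case
    using add.IH coact_cot_coeff(1) fn.subspace_add[OF subspace_weight_space] weight_space_csc weight_space_conv
    by metis
qed

lemma coact_cot_matrix_counit: "x \<in> words_deg UNIV 2 \<Longrightarrow> coact_cot_matrix x t s 0 = matrix_of_tensor x t s"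
  by (simp add: coact_cot_matrix_eq matrix_of_tensor_def conv_0 coact_cot_coeff)

lemma unit_apply_K [simp]: "unit (Word [K i]) = 1"
  by (simp add: unit_def)

lemma conv_apply_K: "(a \<star> b) (Word [K i]) = a (Word [K i]) * b (Word [K i])"
  using fun_cong[OF lshift_conv(3)[of i a b], of 0] by (simp add: lshift_apply conv_0)

lemma weight_space_apply_K: "a \<in> weight_space \<nu> \<Longrightarrow> a (Word [K i]) = qc powi \<nu> i * a 0"
  using rshift_apply[of "K i" a 0] by (simp add: weight_space_def)

lemma BplusA_apply_K:
  assumes "n \<in> BplusA q" shows "n (Word [K i]) = 0"
proof -
  obtain ps where ps: "n = (\<Sum>(b, a)\<leftarrow>ps. b \<star> a)" "set ps \<subseteq> OqF3_plus q \<times> \<A>"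
    using assms by (auto simp: BplusA_def)
  have "b (Word [K i]) = 0" if "b \<in> OqF3_plus q" for b
    using weight_space_apply_K[of b 0 i] that by (simp add: OqF3_plus_def OqF3_eq counit_def)
  then have "map (\<lambda>(b, a). (b \<star> a) (Word [K i])) ps = map (\<lambda>_. 0) ps"
    using ps(2) by (auto simp: conv_apply_K)
  then show ?thesis
    unfolding ps(1) by (simp add: sum_list_fun_apply case_prod_unfold del: map_eq_conv)
qed

lemma coinvariant_matrix_of_tensor:
  assumes x: "x \<in> words_deg UNIV 2"
    and "coact (coact_cot q) x - otimes unit x \<in> coinvariance_kernel \<A> (BplusA q) UNIV (V_ideal q)"
  shows "(\<lambda>t s. (qc powi (wt t i + wt s i) - 1) * matrix_of_tensor x t s) \<in> quad_rels"
proof -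
  let ?ev = "\<lambda>t s. eval_otimes (Word [K i]) (on_pairs (\<lambda>a b. a t * b s))"
  have "?ev t s (coact (coact_cot q) x - otimes unit x) =
      (qc powi (wt t i + wt s i) - 1) * matrix_of_tensor x t s" for t s
  proof -
    have "?ev t s (coact (coact_cot q) x) = qc powi (wt t i + wt s i) * matrix_of_tensor x t s"
      using weight_space_apply_K[OF coact_cot_matrix_weight[OF x, of t s], of i]
      by (simp add: coact_cot_matrix_counit[OF x]) (simp add: coact_cot_matrix_def)
    moreover have "?ev t s (otimes unit x) = matrix_of_tensor x t s"
      by (simp add: eval_otimes_otimes matrix_of_tensor_def bilin_ext_def)
    ultimately show ?thesis by (simp add: eval_otimes_minus algebra_simps)
  qed
  moreover have "(\<lambda>t s. ?ev t s (coact (coact_cot q) x - otimes unit x)) \<in> quad_rels"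
    by (rule eval_coinvariance_kernel[OF assms(2) BplusA_apply_K subspace_quad_rels
          matrix_of_tensor_V_ideal[unfolded matrix_of_tensor_def]])
  ultimately show ?thesis by simp
qed

definition invertible_weight :: "(node \<Rightarrow> int) \<Rightarrow> bool"
  where "invertible_weight \<mu> \<longleftrightarrow>
    (\<exists>ps. set ps \<subseteq> weight_space (- \<mu>) \<times> weight_space \<mu> \<and> (\<Sum>(x, y)\<leftarrow>ps. x \<star> y) = unit)"

lemma invertible_weight_add:
  assumes "invertible_weight \<mu>" "invertible_weight \<nu>" shows "invertible_weight (\<mu> + \<nu>)"
proof -
  obtain ps qs where ps: "set ps \<subseteq> weight_space (- \<mu>) \<times> weight_space \<mu>" "(\<Sum>(x, y)\<leftarrow>ps. x \<star> y) = unit"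
    and qs: "set qs \<subseteq> weight_space (- \<nu>) \<times> weight_space \<nu>" "(\<Sum>(x, y)\<leftarrow>qs. x \<star> y) = unit"
    using assms by (auto simp: invertible_weight_def)
  let ?rs = "map (\<lambda>((x, y), (x', y')). (x' \<star> x, y \<star> y')) (List.product ps qs)"
  have "(x' \<star> x, y \<star> y') \<in> weight_space (- (\<mu> + \<nu>)) \<times> weight_space (\<mu> + \<nu>)"
    if "(x, y) \<in> set ps" "(x', y') \<in> set qs" for x y x' y'
    using that ps(1) qs(1) weight_space_conv[of x' "- \<nu>" x "- \<mu>"] weight_space_conv[of y \<mu> y' \<nu>]
    by (auto simp: algebra_simps)
  then have "set ?rs \<subseteq> weight_space (- (\<mu> + \<nu>)) \<times> weight_space (\<mu> + \<nu>)" by auto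
  moreover have "(\<Sum>(x, y)\<leftarrow>?rs. x \<star> y) = unit"
  proof -
    have "(\<Sum>(x, y)\<leftarrow>?rs. x \<star> y) = (\<Sum>p\<leftarrow>ps. \<Sum>p'\<leftarrow>qs. fst p' \<star> ((fst p \<star> snd p) \<star> snd p'))"
      by (simp only: map_map comp_def sum_list_product case_prod_unfold fst_conv snd_conv conv_assoc)
    also have "\<dots> = (\<Sum>p'\<leftarrow>qs. \<Sum>p\<leftarrow>ps. fst p' \<star> ((fst p \<star> snd p) \<star> snd p'))"
      by (rule sum_list_swap)
    also have "\<dots> = (\<Sum>p'\<leftarrow>qs. fst p' \<star> ((\<Sum>p\<leftarrow>ps. fst p \<star> snd p) \<star> snd p'))"
      by (simp only: conv_sum_list_left conv_sum_list_right)
    also have "\<dots> = unit"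
      using ps(2) qs(2) by (simp only: case_prod_unfold unit_conv)
    finally show ?thesis .
  qed
  ultimately show ?thesis unfolding invertible_weight_def by blast
qed

lemma invertible_index_wt:
  assumes "i \<in> {1..3}" shows "invertible_weight (index_wt i)"
proof -
  let ?ps = "map (\<lambda>m. (antip (u_coef q i m), u_coef q m i)) [1, 2, 3]"
  have "(\<Sum>(x, y)\<leftarrow>map (\<lambda>m. (u_coef q i m, u_coef q m i)) [1, 2, 3]. antip x \<star> y) = csc (u_coef q i i 0) unit"
    using assms by (intro antip_conv_coproduct u_coef_Uq_dual coproduct_rep_u_coef)
  then have "(\<Sum>(x, y)\<leftarrow>?ps. x \<star> y) = unit" by (simp add: u_coef_0)
  moreover have "antip (u_coef q i m) \<in> weight_space (- index_wt i)" "u_coef q m i \<in> weight_space (index_wt i)"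
    if "m \<in> {1..3}" for m
    using bihom_weight_space bihom_antip bihom_u_coef assms that by blast+
  then have "set ?ps \<subseteq> weight_space (- index_wt i) \<times> weight_space (index_wt i)" using index_mem by simp
  ultimately show ?thesis unfolding invertible_weight_def by blast
qed

lemma invertible_uminus_index_wt:
  assumes "i \<in> {1..3}" shows "invertible_weight (- index_wt i)"
proof -
  have "\<exists>j\<in>{1..3}. \<exists>k\<in>{1..3}. - index_wt i = index_wt j + index_wt k"
  proof -
    have "index_wt 1 n + index_wt 2 n + index_wt 3 n = 0" for n by (cases n) (simp_all add: index_wt_def)
    then have "index_wt 1 + index_wt 2 + index_wt 3 = 0" by (simp add: fun_eq_iff)
    then have "- index_wt 1 = index_wt 2 + index_wt 3" "- index_wt 2 = index_wt 1 + index_wt 3"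
      "- index_wt 3 = index_wt 1 + index_wt 2"
      by (rule_tac minus_unique, simp add: ac_simps)+
    moreover have "i = 1 \<or> i = 2 \<or> i = 3" using assms by auto
    ultimately show ?thesis using index_mem by metis
  qed
  then show ?thesis using invertible_weight_add invertible_index_wt by metis
qed

lemma invertible_wt: "invertible_weight (wt r)"
  using invertible_weight_add[OF invertible_index_wt invertible_uminus_index_wt, OF entry_mem]
  by (simp add: wt_eq_index_wt)

text \<open>Writing \<open>a = \<Sum> (a x\<^sub>k) y\<^sub>k\<close> with \<open>\<Sum> x\<^sub>k y\<^sub>k = 1\<close> puts \<open>a\<close> into \<open>B\<^sup>+ A\<close>.\<close>

lemma weight_space_BplusA:
  assumes "a \<in> weight_space \<mu>" "a 0 = 0" "invertible_weight \<mu>" shows "a \<in> BplusA q"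
proof -
  obtain ps where ps: "set ps \<subseteq> weight_space (- \<mu>) \<times> weight_space \<mu>" "(\<Sum>(x, y)\<leftarrow>ps. x \<star> y) = unit"
    using assms(3) by (auto simp: invertible_weight_def)
  have "a = a \<star> (\<Sum>(x, y)\<leftarrow>ps. x \<star> y)" by (simp only: ps conv_unit)
  also have "\<dots> = (\<Sum>(b, a)\<leftarrow>map (\<lambda>(x, y). (a \<star> x, y)) ps. b \<star> a)"
    by (simp only: conv_sum_list_right case_prod_unfold map_map comp_def fst_conv snd_conv conv_assoc)
  also have "\<dots> \<in> BplusA q"
  proof -
    have "a \<star> x \<in> OqF3_plus q" if "x \<in> weight_space (- \<mu>)" for x
      using weight_space_conv[OF assms(1) that] assms(2) by (simp add: OqF3_plus_def OqF3_eq counit_def conv_0)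
    then have "set (map (\<lambda>(x, y). (a \<star> x, y)) ps) \<subseteq> OqF3_plus q \<times> \<A>"
      using ps(1) weight_space_OqSU3 by fastforce
    then show ?thesis unfolding BplusA_def by blast
  qed
  finally show ?thesis .
qed

lemma otimes_tensor_of_matrix:
  "otimes a (tensor_of_matrix m) = (\<Sum>t\<in>UNIV. \<Sum>s\<in>UNIV. otimes (csc (m t s) a) (lett (unitvec t) * lett (unitvec s)))"
  by (simp only: tensor_of_matrix_def otimes_sum_right otimes_linear(3))

lemma otimes_set_expansion:
  assumes "T \<in> otimes_set \<A> (words_deg UNIV 2)"
  shows "T - (\<Sum>t\<in>UNIV. \<Sum>s\<in>UNIV. otimes (\<lambda>X. eval_otimes X (on_pairs (\<lambda>a b. a t * b s)) T)
      (lett (unitvec t) * lett (unitvec s))) \<in> otimes_set \<A> (V_ideal q)"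
proof -
  obtain ps where T: "T = (\<Sum>(a, x)\<leftarrow>ps. otimes a x)" and ps: "set ps \<subseteq> \<A> \<times> words_deg UNIV 2"
    using assms by (auto simp: otimes_set_def)
  have entries: "(\<lambda>X. eval_otimes X (on_pairs (\<lambda>a b. a t * b s)) T) =
      (\<Sum>(a, x)\<leftarrow>ps. csc (matrix_of_tensor x t s) a)" for t s
    by (simp add: T fun_eq_iff eval_otimes_sum_list eval_otimes_otimes matrix_of_tensor_def bilin_ext_def
        sum_list_fun_apply case_prod_unfold mult.commute)
  have "(\<Sum>t\<in>UNIV. \<Sum>s\<in>UNIV. otimes (\<Sum>(a, x)\<leftarrow>ps. csc (matrix_of_tensor x t s) a) (lett (unitvec t) * lett (unitvec s)))
      = (\<Sum>(a, x)\<leftarrow>ps. otimes a (tensor_of_matrix (matrix_of_tensor x)))"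
    by (induction ps)
      (simp_all only: list.map sum_list.Nil sum_list.Cons case_prod_unfold otimes_linear sum.neutral_const
        sum.distrib otimes_tensor_of_matrix)
  then have "T - (\<Sum>t\<in>UNIV. \<Sum>s\<in>UNIV. otimes (\<lambda>X. eval_otimes X (on_pairs (\<lambda>a b. a t * b s)) T)
      (lett (unitvec t) * lett (unitvec s))) = (\<Sum>(a, x)\<leftarrow>ps. otimes a (x - tensor_of_matrix (matrix_of_tensor x)))"
    unfolding entries by (simp add: T case_prod_unfold sum_list_subtractf otimes_linear(6))
  also have "\<dots> \<in> otimes_set \<A> (V_ideal q)"
    using ps tensor_of_matrix_of_tensor unfolding V_ideal_eq V.cong_def
    by (intro otimes_set_sum_list) (auto intro!: otimes_set_base)
  finally show ?thesis .
qed

lemma coinvariant_of_weight_0: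
  assumes x: "x \<in> words_deg UNIV 2" and weight: "weight_part 0 (matrix_of_tensor x) = matrix_of_tensor x"
  shows "coact (coact_cot q) x - otimes unit x \<in> coinvariance_kernel \<A> (BplusA q) UNIV (V_ideal q)"
proof -
  let ?e = "\<lambda>t s. lett (unitvec t) * lett (unitvec s)"
  let ?d = "\<lambda>t s. coact_cot_matrix x t s - csc (matrix_of_tensor x t s) unit"
  have "coact (coact_cot q) x \<in> otimes_set \<A> (words_deg UNIV 2)"
    using coact_cot_mem by (intro coact_words_deg_2[OF x]) simp_all
  from otimes_set_expansion[OF this]
  have "coact (coact_cot q) x - (\<Sum>t\<in>UNIV. \<Sum>s\<in>UNIV. otimes (coact_cot_matrix x t s) (?e t s))
      \<in> otimes_set \<A> (V_ideal q)"
    unfolding coact_cot_matrix_def .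
  moreover have "otimes unit (tensor_of_matrix (matrix_of_tensor x) - x) \<in> otimes_set \<A> (V_ideal q)"
    using V.cong_sym[OF tensor_of_matrix_of_tensor[OF x]] unfolding V_ideal_eq V.cong_def
    by (intro otimes_set_base) simp_all
  ultimately have "(coact (coact_cot q) x - (\<Sum>t\<in>UNIV. \<Sum>s\<in>UNIV. otimes (coact_cot_matrix x t s) (?e t s)))
      + otimes unit (tensor_of_matrix (matrix_of_tensor x) - x) \<in> otimes_set \<A> (V_ideal q)" (is "?t \<in> _")
    by (rule otimes_set_add)
  moreover have "(\<Sum>t\<in>UNIV. \<Sum>s\<in>UNIV. otimes (?d t s) (?e t s)) \<in> otimes_set (BplusA q) (words_on UNIV)"
  proof (intro otimes_set_sum otimes_set_base)
    fix t s
    show "?e t s \<in> words_on UNIV" by (simp add: words_on_def)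
    have "csc (matrix_of_tensor x t s) unit \<in> weight_space (wt t + wt s)"
    proof (cases "wt t + wt s = 0")
      case True
      then show ?thesis using OqF3_unit weight_space_csc by (simp add: OqF3_eq)
    next
      case False
      then have "matrix_of_tensor x t s = 0" using weight by (metis weight_part_def)
      then show ?thesis using weight_space_zero by simp
    qed
    then show "?d t s \<in> BplusA q"
      using coact_cot_matrix_weight[OF x] coact_cot_matrix_counit[OF x]
      by (intro weight_space_BplusA[of _ "wt t + wt s"] fn.subspace_diff subspace_weight_space
          invertible_weight_add invertible_wt) simp_all
  qed
  ultimately have "(\<Sum>t\<in>UNIV. \<Sum>s\<in>UNIV. otimes (?d t s) (?e t s)) + ?t
      \<in> coinvariance_kernel \<A> (BplusA q) UNIV (V_ideal q)" by (intro coinvariance_kernelI)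
  then show ?thesis
    by (simp add: otimes_linear(6,7) sum_subtractf otimes_tensor_of_matrix algebra_simps)
qed

lemma V_coinv_eq:
  "V_coinv q 2 = qspan (V_ideal q) (cls (V_ideal q) ` range (\<lambda>\<gamma>. lett (f_form \<gamma>) * lett (e_form \<gamma>)))"
proof -
  let ?b = "\<lambda>\<gamma>. lett (f_form \<gamma>) * lett (e_form \<gamma>)" and ?K = "coinvariance_kernel \<A> (BplusA q) UNIV (V_ideal q)"
  let ?comb = "\<lambda>c. \<Sum>\<gamma>\<in>UNIV. fscale (c \<gamma>) (?b \<gamma>)"
  have degree: "?comb c \<in> words_deg UNIV 2" for c
    by (intro flin.subspace_sum flin.subspace_scale subspace_words_deg words_deg_2_lett) simp_all
  have matrix: "matrix_of_tensor (?comb c) = (\<Sum>\<gamma>\<in>UNIV. mscale (c \<gamma>) (fe_matrix \<gamma>))" for c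
    by (simp only: matrix_of_tensor_sum matrix_of_tensor_linear matrix_of_tensor_fe)
  have normal_form: "\<exists>c. V.cong x (?comb c)"
    if x: "x \<in> words_deg UNIV 2" "coact (coact_cot q) x - otimes unit x \<in> ?K" for x
  proof -
    obtain c where "matrix_of_tensor x - (\<Sum>\<gamma>\<in>UNIV. mscale (c \<gamma>) (fe_matrix \<gamma>)) \<in> quad_rels"
      using quad_rels_normal_form[OF coinvariant_matrix_of_tensor[OF x]] by blast
    then have "x - (?comb c) \<in> V_ideal q"
      by (simp add: V_ideal_iff flin.subspace_diff subspace_words_deg x(1) degree matrix matrix_of_tensor_linear)
    then show ?thesis unfolding V_ideal_eq V.cong_def by blast
  qed
  have coinvariant: "coact (coact_cot q) (?comb c) - otimes unit (?comb c) \<in> ?K" for c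
  proof (rule coinvariant_of_weight_0[OF degree])
    show "weight_part 0 (matrix_of_tensor (?comb c)) = matrix_of_tensor (?comb c)"
      unfolding matrix by (simp only: weight_part_sum weight_part_linear weight_part_0_matrix_units)
  qed
  show ?thesis
    using V.coinvariants_eq_qspan[of 2 "coact_cot q" \<A> "BplusA q" ?b] normal_form degree coinvariant
    unfolding V_coinv_def V1_eq V_ideal_eq by blast
qed

end

section \<open>Two-forms\<close>

type_synonym form2 = "rvec \<Rightarrow> rvec \<Rightarrow> fnl"

definition scale_form2 :: "complex \<Rightarrow> form2 \<Rightarrow> form2"
  where "scale_form2 c m = (\<lambda>t s. csc c (m t s))"

lemma scale_form2_apply [simp]: "scale_form2 c m t s = csc c (m t s)"
  by (simp add: scale_form2_def)

global_interpretation form2: vector_space scale_form2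
  by standard (simp_all add: fun_eq_iff algebra_simps)

definition matrix_form :: "fnl \<Rightarrow> matrix \<Rightarrow> form2"
  where "matrix_form a m = (\<lambda>t s. csc (m t s) a)"

lemma matrix_form_apply [simp]: "matrix_form a m t s = csc (m t s) a"
  by (simp add: matrix_form_def)

lemma matrix_form_mscale: "matrix_form a (mscale c m) = scale_form2 c (matrix_form a m)"
  by (simp add: fun_eq_iff mult.assoc)

lemma matrix_form_sum: "matrix_form a (\<Sum>i\<in>A. f i) = (\<Sum>i\<in>A. matrix_form a (f i))"
  by (simp add: fun_eq_iff sum_distrib_right)

context quantum_parameter
begin

definition Forms2 :: "form2 set"
  where "Forms2 = {m. \<forall>t s. m t s \<in> weight_space (wt t + wt s)}"

lemma subspace_Forms2: "form2.subspace Forms2"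
  unfolding form2.subspace_def Forms2_def
  using fn.subspace_0[OF subspace_weight_space] fn.subspace_add[OF subspace_weight_space]
    fn.subspace_scale[OF subspace_weight_space]
  by (simp del: csc_apply)

lemma matrix_form_Forms2:
  assumes "a \<in> weight_space \<mu>" "weight_part \<mu> m = m" shows "matrix_form a m \<in> Forms2"
proof -
  have "csc (m t s) a \<in> weight_space (wt t + wt s)" for t s
  proof (cases "wt t + wt s = \<mu>")
    case True
    then show ?thesis using assms(1) weight_space_csc by simp
  next
    case False
    then have "m t s = 0" using assms(2) by (metis weight_part_def)
    then show ?thesis using weight_space_zero by simp
  qed
  then show ?thesis by (simp add: Forms2_def)
qed

text \<open>The map \<open>\<Omega>\<^sup>1 \<otimes>\<^sub>B \<Omega>\<^sup>1 \<rightarrow> A \<otimes> \<Lambda>\<^sup>1 \<otimes> \<Lambda>\<^sup>1\<close>,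
  \<open>(a \<otimes> r) \<otimes> (b \<otimes> s) \<mapsto> a b\<^sub>(\<^sub>1\<^sub>) \<otimes> r b\<^sub>(\<^sub>2\<^sub>) \<otimes> s\<close>, whose inverse is \<open>tensor_of_coeffs\<close> below.\<close>

definition coeffs_of_tensor :: "form1 free_alg \<Rightarrow> form2"
  where "coeffs_of_tensor x = (\<lambda>t s Y. bilin_ext (\<lambda>\<omega> \<eta>. right_mult \<omega> (\<eta> s) t Y) x)"

lemma coeffs_of_tensor_linear:
  "coeffs_of_tensor (x + y) = coeffs_of_tensor x + coeffs_of_tensor y"
  "coeffs_of_tensor (x - y) = coeffs_of_tensor x - coeffs_of_tensor y"
  "coeffs_of_tensor (fscale c x) = scale_form2 c (coeffs_of_tensor x)" "coeffs_of_tensor 0 = 0"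
  by (simp_all add: coeffs_of_tensor_def fun_eq_iff)

lemma coeffs_of_tensor_sum: "coeffs_of_tensor (\<Sum>i\<in>A. f i) = (\<Sum>i\<in>A. coeffs_of_tensor (f i))"
  by (simp add: coeffs_of_tensor_def fun_eq_iff bilin_ext_sum)

lemma coeffs_of_tensor_sum_list: "coeffs_of_tensor (\<Sum>i\<leftarrow>is. f i) = (\<Sum>i\<leftarrow>is. coeffs_of_tensor (f i))"
  by (simp add: coeffs_of_tensor_def fun_eq_iff bilin_ext_sum_list sum_list_fun_apply)

lemma coeffs_of_tensor_lett: "coeffs_of_tensor (lett \<omega> * lett \<eta>) = (\<lambda>t s. right_mult \<omega> (\<eta> s) t)"
  by (simp add: coeffs_of_tensor_def)

lemma coeffs_of_tensor_Forms2: "x \<in> words_deg Forms1 2 \<Longrightarrow> coeffs_of_tensor x \<in> Forms2"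
proof (induction rule: words_deg_2_induct)
  case zero
  show ?case using form2.subspace_0[OF subspace_Forms2] by (simp only: coeffs_of_tensor_linear)
next
  case (add c \<omega> \<eta> y)
  have "right_mult \<omega> (\<eta> s) t \<in> weight_space (wt t + (0 + wt s))" for t s
    using add by (intro right_mult_weight_space) (auto simp: Forms1_def)
  then have "coeffs_of_tensor (lett \<omega> * lett \<eta>) \<in> Forms2"
    by (simp only: Forms2_def coeffs_of_tensor_lett add_0_left mem_Collect_eq simp_thms)
  with add.IH show ?case
    unfolding coeffs_of_tensor_linear by (intro form2.subspace_add form2.subspace_scale subspace_Forms2)
qed

section \<open>The prolongation relations\<close>

lemma sum_conv_Xvec:
  assumes "(\<Sum>(b, c)\<leftarrow>ps. lmult b (diff q c)) = 0"
  shows "(\<Sum>(b, c)\<leftarrow>ps. b \<star> (Xvec q s \<triangleright> c)) = 0"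
proof -
  have "(\<Sum>(b, c)\<leftarrow>ps. b \<star> (Xvec q s \<triangleright> c)) = (\<Sum>(b, c)\<leftarrow>ps. lmult b (diff q c)) s"
    by (simp only: sum_list_fun_apply case_prod_unfold lmult_def diff_def)
  then show ?thesis unfolding assms by simp
qed

lemma sum_right_mult_diff:
  assumes "set ps \<subseteq> \<B> \<times> \<B>" "(\<Sum>(b, c)\<leftarrow>ps. lmult b (diff q c)) = 0"
  shows "(\<Sum>(b, c)\<leftarrow>ps. right_mult (diff q b) (Xvec q s \<triangleright> c) t) = - (\<Sum>(b, c)\<leftarrow>ps. b \<star> (Xvec q t \<triangleright> (Xvec q s \<triangleright> c)))"
proof -
  have "0 = Xvec q t \<triangleright> (\<Sum>(b, c)\<leftarrow>ps. b \<star> (Xvec q s \<triangleright> c))"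
    by (simp only: sum_conv_Xvec[OF assms(2)] act_linear)
  also have "\<dots> = (\<Sum>(b, c)\<leftarrow>ps. right_mult (diff q b) (Xvec q s \<triangleright> c) t + b \<star> (Xvec q t \<triangleright> (Xvec q s \<triangleright> c)))"
    unfolding act_sum_list case_prod_unfold
  proof (intro arg_cong[where f = sum_list] map_cong refl)
    fix p assume "p \<in> set ps"
    then have "fst p \<in> \<D>" "snd p \<in> \<D>" using assms(1) OqF3_OqSU3 by auto
    then show "Xvec q t \<triangleright> (fst p \<star> (Xvec q s \<triangleright> snd p)) =
        right_mult (diff q (fst p)) (Xvec q s \<triangleright> snd p) t + fst p \<star> (Xvec q t \<triangleright> (Xvec q s \<triangleright> snd p))"
      by (simp only: Xvec_conv act_Uq_dual right_mult_def diff_def)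
  qed
  also have "\<dots> = (\<Sum>(b, c)\<leftarrow>ps. right_mult (diff q b) (Xvec q s \<triangleright> c) t)
      + (\<Sum>(b, c)\<leftarrow>ps. b \<star> (Xvec q t \<triangleright> (Xvec q s \<triangleright> c)))"
    by (simp only: case_prod_unfold sum_list_addf)
  finally show ?thesis by (simp only: eq_neg_iff_add_eq_0)
qed

lemma sum_conv_act_eq_pair:
  assumes "set ps \<subseteq> \<B> \<times> \<B>"
  obtains y where "y \<in> \<B>" "\<forall>X. (a \<star> (\<Sum>(b, c)\<leftarrow>ps. b \<star> (X \<triangleright> c))) Y = (X \<triangleright> y) 0"
proof -
  have "\<exists>qs. coproduct_rep c qs \<and> set qs \<subseteq> \<A> \<times> \<B>" if "c \<in> \<B>" for c
    using weight_space_coproduct[of c 0] that by (simp add: OqF3_eq)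
  then obtain cop where cop: "coproduct_rep c (cop c)" "set (cop c) \<subseteq> \<A> \<times> \<B>" if "c \<in> \<B>" for c
    by metis
  define y where "y = (\<Sum>(b, c)\<leftarrow>ps. \<Sum>(x, z)\<leftarrow>cop c. csc ((a \<star> (b \<star> x)) Y) z)"
  have "y \<in> \<B>"
    using assms cop(2) unfolding y_def case_prod_unfold
    by (intro fn.subspace_sum_list fn.subspace_scale subspace_OqF3) fastforce
  moreover have "(a \<star> (\<Sum>(b, c)\<leftarrow>ps. b \<star> (X \<triangleright> c))) Y = (X \<triangleright> y) 0" for X
  proof -
    have "a \<star> (\<Sum>(b, c)\<leftarrow>ps. b \<star> (X \<triangleright> c)) = (\<Sum>(b, c)\<leftarrow>ps. \<Sum>(x, z)\<leftarrow>cop c. csc (pair X z) (a \<star> (b \<star> x)))"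
      unfolding conv_sum_list_right case_prod_unfold
    proof (intro arg_cong[where f = sum_list] map_cong refl)
      fix p assume "p \<in> set ps"
      then have "coproduct_rep (snd p) (cop (snd p))" using assms cop(1) by auto
      from coproduct_rep_act[OF this]
      show "a \<star> (fst p \<star> (X \<triangleright> snd p)) = (\<Sum>p'\<leftarrow>cop (snd p). csc (pair X (snd p')) (a \<star> (fst p \<star> fst p')))"
        by (simp only: conv_sum_list_right case_prod_unfold conv_csc_right)
    qed
    moreover have "(X \<triangleright> y) 0 = (\<Sum>(b, c)\<leftarrow>ps. \<Sum>(x, z)\<leftarrow>cop c. (a \<star> (b \<star> x)) Y * pair X z)"
      unfolding y_def act_sum_list case_prod_unfold
      by (simp only: sum_list_fun_apply act_sum_list act_linear csc_apply act_apply_0)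
    ultimately show ?thesis by (simp only: sum_list_fun_apply case_prod_unfold csc_apply mult.commute)
  qed
  ultimately show ?thesis using that by blast
qed

lemma prolongation_quad_rels:
  assumes "set ps \<subseteq> \<B> \<times> \<B>" "(\<Sum>(b, c)\<leftarrow>ps. lmult b (diff q c)) = 0"
  shows "(\<lambda>t s. (a \<star> (\<Sum>(b, c)\<leftarrow>ps. b \<star> (Xvec q t \<triangleright> (Xvec q s \<triangleright> c)))) Y) \<in> quad_rels"
proof -
  obtain y where y: "y \<in> \<B>" "\<forall>X. (a \<star> (\<Sum>(b, c)\<leftarrow>ps. b \<star> (X \<triangleright> c))) Y = (X \<triangleright> y) 0"
    by (rule sum_conv_act_eq_pair[OF assms(1)])
  define z where "z = y - csc (y 0) unit"
  have "(Xvec q r \<triangleright> y) 0 = 0" for r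
    unfolding y(2)[rule_format, symmetric] sum_conv_Xvec[OF assms(2)] by (simp add: conv_linear)
  then have z: "z \<in> cot_ideal q"
    using y(1) fn.subspace_diff[OF subspace_OqF3] fn.subspace_scale[OF subspace_OqF3] OqF3_unit
    by (simp add: z_def cot_ideal_iff Xvec_unit)
  have "quad_matrix z t s = (a \<star> (\<Sum>(b, c)\<leftarrow>ps. b \<star> (Xvec q t \<triangleright> (Xvec q s \<triangleright> c)))) Y" for t s
  proof -
    have "quad_matrix z t s = ((Xvec q t * Xvec q s) \<triangleright> y) 0"
      by (simp add: quad_matrix_def z_def act_mult Xvec_unit)
    then show ?thesis using y(2)[rule_format, of "Xvec q t * Xvec q s"] by (simp only: act_mult)
  qed
  then have "(\<lambda>t s. (a \<star> (\<Sum>(b, c)\<leftarrow>ps. b \<star> (Xvec q t \<triangleright> (Xvec q s \<triangleright> c)))) Y) = quad_matrix z" by (simp add: fun_eq_iff)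
  then show ?thesis using z unfolding quad_rels_def by (rule image_eqI)
qed

text \<open>If \<open>\<Sum> b dc = 0\<close>, then \<open>\<Sum> db \<otimes> (dc) y = \<Sum> db \<otimes> d(c y) - d(\<Sum> b c) \<otimes> dy\<close>.\<close>

definition prolongation_conv :: "(fnl \<times> fnl) list \<Rightarrow> fnl \<Rightarrow> (fnl \<times> fnl) list"
  where "prolongation_conv ps y = (- (\<Sum>(b, c)\<leftarrow>ps. b \<star> c), y) # map (\<lambda>(b, c). (b, c \<star> y)) ps"

lemma prolongation_conv_mem:
  assumes "set ps \<subseteq> \<B> \<times> \<B>" "y \<in> \<B>" shows "set (prolongation_conv ps y) \<subseteq> \<B> \<times> \<B>"
proof -
  have "(\<Sum>(b, c)\<leftarrow>ps. b \<star> c) \<in> \<B>"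
    using assms(1) OqF3_conv by (intro fn.subspace_sum_list subspace_OqF3) auto
  then show ?thesis
    using assms OqF3_conv fn.subspace_neg[OF subspace_OqF3] by (auto simp: prolongation_conv_def)
qed

lemma sum_lmult_prolongation_conv:
  assumes ps: "set ps \<subseteq> \<B> \<times> \<B>" "(\<Sum>(b, c)\<leftarrow>ps. lmult b (diff q c)) = 0" and y: "y \<in> \<B>"
  shows "(\<Sum>(b, c)\<leftarrow>prolongation_conv ps y. lmult b (diff q c)) = 0"
proof -
  have "b \<in> \<D>" "c \<in> \<D>" "y \<in> \<D>" if "(b, c) \<in> set ps" for b c
    using ps(1) y that OqF3_OqSU3 by auto
  then have "(\<Sum>(b, c)\<leftarrow>ps. lmult b (diff q (c \<star> y)))
      = (\<Sum>(b, c)\<leftarrow>ps. right_mult (lmult b (diff q c)) y + lmult (b \<star> c) (diff q y))"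
    by (intro arg_cong[where f = sum_list] map_cong)
      (auto simp: diff_conv right_mult_lmult lmult_linear simp flip: lmult_lmult)
  also have "\<dots> = right_mult (\<Sum>(b, c)\<leftarrow>ps. lmult b (diff q c)) y + lmult (\<Sum>(b, c)\<leftarrow>ps. b \<star> c) (diff q y)"
    by (simp only: case_prod_unfold sum_list_addf right_mult_sum_list_left lmult_sum_list_left)
  also have "\<dots> = lmult (\<Sum>(b, c)\<leftarrow>ps. b \<star> c) (diff q y)"
    unfolding ps(2) by (simp only: right_mult_linear add_0_left)
  finally show ?thesis
    by (simp only: prolongation_conv_def list.map sum_list.Cons map_map comp_def case_prod_unfold fst_conv snd_conv
        lmult_linear left_minus)
qed

lemma sum_right_mult_prolongation_conv:
  assumes ps: "set ps \<subseteq> \<B> \<times> \<B>" "(\<Sum>(b, c)\<leftarrow>ps. lmult b (diff q c)) = 0" and y: "y \<in> \<B>"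
  shows "(\<Sum>(b, c)\<leftarrow>prolongation_conv ps y. right_mult (diff q b) (Xvec q s \<triangleright> c) t)
    = (\<Sum>(b, c)\<leftarrow>ps. right_mult (diff q b) (right_mult (diff q c) y s) t)"
proof -
  have dual: "fst p \<in> \<D>" "snd p \<in> \<D>" "y \<in> \<D>" if "p \<in> set ps" for p
    using ps(1) y that OqF3_OqSU3 by auto
  have "(\<Sum>(b, c)\<leftarrow>ps. right_mult (diff q b) (Xvec q s \<triangleright> (c \<star> y)) t) =
      (\<Sum>(b, c)\<leftarrow>ps. right_mult (right_mult (diff q b) c) (Xvec q s \<triangleright> y) t
        + right_mult (diff q b) (right_mult (diff q c) y s) t)"
    unfolding case_prod_unfold
  proof (intro arg_cong[where f = sum_list] map_cong refl)
    fix p assume "p \<in> set ps"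
    note dual = dual[OF this]
    have "Xvec q s \<triangleright> (snd p \<star> y) = snd p \<star> (Xvec q s \<triangleright> y) + right_mult (diff q (snd p)) y s"
      using dual by (simp only: Xvec_conv right_mult_def diff_def add.commute)
    then show "right_mult (diff q (fst p)) (Xvec q s \<triangleright> (snd p \<star> y)) t =
        right_mult (right_mult (diff q (fst p)) (snd p)) (Xvec q s \<triangleright> y) t
          + right_mult (diff q (fst p)) (right_mult (diff q (snd p)) y s) t"
      using dual by (simp only: right_mult_linear plus_fun_apply right_mult_right_mult act_Uq_dual)
  qed
  moreover have "diff q (\<Sum>(b, c)\<leftarrow>ps. b \<star> c) = (\<Sum>(b, c)\<leftarrow>ps. right_mult (diff q b) c)"
  proof -
    have "diff q (\<Sum>(b, c)\<leftarrow>ps. b \<star> c) = (\<Sum>(b, c)\<leftarrow>ps. right_mult (diff q b) c + lmult b (diff q c))"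
      unfolding diff_sum_list using dual by (intro arg_cong[where f = sum_list] map_cong) (auto simp: diff_conv)
    then show ?thesis using ps(2) by (simp only: case_prod_unfold sum_list_addf add_0_right)
  qed
  ultimately show ?thesis
    by (simp only: prolongation_conv_def list.map sum_list.Cons map_map comp_def case_prod_unfold fst_conv snd_conv
        diff_uminus right_mult_linear right_mult_sum_list_left uminus_apply sum_list_fun_apply sum_list_addf
        minus_add_cancel)
qed

lemma coeffs_of_tensor_prolongation_rels:
  assumes "r \<in> prolongation_rels q" shows "(\<lambda>t s. coeffs_of_tensor r t s Y) \<in> quad_rels"
proof -
  from assms obtain ps x y where ps: "set ps \<subseteq> \<B> \<times> \<B>" "(\<Sum>(b, c)\<leftarrow>ps. lmult b (diff q c)) = 0"
    and x: "x \<in> \<B>" and y: "y \<in> \<B>"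
    and r: "r = (\<Sum>(b, c)\<leftarrow>ps. lett (lmult x (diff q b)) * lett (rmult q (diff q c) y))"
    unfolding prolongation_rels_def by blast
  let ?qs = "prolongation_conv ps y"
  note qs = prolongation_conv_mem[OF ps(1) y] sum_lmult_prolongation_conv[OF ps y]
  have "coeffs_of_tensor r t s = x \<star> (\<Sum>(b, c)\<leftarrow>ps. right_mult (diff q b) (right_mult (diff q c) y s) t)" for t s
    unfolding r conv_sum_list_right coeffs_of_tensor_sum_list case_prod_unfold coeffs_of_tensor_lett
      rmult_eq_right_mult[OF OqF3_OqSU3[OF y]] right_mult_lmult
    by (simp only: sum_list_fun_apply lmult_def)
  then have "coeffs_of_tensor r t s = - (x \<star> (\<Sum>(b, c)\<leftarrow>?qs. b \<star> (Xvec q t \<triangleright> (Xvec q s \<triangleright> c))))" for t s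
    unfolding sum_right_mult_prolongation_conv[OF ps y, symmetric] sum_right_mult_diff[OF qs]
    by (simp only: conv_uminus_right)
  then have "(\<lambda>t s. coeffs_of_tensor r t s Y) =
      - (\<lambda>t s. (x \<star> (\<Sum>(b, c)\<leftarrow>?qs. b \<star> (Xvec q t \<triangleright> (Xvec q s \<triangleright> c)))) Y)" by (simp add: fun_eq_iff)
  also have "\<dots> \<in> quad_rels" by (intro mat.subspace_neg subspace_quad_rels prolongation_quad_rels[OF qs])
  finally show ?thesis .
qed

abbreviation Omega_rels :: "form1 free_alg set"
  where "Omega_rels \<equiv> lin_rels (\<lambda>c \<omega> r. csc c (\<omega> r)) Forms1 \<union> (balance_rels q \<union> prolongation_rels q)"

sublocale O: tensor_ideal Forms1 Omega_rels "\<lambda>c \<omega> r. csc c (\<omega> r)"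
  by unfold_locales (auto intro: Forms1_zero Forms1_add)

lemma Omega_ideal_eq: "Omega_ideal q = ideal_gen Forms1 Omega_rels"
  by (simp only: Omega_ideal_def Omega1_eq Un_assoc)

lemma balance_rels_words_deg: "r \<in> balance_rels q \<Longrightarrow> r \<in> words_deg Forms1 2"
  using Forms1_right_mult Forms1_lmult rmult_eq_right_mult[OF OqF3_OqSU3]
  by (auto simp: balance_rels_def Omega1_eq intro!: flin.subspace_diff[OF subspace_words_deg] words_deg_2_lett)

lemma prolongation_rels_words_deg:
  assumes "r \<in> prolongation_rels q" shows "r \<in> words_deg Forms1 2"
proof -
  from assms obtain ps x y where ps: "set ps \<subseteq> \<B> \<times> \<B>" and x: "x \<in> \<B>" and y: "y \<in> \<B>"
    and r: "r = (\<Sum>(b, c)\<leftarrow>ps. lett (lmult x (diff q b)) * lett (rmult q (diff q c) y))"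
    unfolding prolongation_rels_def by blast
  have "lett (lmult x (diff q b)) * lett (right_mult (diff q c) y) \<in> words_deg Forms1 2"
    if "(b, c) \<in> set ps" for b c
    using that ps x y by (intro words_deg_2_lett Forms1_lmult Forms1_right_mult Forms1_diff) auto
  then show ?thesis
    unfolding r rmult_eq_right_mult[OF OqF3_OqSU3[OF y]]
    by (intro flin.subspace_sum_list subspace_words_deg) auto
qed

lemma coeffs_of_tensor_balance_rels:
  assumes "r \<in> balance_rels q" shows "coeffs_of_tensor r = 0"
proof -
  from assms obtain \<omega> b \<eta> where "\<omega> \<in> Forms1" "b \<in> \<B>" "\<eta> \<in> Forms1"
    and r: "r = lett (rmult q \<omega> b) * lett \<eta> - lett \<omega> * lett (lmult b \<eta>)"
    by (auto simp: balance_rels_def Omega1_eq)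
  then show ?thesis
    using OqF3_OqSU3 Forms1_Uq_dual
    by (simp add: fun_eq_iff coeffs_of_tensor_linear coeffs_of_tensor_lett rmult_eq_right_mult
        right_mult_right_mult lmult_def)
qed

lemma coeffs_of_tensor_Omega_ideal:
  assumes "x \<in> Omega_ideal q" shows "(\<lambda>t s. coeffs_of_tensor x t s Y) \<in> quad_rels"
  unfolding coeffs_of_tensor_def
proof (rule bilin_ext_ideal_gen[OF subspace_quad_rels])
  show "bilinear_form (\<lambda>c \<omega> r. csc c (\<omega> r)) (\<lambda>\<omega> \<eta>. right_mult \<omega> (\<eta> s) t Y)" for t s
    by (simp add: bilinear_form_def right_mult_linear)
  show "x \<in> ideal_gen Forms1 Omega_rels" using assms by (simp only: Omega_ideal_eq)
  fix r assume r: "r \<in> balance_rels q \<union> prolongation_rels q"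
  then show "r \<in> words_deg Forms1 2"
    using balance_rels_words_deg prolongation_rels_words_deg by blast
  have zero: "(\<lambda>t s. 0) \<in> quad_rels"
    using mat.subspace_0[OF subspace_quad_rels] by (simp add: zero_fun_def)
  have "(\<lambda>t s. coeffs_of_tensor r t s Y) \<in> quad_rels"
    using r coeffs_of_tensor_prolongation_rels coeffs_of_tensor_balance_rels zero by fastforce
  then show "(\<lambda>t s. bilin_ext (\<lambda>\<omega> \<eta>. right_mult \<omega> (\<eta> s) t Y) r) \<in> quad_rels"
    by (simp add: coeffs_of_tensor_def)
qed

definition tensor_of_coeffs :: "form2 \<Rightarrow> form1 free_alg"
  where "tensor_of_coeffs m = (\<Sum>s\<leftarrow>all_rvecs. \<Sum>p\<leftarrow>dual_coproduct s.
    lett (right_mult (\<lambda>t. m t s) (antip (fst p))) * lett (diff q (snd p)))"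

lemma tensor_of_coeffs_letters:
  assumes "m \<in> Forms2" "p \<in> set (dual_coproduct s)"
  shows "right_mult (\<lambda>t. m t s) (antip (fst p)) \<in> Forms1" "diff q (snd p) \<in> Forms1"
proof -
  have "antip (fst p) \<in> weight_space (- wt s)" "snd p \<in> \<B>"
    using dual_coproduct_mem[of "fst p" "snd p" s] assms(2) by simp_all
  then show "right_mult (\<lambda>t. m t s) (antip (fst p)) \<in> Forms1" "diff q (snd p) \<in> Forms1"
    using right_mult_weight_space[of "\<lambda>t. m t s" "wt s" "antip (fst p)" "- wt s"] assms(1) Forms1_diff
    by (simp_all add: Forms1_def Forms2_def)
qed

lemma tensor_of_coeffs_words_deg: "m \<in> Forms2 \<Longrightarrow> tensor_of_coeffs m \<in> words_deg Forms1 2"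
  unfolding tensor_of_coeffs_def
  by (intro flin.subspace_sum_list subspace_words_deg words_deg_2_lett tensor_of_coeffs_letters)

lemma tensor_of_coeffs_add:
  assumes "m \<in> Forms2" "n \<in> Forms2"
  shows "O.cong (tensor_of_coeffs (m + n)) (tensor_of_coeffs m + tensor_of_coeffs n)"
  unfolding tensor_of_coeffs_def sum_list_addf[symmetric]
proof (intro O.cong_sum_list)
  fix s p assume p: "p \<in> set (dual_coproduct s)"
  let ?left = "\<lambda>m :: form2. right_mult (\<lambda>t. m t s) (antip (fst p))" and ?right = "lett (diff q (snd p))"
  have "(\<lambda>t. (m + n) t s) = (\<lambda>t. m t s) + (\<lambda>t. n t s)" by (rule ext) simp
  then have "?left (m + n) = ?left m + ?left n" by (simp only: right_mult_linear)
  then have "O.cong (lett (?left (m + n)) * ?right) ((lett (?left m) + lett (?left n)) * ?right)"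
    using O.cong_lett_add tensor_of_coeffs_letters[OF assms(1) p] tensor_of_coeffs_letters[OF assms(2) p]
    by (intro O.cong_lett_right) (simp_all only:)
  then show "O.cong (lett (?left (m + n)) * ?right) (lett (?left m) * ?right + lett (?left n) * ?right)"
    by (simp only: distrib_right)
qed

lemma tensor_of_coeffs_scale:
  assumes "m \<in> Forms2"
  shows "O.cong (tensor_of_coeffs (scale_form2 c m)) (fscale c (tensor_of_coeffs m))"
proof -
  have "O.cong (tensor_of_coeffs (scale_form2 c m)) (\<Sum>s\<leftarrow>all_rvecs. \<Sum>p\<leftarrow>dual_coproduct s.
      fscale c (lett (right_mult (\<lambda>t. m t s) (antip (fst p))) * lett (diff q (snd p))))"
    unfolding tensor_of_coeffs_def
  proof (intro O.cong_sum_list)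
    fix s p assume p: "p \<in> set (dual_coproduct s)"
    let ?left = "\<lambda>m :: form2. right_mult (\<lambda>t. m t s) (antip (fst p))" and ?right = "lett (diff q (snd p))"
    have "?left (scale_form2 c m) = (\<lambda>r. csc c (?left m r))" by (simp only: scale_form2_def right_mult_linear)
    then have "O.cong (lett (?left (scale_form2 c m)) * ?right) (fscale c (lett (?left m)) * ?right)"
      using O.cong_lett_scale tensor_of_coeffs_letters[OF assms p]
      by (intro O.cong_lett_right) (simp_all only:)
    then show "O.cong (lett (?left (scale_form2 c m)) * ?right) (fscale c (lett (?left m) * ?right))"
      by (simp only: fscale_mult_left)
  qed
  then show ?thesis by (simp add: tensor_of_coeffs_def flin.scale_sum_list)
qed

lemma tensor_of_coeffs_zero: "O.cong (tensor_of_coeffs 0) 0"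
  using tensor_of_coeffs_scale[OF form2.subspace_0[OF subspace_Forms2], of 0]
  by (simp only: form2.scale_zero_left flin.scale_zero_left)

lemma tensor_of_coeffs_sum:
  assumes "\<And>i. i \<in> A \<Longrightarrow> f i \<in> Forms2" "\<And>i. i \<in> A \<Longrightarrow> tensor_of_coeffs (f i) \<in> O.J"
  shows "tensor_of_coeffs (\<Sum>i\<in>A. f i) \<in> O.J"
  using assms
proof (induction A rule: infinite_finite_induct)
  case (insert i A)
  have "(\<Sum>i\<in>A. f i) \<in> Forms2" using insert.prems(1) by (intro form2.subspace_sum subspace_Forms2) simp
  then have "O.cong (tensor_of_coeffs (f i + (\<Sum>i\<in>A. f i))) (tensor_of_coeffs (f i) + tensor_of_coeffs (\<Sum>i\<in>A. f i))"
    using insert.prems(1) by (intro tensor_of_coeffs_add) simp_all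
  moreover have "tensor_of_coeffs (f i) + tensor_of_coeffs (\<Sum>i\<in>A. f i) \<in> O.J"
    by (intro O.J_add insert.IH insert.prems) simp_all
  ultimately show ?case unfolding sum.insert[OF insert.hyps] using O.cong_mem by blast
qed (simp_all only: sum.infinite sum.empty not_False_eq_True O.cong_mem[OF tensor_of_coeffs_zero] O.J_zero)

lemma lett_dual_expansion:
  assumes "\<eta> \<in> Forms1"
  shows "O.cong (lett \<eta>) (\<Sum>s\<leftarrow>all_rvecs. \<Sum>p\<leftarrow>dual_coproduct s. lett (lmult (\<eta> s \<star> antip (fst p)) (diff q (snd p))))"
proof -
  let ?term = "\<lambda>s p. lmult (\<eta> s \<star> antip (fst p)) (diff q (snd p))"
  have mem: "?term s p \<in> Forms1" if "p \<in> set (dual_coproduct s)" for s p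
  proof -
    have p: "(fst p, snd p) \<in> set (dual_coproduct s)" using that by simp
    have "\<eta> s \<in> weight_space (wt s)" using assms by (simp add: Forms1_def)
    then show ?thesis
      by (intro Forms1_lmult Forms1_diff weight_space_antip_OqF3[OF _ p] dual_coproduct_mem(3)[OF p])
  qed
  have "O.cong (lett (\<Sum>s\<leftarrow>all_rvecs. \<Sum>p\<leftarrow>dual_coproduct s. ?term s p))
      (\<Sum>s\<leftarrow>all_rvecs. lett (\<Sum>p\<leftarrow>dual_coproduct s. ?term s p))"
    using mem by (intro O.cong_lett_sum_list sum_list_mem[OF Forms1_zero Forms1_add])
  also have "O.cong \<dots> (\<Sum>s\<leftarrow>all_rvecs. \<Sum>p\<leftarrow>dual_coproduct s. lett (?term s p))"
    using mem by (intro O.cong_sum_list O.cong_lett_sum_list)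
  finally show ?thesis using form1_expansion[of \<eta>] by (simp only: case_prod_unfold)
qed

lemma lett_balance:
  assumes "\<omega> \<in> Forms1" "\<eta> \<in> Forms1" "b \<in> \<B>"
  shows "O.cong (lett \<omega> * lett (lmult b \<eta>)) (lett (right_mult \<omega> b) * lett \<eta>)"
proof -
  have "lett (rmult q \<omega> b) * lett \<eta> - lett \<omega> * lett (lmult b \<eta>) \<in> balance_rels q"
    using assms by (auto simp: balance_rels_def Omega1_eq)
  then have "lett (rmult q \<omega> b) * lett \<eta> - lett \<omega> * lett (lmult b \<eta>) \<in> O.J"
    by (intro O.J_base) simp
  then show ?thesis
    unfolding rmult_eq_right_mult[OF OqF3_OqSU3[OF assms(3)]] O.cong_def[symmetric] by (rule O.cong_sym)
qed

lemma lett_lett_cong: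
  assumes "\<omega> \<in> Forms1" "\<eta> \<in> Forms1"
  shows "O.cong (lett \<omega> * lett \<eta>) (tensor_of_coeffs (coeffs_of_tensor (lett \<omega> * lett \<eta>)))"
proof -
  let ?term = "\<lambda>s p. lmult (\<eta> s \<star> antip (fst p)) (diff q (snd p))"
  have "O.cong (lett \<omega> * lett \<eta>) (lett \<omega> * (\<Sum>s\<leftarrow>all_rvecs. \<Sum>p\<leftarrow>dual_coproduct s. lett (?term s p)))"
    by (intro O.cong_lett_left lett_dual_expansion assms)
  also have "\<dots> = (\<Sum>s\<leftarrow>all_rvecs. \<Sum>p\<leftarrow>dual_coproduct s. lett \<omega> * lett (?term s p))"
    by (simp only: sum_list_const_mult[symmetric])
  also have "O.cong \<dots> (tensor_of_coeffs (coeffs_of_tensor (lett \<omega> * lett \<eta>)))"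
    unfolding tensor_of_coeffs_def coeffs_of_tensor_lett
  proof (intro O.cong_sum_list)
    fix s p assume "p \<in> set (dual_coproduct s)"
    then have p: "(fst p, snd p) \<in> set (dual_coproduct s)" by simp
    have "\<eta> s \<star> antip (fst p) \<in> \<B>"
      using assms(2) by (intro weight_space_antip_OqF3[OF _ p]) (simp add: Forms1_def)
    then have "O.cong (lett \<omega> * lett (?term s p)) (lett (right_mult \<omega> (\<eta> s \<star> antip (fst p))) * lett (diff q (snd p)))"
      by (intro lett_balance Forms1_diff dual_coproduct_mem(3)[OF p] assms(1))
    then show "O.cong (lett \<omega> * lett (?term s p))
        (lett (right_mult (\<lambda>t. right_mult \<omega> (\<eta> s) t) (antip (fst p))) * lett (diff q (snd p)))"
      using Forms1_Uq_dual[OF assms(2)] dual_coproduct_mem(1)[OF p] by (simp add: right_mult_right_mult)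
  qed
  finally show ?thesis .
qed

lemma tensor_of_coeffs_of_tensor:
  "x \<in> words_deg Forms1 2 \<Longrightarrow> O.cong x (tensor_of_coeffs (coeffs_of_tensor x))"
proof (induction rule: words_deg_2_induct)
  case zero
  show ?case using O.cong_sym[OF tensor_of_coeffs_zero] by (simp only: coeffs_of_tensor_linear)
next
  case (add c \<omega> \<eta> y)
  let ?m = "coeffs_of_tensor (lett \<omega> * lett \<eta>)" and ?n = "coeffs_of_tensor y"
  have mem: "?m \<in> Forms2" "?n \<in> Forms2" using add by (auto intro!: coeffs_of_tensor_Forms2 words_deg_2_lett)
  have "O.cong (fscale c (lett \<omega> * lett \<eta>) + y) (fscale c (tensor_of_coeffs ?m) + tensor_of_coeffs ?n)"
    using add by (intro O.cong_add O.cong_scale lett_lett_cong)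
  also have "O.cong \<dots> (tensor_of_coeffs (scale_form2 c ?m) + tensor_of_coeffs ?n)"
    by (intro O.cong_add O.cong_refl O.cong_sym[OF tensor_of_coeffs_scale] mem)
  also have "O.cong \<dots> (tensor_of_coeffs (scale_form2 c ?m + ?n))"
    by (intro O.cong_sym[OF tensor_of_coeffs_add] form2.subspace_scale subspace_Forms2 mem)
  finally show ?case by (simp only: coeffs_of_tensor_linear)
qed

lemma coeffs_of_tensor_of_coeffs: "coeffs_of_tensor (tensor_of_coeffs m) = m"
proof (intro ext)
  fix t s Y
  have summand: "(\<Sum>p\<leftarrow>dual_coproduct s'. right_mult (right_mult (\<lambda>t. m t s') (antip (fst p))) (Xvec q s \<triangleright> snd p) t)
      = (if s' = s then m t s' else 0)" for s'
  proof -
    have "(\<Sum>p\<leftarrow>dual_coproduct s'. right_mult (right_mult (\<lambda>t. m t s') (antip (fst p))) (Xvec q s \<triangleright> snd p) t)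
       = (\<Sum>p\<leftarrow>dual_coproduct s'. right_mult (\<lambda>t. m t s') (unit \<star> antip (fst p) \<star> (Xvec q s \<triangleright> snd p)) t)"
    proof (intro arg_cong[where f = sum_list] map_cong refl)
      fix p assume "p \<in> set (dual_coproduct s')"
      then have "(fst p, snd p) \<in> set (dual_coproduct s')" by simp
      then have "fst p \<in> \<A>" "snd p \<in> \<A>" using dual_coproduct_mem OqF3_OqSU3 by blast+
      then show "right_mult (right_mult (\<lambda>t. m t s') (antip (fst p))) (Xvec q s \<triangleright> snd p) t
          = right_mult (\<lambda>t. m t s') (unit \<star> antip (fst p) \<star> (Xvec q s \<triangleright> snd p)) t"
        by (simp add: right_mult_right_mult)
    qed
    also have "\<dots> = right_mult (\<lambda>t. m t s') (if s' = s then unit else 0) t"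
      unfolding dual_coproduct_antipode[symmetric]
      by (simp only: right_mult_sum_list_right sum_list_fun_apply case_prod_unfold)
    finally show ?thesis by (simp add: right_mult_linear)
  qed
  have "coeffs_of_tensor (tensor_of_coeffs m) t s =
      (\<Sum>s'\<leftarrow>all_rvecs. \<Sum>p\<leftarrow>dual_coproduct s'.
        right_mult (right_mult (\<lambda>t. m t s') (antip (fst p))) (Xvec q s \<triangleright> snd p) t)"
    unfolding tensor_of_coeffs_def coeffs_of_tensor_sum_list coeffs_of_tensor_lett sum_list_fun_apply diff_def ..
  also have "\<dots> = (\<Sum>s'\<in>UNIV. if s' = s then m t s' else 0)" by (simp only: summand sum_all_rvecs)
  finally show "coeffs_of_tensor (tensor_of_coeffs m) t s Y = m t s Y" by simp
qed

text \<open>The prolongation relation obtained from \<open>\<Sum> a S(z\<^sub>(\<^sub>1\<^sub>)) d z\<^sub>(\<^sub>2\<^sub>) = 0\<close>.\<close>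

lemma cot_ideal_prolongation:
  assumes a: "a \<in> weight_space \<mu>" and z: "z \<in> cot_ideal q" "bihom \<mu> 0 z"
  obtains r where "r \<in> prolongation_rels q" "coeffs_of_tensor r = scale_form2 (-1) (matrix_form a (quad_matrix z))"
proof -
  obtain ps where ps: "coproduct_rep z ps" "set ps \<subseteq> bihom_pairs \<mu> 0" using bihom_coproduct[OF z(2)] by blast
  define qs where "qs = map (\<lambda>(x, y). (a \<star> antip x, y)) ps"
  have "a \<star> antip x \<in> \<B> \<and> y \<in> \<B>" if xy: "(x, y) \<in> set ps" for x y
  proof -
    from xy ps(2) obtain \<kappa> where bihom: "bihom \<mu> \<kappa> x" "bihom \<kappa> 0 y" by (auto simp: bihom_pairs_def)
    have "a \<star> antip x \<in> weight_space (\<mu> + (- \<mu>))"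
      by (intro weight_space_conv a bihom_weight_space[OF bihom_antip[OF bihom(1)]])
    then show ?thesis using bihom_weight_space[OF bihom(2)] by (simp add: OqF3_eq)
  qed
  then have qs: "set qs \<subseteq> \<B> \<times> \<B>" unfolding qs_def by auto
  have pairing: "(\<Sum>(b, c)\<leftarrow>qs. b \<star> (X \<triangleright> c)) = csc (pair X z) a" for X
    using sum_conv_antip_act[OF bihom_Uq_dual[OF z(2)] ps(1), of a X] unfolding qs_def
    by (simp only: case_prod_unfold map_map comp_def fst_conv snd_conv)
  have zero: "(\<Sum>(b, c)\<leftarrow>qs. lmult b (diff q c)) = 0"
  proof
    fix r
    have "(\<Sum>(b, c)\<leftarrow>qs. lmult b (diff q c)) r = (\<Sum>(b, c)\<leftarrow>qs. b \<star> (Xvec q r \<triangleright> c))"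
      by (simp only: sum_list_fun_apply case_prod_unfold lmult_def diff_def)
    then show "(\<Sum>(b, c)\<leftarrow>qs. lmult b (diff q c)) r = 0 r"
      using z(1) unfolding pairing by (simp add: cot_ideal_iff act_apply_0)
  qed
  define r where "r = (\<Sum>(b, c)\<leftarrow>qs. lett (lmult unit (diff q b)) * lett (rmult q (diff q c) unit))"
  have "r \<in> prolongation_rels q"
    unfolding prolongation_rels_def r_def using qs zero OqF3_unit by blast
  moreover have "coeffs_of_tensor r t s = - csc (quad_matrix z t s) a" for t s
  proof -
    have "coeffs_of_tensor r t s = (\<Sum>(b, c)\<leftarrow>qs. right_mult (diff q b) (Xvec q s \<triangleright> c) t)"
      unfolding r_def coeffs_of_tensor_sum_list case_prod_unfold coeffs_of_tensor_lett lmult_unit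
        rmult_eq_right_mult[OF OqSU3_unit] right_mult_unit
      by (simp only: sum_list_fun_apply diff_def[of q "snd _"])
    also have "\<dots> = - csc (quad_matrix z t s) a"
      using sum_right_mult_diff[OF qs zero] pairing[of "Xvec q t * Xvec q s"]
      by (simp only: act_mult quad_matrix_def act_apply_0[symmetric])
    finally show ?thesis .
  qed
  ultimately show ?thesis using that by (simp add: fun_eq_iff)
qed

lemma tensor_of_coeffs_cot_ideal:
  assumes "a \<in> weight_space \<mu>" "z \<in> cot_ideal q" "bihom \<mu> 0 z"
  shows "tensor_of_coeffs (matrix_form a (quad_matrix z)) \<in> O.J"
proof -
  let ?m = "matrix_form a (quad_matrix z)"
  obtain r where r: "r \<in> prolongation_rels q" "coeffs_of_tensor r = scale_form2 (-1) ?m"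
    by (rule cot_ideal_prolongation[OF assms])
  have m: "?m \<in> Forms2" by (intro matrix_form_Forms2[OF assms(1)] quad_matrix_bihom assms(3))
  have "O.cong r (tensor_of_coeffs (scale_form2 (-1) ?m))"
    using tensor_of_coeffs_of_tensor[OF prolongation_rels_words_deg[OF r(1)]] by (simp only: r(2))
  also have "O.cong \<dots> (fscale (-1) (tensor_of_coeffs ?m))" by (rule tensor_of_coeffs_scale[OF m])
  finally have "fscale (-1) (tensor_of_coeffs ?m) \<in> O.J" using O.J_base r(1) O.cong_mem by blast
  from O.J_scale[OF this, of "-1"] show ?thesis by simp
qed

lemma tensor_of_coeffs_quad_rels:
  assumes m: "m \<in> Forms2" "\<And>Y. (\<lambda>t s. m t s Y) \<in> quad_rels"
  shows "tensor_of_coeffs m \<in> O.J"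
proof -
  obtain P where P: "\<forall>t s. P t s \<in> quad_rels \<and> weight_part (wt t + wt s) (P t s) = P t s"
    and expand: "\<forall>v\<in>quad_rels. v = (\<Sum>t\<in>UNIV. \<Sum>s\<in>UNIV. mscale (v t s) (P t s))"
    by (rule quad_rels_graded_projection)
  have m_eq: "m = (\<Sum>t\<in>UNIV. \<Sum>s\<in>UNIV. matrix_form (m t s) (P t s))"
  proof (intro ext)
    fix t s Y
    have "m t s Y = (\<Sum>t'\<in>UNIV. \<Sum>s'\<in>UNIV. mscale (m t' s' Y) (P t' s')) t s"
      by (rule fun_cong[OF fun_cong[OF bspec[OF expand m(2)[of Y]]]])
    also have "\<dots> = (\<Sum>t'\<in>UNIV. \<Sum>s'\<in>UNIV. matrix_form (m t' s') (P t' s')) t s Y" by (simp add: mult.commute)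
    finally show "m t s Y = (\<Sum>t'\<in>UNIV. \<Sum>s'\<in>UNIV. matrix_form (m t' s') (P t' s')) t s Y" .
  qed
  have weight: "m t s \<in> weight_space (wt t + wt s)" for t s using m(1) by (simp add: Forms2_def)
  have mem: "matrix_form (m t s) (P t s) \<in> Forms2" for t s
    using P by (intro matrix_form_Forms2[OF weight]) simp
  have "tensor_of_coeffs (matrix_form (m t s) (P t s)) \<in> O.J" for t s
  proof -
    obtain y where y: "y \<in> cot_ideal q" "P t s = quad_matrix y" using P by (auto simp: quad_rels_def)
    obtain z where z: "z \<in> cot_ideal q" "bihom (wt t + wt s) 0 z"
        "quad_matrix z = weight_part (wt t + wt s) (quad_matrix y)"
      by (rule cot_ideal_weight_part[OF y(1)])
    have "P t s = weight_part (wt t + wt s) (P t s)" using P by simp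
    then have "P t s = quad_matrix z" by (simp only: y(2) z(3))
    then show ?thesis using tensor_of_coeffs_cot_ideal[OF weight[of t s] z(1,2)] by (simp only:)
  qed
  then have "tensor_of_coeffs (\<Sum>t\<in>UNIV. \<Sum>s\<in>UNIV. matrix_form (m t s) (P t s)) \<in> O.J"
    by (intro tensor_of_coeffs_sum form2.subspace_sum subspace_Forms2 mem)
  then show ?thesis unfolding m_eq[symmetric] .
qed

lemma Omega_ideal_iff:
  assumes "x \<in> words_deg Forms1 2"
  shows "x \<in> Omega_ideal q \<longleftrightarrow> (\<forall>Y. (\<lambda>t s. coeffs_of_tensor x t s Y) \<in> quad_rels)"
  using coeffs_of_tensor_Omega_ideal tensor_of_coeffs_quad_rels[OF coeffs_of_tensor_Forms2[OF assms]]
    O.cong_mem[OF tensor_of_coeffs_of_tensor[OF assms]]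
  unfolding Omega_ideal_eq by blast

section \<open>Coinvariant two-forms\<close>

lemma exists_coact_form:
  assumes "\<omega> \<in> Forms1"
  shows "\<exists>ps. set ps \<subseteq> \<A> \<times> Forms1 \<and> (\<forall>X Y r. \<omega> r (X + Y) = (\<Sum>(a, \<eta>)\<leftarrow>ps. a X * \<eta> r Y))"
proof -
  have "\<exists>ps. coproduct_rep (\<omega> r) ps \<and> set ps \<subseteq> \<A> \<times> weight_space (wt r)" for r
    using assms by (intro weight_space_coproduct) (simp add: Forms1_def)
  then obtain cop where cop: "coproduct_rep (\<omega> r) (cop r)" "set (cop r) \<subseteq> \<A> \<times> weight_space (wt r)" for r
    by metis
  let ?ps = "concat (map (\<lambda>r. map (\<lambda>(a, b). (a, \<lambda>s. if s = r then b else 0)) (cop r)) all_rvecs)"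
  have "(a, \<lambda>s. if s = r then b else 0) \<in> \<A> \<times> Forms1" if "(a, b) \<in> set (cop r)" for a b r
    using that cop(2) weight_space_zero by (fastforce simp: Forms1_def)
  then have "set ?ps \<subseteq> \<A> \<times> Forms1" by auto
  moreover have "\<omega> r (X + Y) = (\<Sum>(a, \<eta>)\<leftarrow>?ps. a X * \<eta> r Y)" for X Y r
  proof -
    have "(\<Sum>(a, \<eta>)\<leftarrow>?ps. a X * \<eta> r Y) = (\<Sum>r'\<in>UNIV. \<Sum>p\<leftarrow>cop r'. fst p X * (if r = r' then snd p else 0) Y)"
      unfolding sum_list_concat_map sum_all_rvecs by (simp only: case_prod_unfold map_map comp_def fst_conv snd_conv)
    also have "\<dots> = (\<Sum>r'\<in>UNIV. if r' = r then (\<Sum>p\<leftarrow>cop r. fst p X * snd p Y) else 0)"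
      by (intro sum.cong refl) auto
    also have "\<dots> = \<omega> r (X + Y)" using coproduct_repD[OF cop(1)] by (simp add: case_prod_unfold)
    finally show ?thesis ..
  qed
  ultimately show ?thesis by blast
qed

lemma coact_form:
  assumes "\<omega> \<in> Forms1"
  shows "set (coact_form q \<omega>) \<subseteq> \<A> \<times> Forms1"
    and "coproduct_rep (\<omega> r) (map (\<lambda>(a, \<eta>). (a, \<eta> r)) (coact_form q \<omega>))"
  using someI_ex[OF exists_coact_form[OF assms]] unfolding coact_form_def[symmetric] Omega1_eq[symmetric]
  by (simp_all add: coproduct_rep_def comp_def case_prod_unfold)

lemma right_mult_coact:
  assumes "\<omega> \<in> Forms1" "\<eta> \<in> Forms1"
  shows "(\<Sum>(a, \<omega>')\<leftarrow>coact_form q \<omega>. \<Sum>(b, \<eta>')\<leftarrow>coact_form q \<eta>. (a \<star> b) X * right_mult \<omega>' (\<eta>' s) t Y)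
    = right_mult \<omega> (\<eta> s) t (X + Y)"
proof -
  let ?ps = "coact_form q \<omega>" and ?qs = "coact_form q \<eta>"
  have "(\<omega> r \<star> (Gvec q r t \<triangleright> \<eta> s)) (X + Y) =
      (\<Sum>p\<leftarrow>?ps. \<Sum>p'\<leftarrow>?qs. (fst p \<star> fst p') X * (snd p r \<star> (Gvec q r t \<triangleright> snd p' s)) Y)" for r
    using coproduct_repD[OF coproduct_rep_conv[OF coact_form(2)[OF assms(1), of r]
          coproduct_rep_act_right[OF coact_form(2)[OF assms(2), of s], of "Gvec q r t"]], of X Y]
    by (simp add: sum_list_product comp_def case_prod_unfold)
  then have "right_mult \<omega> (\<eta> s) t (X + Y) =
      (\<Sum>r\<leftarrow>all_rvecs. \<Sum>p\<leftarrow>?ps. \<Sum>p'\<leftarrow>?qs. (fst p \<star> fst p') X * (snd p r \<star> (Gvec q r t \<triangleright> snd p' s)) Y)"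
    by (simp add: right_mult_def sum_all_rvecs)
  also have "\<dots> = (\<Sum>p\<leftarrow>?ps. \<Sum>p'\<leftarrow>?qs. \<Sum>r\<leftarrow>all_rvecs. (fst p \<star> fst p') X * (snd p r \<star> (Gvec q r t \<triangleright> snd p' s)) Y)"
    by (simp only: sum_list_swap[where xs = all_rvecs and ys = ?ps] sum_list_swap[where xs = all_rvecs and ys = ?qs])
  also have "\<dots> = (\<Sum>p\<leftarrow>?ps. \<Sum>p'\<leftarrow>?qs. (fst p \<star> fst p') X * right_mult (snd p) (snd p' s) t Y)"
    unfolding right_mult_def sum_fun_apply sum_all_rvecs sum_distrib_left ..
  finally show ?thesis by (simp only: case_prod_unfold)
qed

lemma eval_coact_form:
  assumes "x \<in> words_deg Forms1 2"
  shows "eval_otimes X (on_pairs (\<lambda>\<omega> \<eta>. right_mult \<omega> (\<eta> s) t Y)) (coact (coact_form q) x - otimes unit x)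
    = coeffs_of_tensor x t s (X + Y) - unit X * coeffs_of_tensor x t s Y"
proof -
  have "eval_otimes X (on_pairs (\<lambda>\<omega> \<eta>. right_mult \<omega> (\<eta> s) t Y)) (coact (coact_form q) x)
      = bilin_ext (\<lambda>\<omega> \<eta>. right_mult \<omega> (\<eta> s) t (X + Y)) x"
    by (intro eval_otimes_coact_words_deg_2[OF assms] right_mult_coact)
  then show ?thesis
    by (simp add: eval_otimes_minus eval_otimes_otimes coeffs_of_tensor_def bilin_ext_def)
qed

lemma coact_form_coinvariant:
  assumes z: "z \<in> words_deg Forms1 2" "coeffs_of_tensor z = matrix_form unit m"
  shows "coact (coact_form q) z - otimes unit z \<in> coinvariance_kernel \<A> {0} Forms1 (Omega_ideal q)"
proof -
  have "coact (coact_form q) z \<in> otimes_set \<A> (words_deg Forms1 2)"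
    using z(1) coact_form(1) OqSU3_conv by (rule coact_words_deg_2)
  moreover have "otimes unit (- z) \<in> otimes_set \<A> (words_deg Forms1 2)"
    by (intro otimes_set_base OqSU3_unit flin.subspace_neg subspace_words_deg z(1))
  ultimately have degree: "coact (coact_form q) z - otimes unit z \<in> otimes_set \<A> (words_deg Forms1 2)"
    using otimes_set_add by (fastforce simp: otimes_linear(9))
  have "coact (coact_form q) z - otimes unit z \<in> otimes_set \<A> (Omega_ideal q)"
  proof (rule otimes_set_kernel[OF subspace_words_deg degree])
    fix X and i :: "rvec \<times> rvec \<times> gen word"
    show "eval_otimes X ((\<lambda>(t, s, Y). on_pairs (\<lambda>\<omega> \<eta>. right_mult \<omega> (\<eta> s) t Y)) i)
        (coact (coact_form q) z - otimes unit z) = 0"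
      by (cases i) (simp add: eval_coact_form[OF z(1)] z(2), simp add: unit_def)
  next
    fix x assume x: "x \<in> words_deg Forms1 2"
      and "\<And>i. lin_ext ((\<lambda>(t, s, Y). on_pairs (\<lambda>\<omega> \<eta>. right_mult \<omega> (\<eta> s) t Y)) i) x = 0"
    then have "coeffs_of_tensor x t s Y = 0" for t s Y
      by (auto simp: coeffs_of_tensor_def bilin_ext_def)
    then show "x \<in> Omega_ideal q"
      using mat.subspace_0[OF subspace_quad_rels] by (simp add: Omega_ideal_iff[OF x] zero_fun_def)
  qed
  from coinvariance_kernelI[OF otimes_set_zero this] show ?thesis by simp
qed

definition coinv_form :: "root \<Rightarrow> form1 free_alg"
  where "coinv_form \<gamma> = tensor_of_coeffs (matrix_form unit (fe_matrix \<gamma>))"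

lemma coinv_form_words_deg: "(\<Sum>\<gamma>\<in>UNIV. fscale (c \<gamma>) (coinv_form \<gamma>)) \<in> words_deg Forms1 2"
  unfolding coinv_form_def
  by (intro flin.subspace_sum flin.subspace_scale subspace_words_deg tensor_of_coeffs_words_deg
      matrix_form_Forms2[OF bihom_weight_space[OF bihom_unit]] weight_part_0_matrix_units)

lemma coeffs_of_coinv_form:
  "coeffs_of_tensor (\<Sum>\<gamma>\<in>UNIV. fscale (c \<gamma>) (coinv_form \<gamma>)) = matrix_form unit (\<Sum>\<gamma>\<in>UNIV. mscale (c \<gamma>) (fe_matrix \<gamma>))"
  unfolding coinv_form_def coeffs_of_tensor_sum coeffs_of_tensor_linear coeffs_of_tensor_of_coeffs
    matrix_form_sum matrix_form_mscale ..

lemma coinvariant_form_normal_form: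
  assumes x: "x \<in> words_deg Forms1 2"
    and coinv: "coact (coact_form q) x - otimes unit x \<in> coinvariance_kernel \<A> {0} Forms1 (Omega_ideal q)"
  shows "\<exists>c. O.cong x (\<Sum>\<gamma>\<in>UNIV. fscale (c \<gamma>) (coinv_form \<gamma>))"
proof -
  let ?m = "coeffs_of_tensor x"
  have coinv_coeffs: "(\<lambda>t s. ?m t s (X + Y) - unit X * ?m t s Y) \<in> quad_rels" for X Y
    unfolding eval_coact_form[OF x, symmetric]
    using coinv by (rule eval_coinvariance_kernel[OF _ _ subspace_quad_rels])
      (use coeffs_of_tensor_Omega_ideal in \<open>simp_all add: coeffs_of_tensor_def\<close>)
  have "(\<lambda>t s. (qc powi (wt t i + wt s i) - 1) * ?m t s 0) \<in> quad_rels" for i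
  proof -
    have "?m t s (Word [K i]) = qc powi (wt t i + wt s i) * ?m t s 0" for t s
      using coeffs_of_tensor_Forms2[OF x] weight_space_apply_K[of "?m t s" "wt t + wt s"] by (simp add: Forms2_def)
    then show ?thesis using coinv_coeffs[of "Word [K i]" 0] by (simp add: algebra_simps)
  qed
  from quad_rels_normal_form[OF this]
  obtain c where c: "(\<lambda>t s. ?m t s 0) - (\<Sum>\<gamma>\<in>UNIV. mscale (c \<gamma>) (fe_matrix \<gamma>)) \<in> quad_rels" .
  let ?z = "\<Sum>\<gamma>\<in>UNIV. fscale (c \<gamma>) (coinv_form \<gamma>)"
  have "(\<lambda>t s. coeffs_of_tensor (x - ?z) t s X) \<in> quad_rels" for X
  proof -
    have "(\<lambda>t s. coeffs_of_tensor (x - ?z) t s X) = (\<lambda>t s. ?m t s (X + 0) - unit X * ?m t s 0)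
        + mscale (unit X) ((\<lambda>t s. ?m t s 0) - (\<Sum>\<gamma>\<in>UNIV. mscale (c \<gamma>) (fe_matrix \<gamma>)))"
      unfolding coeffs_of_tensor_linear(2) coeffs_of_coinv_form by (simp add: fun_eq_iff algebra_simps)
    also have "\<dots> \<in> quad_rels"
      by (intro mat.subspace_add mat.subspace_scale subspace_quad_rels coinv_coeffs c)
    finally show ?thesis .
  qed
  then have "x - ?z \<in> Omega_ideal q"
    using flin.subspace_diff[OF subspace_words_deg x coinv_form_words_deg] by (simp add: Omega_ideal_iff)
  then show ?thesis unfolding Omega_ideal_eq O.cong_def by blast
qed

lemma Omega_coinv_eq: "Omega_coinv q 2 = qspan (Omega_ideal q) (cls (Omega_ideal q) ` range coinv_form)"
  using O.coinvariants_eq_qspan[of 2 "coact_form q" \<A> "{0}" coinv_form]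
    coinvariant_form_normal_form coinv_form_words_deg
    coact_form_coinvariant[OF coinv_form_words_deg coeffs_of_coinv_form]
  unfolding Omega_coinv_def Omega1_eq Omega_ideal_eq by blast

lemma coinv_form_independent:
  assumes "(\<Sum>\<gamma>\<in>UNIV. fscale (c \<gamma>) (coinv_form \<gamma>)) \<in> Omega_ideal q" shows "c \<gamma> = 0"
proof (rule fe_matrix_independent)
  have "(\<lambda>t s. matrix_form unit (\<Sum>\<gamma>\<in>UNIV. mscale (c \<gamma>) (fe_matrix \<gamma>)) t s 0) \<in> quad_rels"
    using coeffs_of_tensor_Omega_ideal[OF assms] by (simp only: coeffs_of_coinv_form)
  moreover have "(\<lambda>t s. matrix_form unit m t s 0) = m" for m by (simp add: unit_def)
  ultimately show "(\<Sum>\<gamma>\<in>UNIV. mscale (c \<gamma>) (fe_matrix \<gamma>)) \<in> quad_rels" by (simp only:)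
qed

lemma qdim_Omega_coinv: "qdim (Omega_ideal q) (Omega_coinv q 2) 3"
proof -
  have "qdim O.J (Omega_coinv q 2) (card (UNIV :: root set))"
    using Omega_coinv_eq coinv_form_independent unfolding Omega_ideal_eq by (intro O.qdimI) auto
  then show ?thesis by (simp add: Omega_ideal_eq UNIV_root numeral_3_eq_3)
qed

end

theorem lemma6p3:
  fixes q :: real
  assumes "q \<notin> {-1, 0, 1}"
  shows "qdim (Omega_ideal q) (Omega_coinv q 2) 3 \<and>
    V_coinv q 2 = qspan (V_ideal q)
      {wedge q (f_form A1) (e_form A1), wedge q (f_form A2) (e_form A2), wedge q (f_form A12) (e_form A12)}"
proof -
  interpret quantum_parameter q by standard (fact assms)
  have "cls (V_ideal q) ` range (\<lambda>\<gamma>. lett (f_form \<gamma>) * lett (e_form \<gamma>))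
      = {wedge q (f_form A1) (e_form A1), wedge q (f_form A2) (e_form A2), wedge q (f_form A12) (e_form A12)}"
    unfolding UNIV_root wedge_def by simp
  then show ?thesis using qdim_Omega_coinv V_coinv_eq by simp
qed

end
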